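(* The following identity holds: $$\log\Big(\sum_{n\ge0}\ \sum_{|\rho|=|\eta|=n}\frac{e^{\frac14\kappa_\rho\sqrt{-1}\lambda}}{\prod_{e\in\rho}2\sin(h(e)\lambda/2)}\,\frac{\chi_\rho(\eta)}{z_\eta}\,p_\eta\Big)=-\sum_{d\ge1}\frac{\sqrt{-1}^{\,d+1}\,p_d}{2d\sin(d\lambda/2)},$$ where the inner sum is over all pairs of partitions $\rho,\eta$ of $n$.
   Context: For a partition $\rho=(\rho_1\ge\dots\ge\rho_{l(\rho)}>0)$: $|\rho|=\sum_i\rho_i$, $\kappa_\rho=\sum_{i}\rho_i(\rho_i-2i+1)$; $\rho'$ is the conjugate partition; $e\in\rho$ runs over the squares of the Young diagram, and the hook length of the square $e$ in row $i$ and column $j$ is $h(e)=\rho_i+\rho'_j-i-j+1$. $m_j(\eta)$ is the number of parts of $\eta$ equal to $j$ and $z_\eta=\prod_jm_j(\eta)!\,j^{m_j(\eta)}$. $\chi_\rho(\eta)$ is the value on permutations of cycle type $\eta$ of the irreducible character of $S_n$ indexed by $\rho$ ($\chi_{(n)}$ is trivial, $\chi_{(1^n)}$ is the sign). $p_1,p_2,\dots$ are formal variables and $p_\eta=\prod_ip_{\eta_i}$. The identity is one of formal power series in the $p_i$ whose coefficients are meromorphic functions of $\lambda$; the $n=0$ term is $1$. *)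

theory Defs
  imports
    "HOL-Complex_Analysis.Complex_Analysis"
    "HOL-Combinatorics.Permutations"
    "HOL-Combinatorics.Orbits"
    "HOL-Library.Multiset"
    "HOL-Library.Function_Algebras"
begin

section \<open>The field of meromorphic functions on the complex plane\<close>

text \<open>
  Two functions that are meromorphic on the plane denote the same element of \<open>mero\<close> iff they agree
  outside a discrete closed set. In particular, the values that division by zero assigns at the poles
  are irrelevant.
\<close>

definition mero_eq :: "(complex \<Rightarrow> complex) \<Rightarrow> (complex \<Rightarrow> complex) \<Rightarrow> bool" where
  "mero_eq f g \<longleftrightarrow> f meromorphic_on UNIV \<and> g meromorphic_on UNIV \<and>
     eventually (\<lambda>z. f z = g z) (cosparse UNIV)"

lemma part_equivp_mero_eq: "part_equivp mero_eq"
proof (rule part_equivpI)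
  show "\<exists>f. mero_eq f f"
    by (rule exI[of _ "\<lambda>_. 0"]) (auto simp: mero_eq_def)
  show "symp mero_eq"
    unfolding symp_def mero_eq_def by (auto elim: eventually_mono)
  show "transp mero_eq"
    unfolding transp_def mero_eq_def by (auto elim: eventually_elim2)
qed

quotient_type mero = "complex \<Rightarrow> complex" / partial: mero_eq
  by (rule part_equivp_mero_eq)

text \<open>The element represented by a function (which is only meaningful for meromorphic functions).\<close>

definition mero :: "(complex \<Rightarrow> complex) \<Rightarrow> mero" where
  "mero f = abs_mero f"

instantiation mero :: field
begin

lift_definition zero_mero :: mero is "\<lambda>_. 0"
  by (auto simp: mero_eq_def)

lift_definition one_mero :: mero is "\<lambda>_. 1"
  by (auto simp: mero_eq_def)

lift_definition plus_mero :: "mero \<Rightarrow> mero \<Rightarrow> mero" is "\<lambda>f g z. f z + g z"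
  by (auto simp: mero_eq_def intro!: meromorphic_intros elim: eventually_elim2)

lift_definition minus_mero :: "mero \<Rightarrow> mero \<Rightarrow> mero" is "\<lambda>f g z. f z - g z"
  by (auto simp: mero_eq_def intro!: meromorphic_intros elim: eventually_elim2)

lift_definition uminus_mero :: "mero \<Rightarrow> mero" is "\<lambda>f z. - f z"
  by (auto simp: mero_eq_def intro!: meromorphic_intros elim: eventually_mono)

lift_definition times_mero :: "mero \<Rightarrow> mero \<Rightarrow> mero" is "\<lambda>f g z. f z * g z"
  by (auto simp: mero_eq_def intro!: meromorphic_intros elim: eventually_elim2)

lift_definition inverse_mero :: "mero \<Rightarrow> mero" is "\<lambda>f z. inverse (f z)"
  by (auto simp: mero_eq_def intro!: meromorphic_intros elim: eventually_mono)

lift_definition divide_mero :: "mero \<Rightarrow> mero \<Rightarrow> mero" is "\<lambda>f g z. f z / g z"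
  by (auto simp: mero_eq_def intro!: meromorphic_intros elim: eventually_elim2)

instance
proof
  fix a b c :: mero
  show "a * b * c = a * (b * c)"
    by transfer (auto simp: mero_eq_def mult.assoc intro!: meromorphic_intros)
  show "a * b = b * a"
    by transfer (auto simp: mero_eq_def mult.commute intro!: meromorphic_intros)
  show "1 * a = a"
    by transfer (auto simp: mero_eq_def intro!: meromorphic_intros)
  show "a + b + c = a + (b + c)"
    by transfer (auto simp: mero_eq_def add.assoc intro!: meromorphic_intros)
  show "a + b = b + a"
    by transfer (auto simp: mero_eq_def add.commute intro!: meromorphic_intros)
  show "0 + a = a"
    by transfer (auto simp: mero_eq_def intro!: meromorphic_intros)
  show "- a + a = 0"
    by transfer (auto simp: mero_eq_def intro!: meromorphic_intros)
  show "a - b = a + - b"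
    by transfer (auto simp: mero_eq_def intro!: meromorphic_intros)
  show "(a + b) * c = a * c + b * c"
    by transfer (auto simp: mero_eq_def algebra_simps intro!: meromorphic_intros)
  show "(0 :: mero) \<noteq> 1"
    by transfer (auto simp: mero_eq_def)
  show "a div b = a * inverse b"
    by transfer (auto simp: mero_eq_def field_simps intro!: meromorphic_intros)
  show "inverse (0 :: mero) = 0"
    by transfer (auto simp: mero_eq_def)
  show "inverse a * a = 1" if "a \<noteq> 0"
    using that
  proof transfer
    fix f assume f: "mero_eq f f" and nz: "\<not> mero_eq f (\<lambda>_. 0)"
    have "eventually (\<lambda>z. f z = 0) (cosparse UNIV) \<or> eventually (\<lambda>z. f z \<noteq> 0) (cosparse UNIV)"
      using f by (intro meromorphic_imp_constant_or_avoid) (auto simp: mero_eq_def)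
    hence "eventually (\<lambda>z. f z \<noteq> 0) (cosparse UNIV)"
      using f nz by (auto simp: mero_eq_def)
    hence "eventually (\<lambda>z. inverse (f z) * f z = 1) (cosparse UNIV)"
      by eventually_elim auto
    thus "mero_eq (\<lambda>z. inverse (f z) * f z) (\<lambda>_. 1)"
      using f by (auto simp: mero_eq_def intro!: meromorphic_intros)
  qed
qed

end

lemma of_nat_mero: "of_nat n = mero (\<lambda>_. of_nat n)"
proof (induction n)
  case 0
  show ?case by (simp add: mero_def zero_mero_def)
next
  case (Suc n)
  have "mero_eq (\<lambda>_. 1) (\<lambda>_. 1)" "mero_eq (\<lambda>_. of_nat n) (\<lambda>_. of_nat n)"
    by (auto simp: mero_eq_def)
  from plus_mero.abs_eq[OF this] show ?case
    by (simp add: Suc mero_def one_mero_def)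
qed

instance mero :: field_char_0
proof
  show "inj (of_nat :: nat \<Rightarrow> mero)"
  proof (rule injI)
    fix m n :: nat assume "(of_nat m :: mero) = of_nat n"
    hence "abs_mero (\<lambda>_. of_nat m) = abs_mero (\<lambda>_. of_nat n)"
      by (simp add: of_nat_mero mero_def)
    hence "mero_eq (\<lambda>_. of_nat m) (\<lambda>_. of_nat n)"
      using Quotient_rel[OF Quotient_mero, of "\<lambda>_. of_nat m" "\<lambda>_. of_nat n"]
      by (auto simp: mero_eq_def)
    thus "m = n"
      by (auto simp: mero_eq_def)
  qed
qed


section \<open>Formal power series in infinitely many variables\<close>

text \<open>
  A series in the variables \<open>x\<^sub>v\<close> is the family of its coefficients, indexed by the monomials, that is by
  the finite multisets of variables.
\<close>

typedef ('v, 'a) mfps = "UNIV :: ('v multiset \<Rightarrow> 'a) set"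
  morphisms mfps_coeff Abs_mfps ..

setup_lifting type_definition_mfps

lemma finite_submultisets: "finite {a. a \<subseteq># (m :: 'v multiset)}"
proof (induction m)
  case (add x m)
  have "a \<in> {a. a \<subseteq># m} \<union> add_mset x ` {a. a \<subseteq># m}" if "a \<subseteq># add_mset x m" for a
  proof (cases "x \<in># a")
    case True
    then obtain b where "a = add_mset x b" by (meson mset_add)
    thus ?thesis using that by auto
  next
    case False
    thus ?thesis using that
      by (metis Diff_eq_empty_iff_mset UnI1 mem_Collect_eq diff_add_mset_swap
          add_mset_eq_singleton_iff diff_single_trivial subset_eq_diff_conv add_mset_add_single)
  qed
  thus ?case
    by (intro finite_subset[OF _ finite_UnI[OF add finite_imageI[OF add, of "add_mset x"]]]) auto
qed auto

lemma finite_mset_splits: "finite {(a, b). a + b = (m :: 'v multiset)}"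
  by (rule finite_subset[of _ "{a. a \<subseteq># m} \<times> {a. a \<subseteq># m}"]) (auto simp: finite_submultisets)

lemma finite_mset_splits': "finite {p. fst p + snd p = (m :: 'v multiset)}"
  using finite_mset_splits[of m] by (simp add: case_prod_unfold)

instantiation mfps :: (type, comm_ring_1) comm_ring_1
begin

lift_definition zero_mfps :: "('a, 'b) mfps" is "\<lambda>_. 0" .

lift_definition one_mfps :: "('a, 'b) mfps" is "\<lambda>m. if m = {#} then 1 else 0" .

lift_definition plus_mfps :: "('a, 'b) mfps \<Rightarrow> ('a, 'b) mfps \<Rightarrow> ('a, 'b) mfps"
  is "\<lambda>f g m. f m + g m" .

lift_definition minus_mfps :: "('a, 'b) mfps \<Rightarrow> ('a, 'b) mfps \<Rightarrow> ('a, 'b) mfps"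
  is "\<lambda>f g m. f m - g m" .

lift_definition uminus_mfps :: "('a, 'b) mfps \<Rightarrow> ('a, 'b) mfps"
  is "\<lambda>f m. - f m" .

lift_definition times_mfps :: "('a, 'b) mfps \<Rightarrow> ('a, 'b) mfps \<Rightarrow> ('a, 'b) mfps"
  is "\<lambda>f g m. \<Sum>(a, b) | a + b = m. f a * g b" .

instance
proof
  fix f g h :: "('a, 'b) mfps"
  show "f * g * h = f * (g * h)"
  proof (transfer, rule ext)
    fix f g h :: "'a multiset \<Rightarrow> 'b" and m
    have "(\<Sum>(a, b) | a + b = m. (\<Sum>(c, d) | c + d = a. f c * g d) * h b) =
          (\<Sum>(p, q)\<in>(SIGMA p:{(a, b). a + b = m}. {(c, d). c + d = fst p}).
             f (fst q) * g (snd q) * h (snd p))"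
      by (subst sum.Sigma [symmetric])
         (auto simp: finite_mset_splits' sum_distrib_right case_prod_unfold)
    also have "\<dots> = (\<Sum>(p, q)\<in>(SIGMA p:{(a, b). a + b = m}. {(c, d). c + d = snd p}).
             f (fst p) * g (fst q) * h (snd q))"
      by (rule sum.reindex_bij_witness[of _
            "\<lambda>((a, b), (c, d)). ((a + c, d), (a, c))" "\<lambda>((a, b), (c, d)). ((c, d + b), (d, b))"])
         (auto simp: add.assoc)
    also have "\<dots> = (\<Sum>(a, b) | a + b = m. f a * (\<Sum>(c, d) | c + d = b. g c * h d))"
      by (subst sum.Sigma [symmetric])
         (auto simp: finite_mset_splits' sum_distrib_left case_prod_unfold mult.assoc)
    finally show "(\<Sum>(a, b) | a + b = m. (\<Sum>(c, d) | c + d = a. f c * g d) * h b) =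
      (\<Sum>(a, b) | a + b = m. f a * (\<Sum>(c, d) | c + d = b. g c * h d))" .
  qed
  show "f * g = g * f"
    by (transfer, rule ext,
        rule sum.reindex_bij_witness[of _ "\<lambda>(a, b). (b, a)" "\<lambda>(a, b). (b, a)"])
       (auto simp: mult.commute add.commute)
  show "1 * f = f"
  proof (transfer, rule ext)
    fix f :: "'a multiset \<Rightarrow> 'b" and m
    have "(\<Sum>(a, b) | a + b = m. (if a = {#} then 1 else 0) * f b) =
          (\<Sum>(a, b)\<in>{({#} :: 'a multiset, m)}. (if a = {#} then 1 else 0) * f b)"
      by (rule sum.mono_neutral_right) (auto simp: finite_mset_splits split: if_splits)
    thus "(\<Sum>(a, b) | a + b = m. (if a = {#} then 1 else 0) * f b) = f m"
      by simp
  qed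
  show "f + g + h = f + (g + h)" by transfer (simp add: add.assoc)
  show "f + g = g + f" by transfer (simp add: add.commute)
  show "0 + f = f" by transfer simp
  show "- f + f = 0" by transfer simp
  show "f - g = f + - g" by transfer simp
  show "(f + g) * h = f * h + g * h"
    by transfer (auto simp: case_prod_unfold distrib_right sum.distrib)
  show "(0 :: ('a, 'b) mfps) \<noteq> 1"
    by transfer (metis zero_neq_one)
qed

end

definition mfps_const :: "'a \<Rightarrow> ('v, 'a::comm_ring_1) mfps" where
  "mfps_const c = Abs_mfps (\<lambda>m. if m = {#} then c else 0)"

definition mfps_var :: "'v \<Rightarrow> ('v, 'a::comm_ring_1) mfps" where
  "mfps_var v = Abs_mfps (\<lambda>m. if m = {#v#} then 1 else 0)"

text \<open>
  The formal sum of a possibly infinite family of series, computed coefficientwise. It is meaningful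
  if every monomial occurs in only finitely many members of the family.
\<close>

definition mfps_sum :: "('i \<Rightarrow> ('v, 'a) mfps) \<Rightarrow> 'i set \<Rightarrow> ('v, 'a::comm_ring_1) mfps" where
  "mfps_sum F I = Abs_mfps (\<lambda>m. \<Sum>i | i \<in> I \<and> mfps_coeff (F i) m \<noteq> 0. mfps_coeff (F i) m)"

text \<open>The formal logarithm of a series with constant coefficient 1.\<close>

definition mfps_log :: "('v, 'a) mfps \<Rightarrow> ('v, 'a::field_char_0) mfps" where
  "mfps_log f = mfps_sum (\<lambda>k. mfps_const ((-1) ^ (k + 1) / of_nat k) * (f - 1) ^ k) {1..}"


section \<open>Partitions\<close>

definition partitions :: "nat \<Rightarrow> nat list set" where
  "partitions n = {\<rho>. sorted_wrt (\<ge>) \<rho> \<and> 0 \<notin> set \<rho> \<and> sum_list \<rho> = n}"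

text \<open>Rows and columns of diagrams are numbered from 1; lists are indexed from 0.\<close>

definition part :: "nat list \<Rightarrow> nat \<Rightarrow> nat" where
  "part \<rho> i = \<rho> ! (i - 1)"

definition conj_part :: "nat list \<Rightarrow> nat \<Rightarrow> nat" where
  "conj_part \<rho> j = card {i \<in> {1..length \<rho>}. j \<le> part \<rho> i}"

definition young_diagram :: "nat list \<Rightarrow> (nat \<times> nat) set" where
  "young_diagram \<rho> = {(i, j). i \<in> {1..length \<rho>} \<and> j \<in> {1..part \<rho> i}}"

definition hook_length :: "nat list \<Rightarrow> nat \<times> nat \<Rightarrow> int" where
  "hook_length \<rho> = (\<lambda>(i, j). int (part \<rho> i) + int (conj_part \<rho> j) - int i - int j + 1)"

definition kappa :: "nat list \<Rightarrow> int" where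
  "kappa \<rho> = (\<Sum>i = 1..length \<rho>. int (part \<rho> i) * (int (part \<rho> i) - 2 * int i + 1))"

definition zee :: "nat list \<Rightarrow> nat" where
  "zee \<eta> = (\<Prod>j\<in>set \<eta>. fact (count_list \<eta> j) * j ^ count_list \<eta> j)"


section \<open>Irreducible characters of the symmetric groups\<close>

definition cfun_scale :: "complex \<Rightarrow> ('a \<Rightarrow> complex) \<Rightarrow> 'a \<Rightarrow> complex" where
  "cfun_scale c f = (\<lambda>x. c * f x)"

global_interpretation cfun: vector_space "cfun_scale :: complex \<Rightarrow> ('a \<Rightarrow> complex) \<Rightarrow> 'a \<Rightarrow> complex"
  by standard (auto simp: cfun_scale_def fun_eq_iff algebra_simps)

text \<open>
  The trace of an endomorphism \<open>f\<close> of a finite-dimensional subspace \<open>V\<close>; it does not depend on the basis.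
\<close>

definition trace_on :: "('a \<Rightarrow> complex) set \<Rightarrow> (('a \<Rightarrow> complex) \<Rightarrow> 'a \<Rightarrow> complex) \<Rightarrow> complex" where
  "trace_on V f =
     (let B = (SOME B. B \<subseteq> V \<and> cfun.independent B \<and> cfun.span B = V)
      in \<Sum>b\<in>B. cfun.representation B (f b) b)"

text \<open>
  For a finite set \<open>Y\<close>, the group algebra of the symmetric group of \<open>Y\<close> consists of the complex functions
  supported on the permutations of \<open>Y\<close>; its product is convolution.
\<close>

definition group_algebra :: "'a set \<Rightarrow> (('a \<Rightarrow> 'a) \<Rightarrow> complex) set" where
  "group_algebra Y = {x. \<forall>g. \<not> g permutes Y \<longrightarrow> x g = 0}"

definition conv :: "'a set \<Rightarrow> (('a \<Rightarrow> 'a) \<Rightarrow> complex) \<Rightarrow> (('a \<Rightarrow> 'a) \<Rightarrow> complex) \<Rightarrow> ('a \<Rightarrow> 'a) \<Rightarrow> complex"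
  where "conv Y x y = (\<lambda>g. \<Sum>h | h permutes Y. x h * y (inv h \<circ> g))"

definition perm_elem :: "('a \<Rightarrow> 'a) \<Rightarrow> ('a \<Rightarrow> 'a) \<Rightarrow> complex" where
  "perm_elem g = (\<lambda>h. if h = g then 1 else 0)"

text \<open>
  The symmetric group on \<open>n\<close> letters is realised as the group of permutations of the \<open>n\<close> squares of the
  diagram of \<open>\<rho>\<close>. Then no filling of the diagram has to be chosen: the row and the column stabilisers
  are the groups of permutations that keep every square in its row and column, respectively. The
  irreducible representation indexed by \<open>\<rho>\<close> is the left ideal generated by the Young symmetrizer; it is
  the trivial one for a single row and the sign representation for a single column.
\<close>

definition row_group :: "nat list \<Rightarrow> (nat \<times> nat \<Rightarrow> nat \<times> nat) set" where
  "row_group \<rho> = {g. g permutes young_diagram \<rho> \<and> (\<forall>e. fst (g e) = fst e)}"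

definition column_group :: "nat list \<Rightarrow> (nat \<times> nat \<Rightarrow> nat \<times> nat) set" where
  "column_group \<rho> = {g. g permutes young_diagram \<rho> \<and> (\<forall>e. snd (g e) = snd e)}"

definition young_symmetrizer :: "nat list \<Rightarrow> (nat \<times> nat \<Rightarrow> nat \<times> nat) \<Rightarrow> complex" where
  "young_symmetrizer \<rho> =
     conv (young_diagram \<rho>) (\<Sum>g\<in>row_group \<rho>. perm_elem g)
       (\<Sum>g\<in>column_group \<rho>. cfun_scale (of_int (sign g)) (perm_elem g))"

definition specht_module :: "nat list \<Rightarrow> ((nat \<times> nat \<Rightarrow> nat \<times> nat) \<Rightarrow> complex) set" where
  "specht_module \<rho> =
     (\<lambda>x. conv (young_diagram \<rho>) x (young_symmetrizer \<rho>)) ` group_algebra (young_diagram \<rho>)"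

definition irr_character :: "nat list \<Rightarrow> (nat \<times> nat \<Rightarrow> nat \<times> nat) \<Rightarrow> complex" where
  "irr_character \<rho> g = trace_on (specht_module \<rho>) (\<lambda>x. conv (young_diagram \<rho>) (perm_elem g) x)"

definition cycle_type :: "'a set \<Rightarrow> ('a \<Rightarrow> 'a) \<Rightarrow> nat multiset" where
  "cycle_type Y g = image_mset card (mset_set (orbit g ` Y))"

text \<open>
  The value of the character at the permutations of cycle type \<open>\<eta>\<close>, for partitions \<open>\<rho>\<close> and \<open>\<eta>\<close> of the
  same number. The choice of the permutation does not matter, since permutations of the same cycle type
  are conjugate.
\<close>

definition chi :: "nat list \<Rightarrow> nat list \<Rightarrow> complex" where
  "chi \<rho> \<eta> = irr_character \<rho>
     (SOME g. g permutes young_diagram \<rho> \<and> cycle_type (young_diagram \<rho>) g = mset \<eta>)"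

end

theory Submission
  imports Defs "HOL-Combinatorics.Cycles"
begin

text \<open>
  With \<open>q = exp (- \<i> z)\<close>, comparing coefficients turns the claim into the principal specialization
  \<open>\<Sum>\<^bsub>\<rho>\<^esub> \<chi>\<^sub>\<rho>(\<eta>) q\<^bsup>n(\<rho>)\<^esup> / \<Prod>\<^bsub>e\<^esub> (1 - q\<^bsup>h(e)\<^esup>) = \<Prod>\<^bsub>i\<^esub> 1 / (1 - q\<^bsup>\<eta>\<^sub>i\<^esup>)\<close>, which suffices for \<open>\<bar>q\<bar> < 1\<close> by the
  identity theorem. Frobenius' formula says that \<open>\<chi>\<^sub>\<rho>(\<eta>)\<close> is the coefficient of \<open>x\<^bsup>\<rho>+\<delta>\<^esup>\<close> in the product of
  the power sums \<open>p\<^sub>\<eta>\<close> and the Vandermonde alternant in \<open>N\<close> variables. Evaluating this product at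
  \<open>x\<^sub>i = q\<^sup>i\<close> makes every alternant a Vandermonde determinant, which the hook lengths factorize, and
  \<open>N \<longlonglongrightarrow> \<infinity>\<close> gives the specialization.

  For Frobenius' formula, let \<open>\<phi>\<^sub>\<rho>\<close> be the class function given by these coefficients. Both \<open>\<chi>\<^sub>\<rho>\<close> and
  \<open>\<phi>\<^sub>\<rho>\<close> pair to 0 with the permutation character on the maps of content \<open>\<mu>\<close> unless \<open>\<mu>\<close> is dominated
  by \<open>\<rho>\<close>, and to 1 for \<open>\<mu> = \<rho>\<close>: for \<open>\<chi>\<^sub>\<rho>\<close> by counting fillings of the diagram with distinct
  entries in each column, for \<open>\<phi>\<^sub>\<rho>\<close> by Pieri's rule. Since \<open>\<phi>\<^sub>\<rho>\<close> is an alternating sum of such permutation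
  characters, in which only the leading one is dominated by \<open>\<rho>\<close>, both pair to 1 with \<open>\<phi>\<^sub>\<rho>\<close>. As \<open>\<chi>\<^sub>\<rho>\<close>
  also has norm 1, by von Neumann's lemma on Young symmetrizers, they are equal.
\<close>

section \<open>Formal logarithms\<close>

text \<open>The substitution works because hook lengths minus contents add up to 2 n(\<rho>) + n:
  the exponential of \<open>kappa\<close> and the phases split off from the sines leave q^n(\<rho>)
  and a factor depending on n alone, which spreads over the parts of \<eta>. Alternants exist only
  in finitely many variables, so the specialization is a limit; it can be taken term by term because
  the coefficients, being character values, do not depend on N. The obstacle is that \<chi> is a
  trace on a left ideal while \<phi> is a family of signed counts of maps. They are compared by the
  equality case of Cauchy-Schwarz: both are real-valued, and the norms and the mutual pairing are
  all 1, so the difference has norm 1 - 2 + 1 = 0. On the side of the representation, everything is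
  expressed by the scalar k with c c = k c for the Young symmetrizer c. It cancels from every
  pairing, so that only k \<noteq> 0 has to be known. Symmetric polynomials appear only as weighted
  sets of objects, so that products, symmetry and pairings become bijections between sets of maps
  fixed by a permutation.\<close>

lemma mfps_eqI: "(\<And>m. mfps_coeff f m = mfps_coeff g m) \<Longrightarrow> f = g"
  by (metis ext mfps_coeff_inject)

lemma mfps_coeff_Abs [simp]: "mfps_coeff (Abs_mfps f) = f"
  by (simp add: Abs_mfps_inverse)

lemma mfps_coeff_add: "mfps_coeff (f + g) m = mfps_coeff f m + mfps_coeff g m"
  by transfer simp

lemma mfps_coeff_minus: "mfps_coeff (- f) m = - mfps_coeff f m"
  by transfer simp

lemma mfps_coeff_diff: "mfps_coeff (f - g) m = mfps_coeff f m - mfps_coeff g m"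
  by transfer simp

lemma mfps_coeff_0 [simp]: "mfps_coeff 0 m = 0"
  by transfer simp

lemma mfps_coeff_1: "mfps_coeff 1 m = (if m = {#} then 1 else 0)"
  by transfer simp

lemma mfps_coeff_mult:
  "mfps_coeff (f * g) m = (\<Sum>(a, b) | a + b = m. mfps_coeff f a * mfps_coeff g b)"
  by transfer simp

lemma mfps_coeff_sum: "mfps_coeff (sum F A) m = (\<Sum>i\<in>A. mfps_coeff (F i) m)"
  by (induction A rule: infinite_finite_induct) (auto simp: mfps_coeff_add)

lemma mfps_coeff_const_mult:
  fixes f :: "('v, 'a::comm_ring_1) mfps"
  shows "mfps_coeff (mfps_const c * f) m = c * mfps_coeff f m"
proof -
  have "mfps_coeff (mfps_const c * f) m =
      (\<Sum>(a, b)\<in>{({#} :: 'v multiset, m)}. mfps_coeff (mfps_const c) a * mfps_coeff f b)"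
    unfolding mfps_coeff_mult
    by (rule sum.mono_neutral_right)
       (auto simp: finite_mset_splits mfps_const_def split: if_splits)
  thus ?thesis by (simp add: mfps_const_def)
qed

lemma mfps_coeff_mfps_sum:
  "mfps_coeff (mfps_sum F I) m = (\<Sum>i | i \<in> I \<and> mfps_coeff (F i) m \<noteq> 0. mfps_coeff (F i) m)"
  by (simp add: mfps_sum_def)

lemma mfps_coeff_mfps_sum_superset:
  assumes "finite J" "J \<subseteq> I" "\<And>i. i \<in> I - J \<Longrightarrow> mfps_coeff (F i) m = 0"
  shows "mfps_coeff (mfps_sum F I) m = (\<Sum>i\<in>J. mfps_coeff (F i) m)"
  unfolding mfps_coeff_mfps_sum
  by (rule sum.mono_neutral_left) (use assms in auto)

lemma mfps_coeff_var: "mfps_coeff (mfps_var v) m = (if m = {#v#} then 1 else 0)"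
  by (simp add: mfps_var_def)

lemma mfps_coeff_prod_list_var:
  fixes xs :: "'v list"
  shows "mfps_coeff (prod_list (map mfps_var xs)) m = (if m = mset xs then 1 else (0 :: 'a :: comm_ring_1))"
proof (induction xs arbitrary: m)
  case (Cons x xs)
  let ?P = "prod_list (map mfps_var xs) :: ('v, 'a) mfps"
  have "mfps_coeff (mfps_var x * ?P) m =
      (\<Sum>(a, b)\<in>(if m = mset (x # xs) then {({#x#}, mset xs)} else {}).
         mfps_coeff (mfps_var x) a * mfps_coeff ?P b)"
    unfolding mfps_coeff_mult
    by (rule sum.mono_neutral_right)
       (auto simp: finite_mset_splits mfps_coeff_var Cons split: if_splits)
  thus ?case by (simp add: mfps_coeff_var Cons)
qed (simp add: mfps_coeff_1)

text \<open>The Euler derivation, the sum of x_v d/dx_v over all variables. In characteristic 0 it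
  kills only constants, so this one derivation does for infinitely many variables what d/dx does for
  one.\<close>

definition mfps_euler :: "('v, 'a) mfps \<Rightarrow> ('v, 'a::comm_ring_1) mfps" where
  "mfps_euler f = Abs_mfps (\<lambda>m. of_nat (size m) * mfps_coeff f m)"

lemma mfps_coeff_euler: "mfps_coeff (mfps_euler f) m = of_nat (size m) * mfps_coeff f m"
  by (simp add: mfps_euler_def)

lemma mfps_euler_mult: "mfps_euler (f * g) = mfps_euler f * g + f * mfps_euler g"
proof (rule mfps_eqI)
  fix m
  have "of_nat (size m) * (\<Sum>(a, b) | a + b = m. mfps_coeff f a * mfps_coeff g b) =
      (\<Sum>(a, b) | a + b = m. of_nat (size a) * mfps_coeff f a * mfps_coeff g b +
          mfps_coeff f a * (of_nat (size b) * mfps_coeff g b))"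
    unfolding sum_distrib_left by (rule sum.cong) (auto simp: algebra_simps)
  thus "mfps_coeff (mfps_euler (f * g)) m = mfps_coeff (mfps_euler f * g + f * mfps_euler g) m"
    by (simp add: mfps_coeff_euler mfps_coeff_add mfps_coeff_mult sum.distrib case_prod_unfold)
qed

lemma mfps_euler_power: "mfps_euler (f ^ Suc k) = of_nat (Suc k) * f ^ k * mfps_euler f"
  by (induction k) (auto simp: mfps_euler_mult algebra_simps)

lemma mfps_euler_const_mult: "mfps_euler (mfps_const c * f) = mfps_const c * mfps_euler f"
  by (rule mfps_eqI) (simp add: mfps_coeff_euler mfps_coeff_const_mult)

lemma mfps_euler_sum: "mfps_euler (sum F A) = (\<Sum>i\<in>A. mfps_euler (F i))"
  by (rule mfps_eqI) (simp add: mfps_coeff_euler mfps_coeff_sum sum_distrib_left)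

lemma mfps_coeff_power_eq_0:
  assumes "mfps_coeff f {#} = 0" "size m < k"
  shows "mfps_coeff (f ^ k) m = 0"
  using assms(2)
proof (induction k arbitrary: m)
  case (Suc k)
  have "mfps_coeff f a * mfps_coeff (f ^ k) b = 0" if "a + b = m" for a b
  proof (cases "a = {#}")
    case False
    hence "size b < k" using that Suc.prems by (auto simp: nonempty_has_size)
    thus ?thesis using Suc.IH by simp
  qed (simp add: assms)
  thus ?case by (auto simp: mfps_coeff_mult intro!: sum.neutral)
qed auto

lemma mfps_coeff_mult_power_eq_0:
  assumes "mfps_coeff f {#} = 0" "size m < k"
  shows "mfps_coeff (f ^ k * g) m = 0"
  unfolding mfps_coeff_mult
  by (rule sum.neutral) (use assms in \<open>auto simp: mfps_coeff_power_eq_0\<close>)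

text \<open>The Euler derivative of log f is that of f divided by f, and in characteristic 0 a
  series is determined by its Euler derivative and its constant term. Only a truncation
  \<open>L\<close> of the logarithm is differentiated, so that no infinite sum has to be
  interchanged with the derivation.\<close>

lemma mfps_log_eqI:
  fixes f g :: "('v, 'a::field_char_0) mfps"
  assumes f: "mfps_coeff f {#} = 1" and euler: "mfps_euler f = f * mfps_euler g"
    and g: "mfps_coeff g {#} = 0"
  shows "mfps_log f = g"
proof (rule mfps_eqI)
  fix m :: "'v multiset"
  define u where "u = f - 1"
  \<comment> \<open>\<open>K\<close> exceeds the degree of m, so that the error term
    \<open>(- u) ^ K\<close> of the geometric sum below cannot reach m.\<close>
  define K where "K = Suc (size m)"
  define L where "L = (\<Sum>k<K. mfps_const ((-1) ^ k / of_nat (Suc k)) * u ^ Suc k)"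
  have u0: "mfps_coeff u {#} = 0"
    by (simp add: u_def mfps_coeff_diff mfps_coeff_1 f)
  have *: "mfps_coeff (mfps_log f) m = mfps_coeff L m"
  proof -
    have "mfps_coeff (mfps_log f) m =
        (\<Sum>k\<in>{1..K}. mfps_coeff (mfps_const ((-1) ^ (k + 1) / of_nat k) * u ^ k) m)"
      unfolding mfps_log_def u_def[symmetric]
      by (rule mfps_coeff_mfps_sum_superset)
         (auto simp: mfps_coeff_const_mult K_def mfps_coeff_power_eq_0[OF u0])
    also have "\<dots> = (\<Sum>k<K. mfps_coeff (mfps_const ((-1) ^ k / of_nat (Suc k)) * u ^ Suc k) m)"
      by (rule sum.reindex_bij_witness[of _ Suc "\<lambda>k. k - 1"]) (auto simp: Suc_le_eq gr0_conv_Suc)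
    finally show ?thesis by (simp add: L_def mfps_coeff_sum)
  qed
  \<comment> \<open>The denominator \<open>Suc k\<close> of the logarithmic series cancels the
    factor from differentiating \<open>u ^ Suc k\<close>, which leaves a geometric sum.\<close>
  have cc: "mfps_const ((-1) ^ k / of_nat (Suc k)) * (of_nat (Suc k) * h) = (- 1) ^ k * h"
    for k and h :: "('v, 'a) mfps"
  proof (rule mfps_eqI)
    fix m
    have 1: "mfps_coeff (of_nat n * h) m = of_nat n * mfps_coeff h m" for n
      by (induction n) (auto simp: mfps_coeff_add algebra_simps)
    have 2: "mfps_coeff ((-1) ^ k * h) m = (-1) ^ k * mfps_coeff h m"
      by (induction k) (auto simp: mfps_coeff_minus)
    show "mfps_coeff (mfps_const ((-1) ^ k / of_nat (Suc k)) * (of_nat (Suc k) * h)) m =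
        mfps_coeff ((- 1) ^ k * h) m"
      unfolding mfps_coeff_const_mult 1 2 by (simp del: of_nat_Suc)
  qed
  have "mfps_euler L = (\<Sum>k<K. mfps_const ((-1) ^ k / of_nat (Suc k)) * (of_nat (Suc k) * (u ^ k * mfps_euler u)))"
    unfolding L_def mfps_euler_sum mfps_euler_const_mult mfps_euler_power by (simp only: mult.assoc)
  also have "\<dots> = (\<Sum>k<K. (- u) ^ k) * mfps_euler u"
    unfolding cc sum_distrib_right
    by (rule sum.cong) (simp_all add: mult.assoc[symmetric] power_mult_distrib[symmetric])
  also have "mfps_euler u = (1 + u) * mfps_euler g"
  proof -
    have "mfps_euler u = mfps_euler f"
      by (rule mfps_eqI) (auto simp: mfps_coeff_euler u_def mfps_coeff_diff mfps_coeff_1)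
    thus ?thesis by (simp add: euler u_def)
  qed
  also have "(\<Sum>k<K. (- u) ^ k) * ((1 + u) * mfps_euler g) = (1 - (- u) ^ K) * mfps_euler g"
    using one_diff_power_eq[of "-u" K] by (simp add: mult.assoc[symmetric] mult.commute)
  finally have "mfps_euler L = mfps_euler g - (- u) ^ K * mfps_euler g"
    by (simp add: algebra_simps)
  moreover have "mfps_coeff ((- u) ^ K * mfps_euler g) m = 0"
    by (rule mfps_coeff_mult_power_eq_0) (auto simp: K_def mfps_coeff_minus u0)
  ultimately have "of_nat (size m) * mfps_coeff L m = of_nat (size m) * mfps_coeff g m"
    by (metis mfps_coeff_diff mfps_coeff_euler diff_zero)
  moreover have "mfps_coeff L {#} = 0"
    unfolding L_def mfps_coeff_sum
    by (rule sum.neutral) (auto simp: mfps_coeff_const_mult mfps_coeff_power_eq_0[OF u0] simp del: power_Suc)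
  ultimately show "mfps_coeff (mfps_log f) m = mfps_coeff g m"
    using g * by (cases "m = {#}") auto
qed

text \<open>The hypothesis describes the exponential of a linear series: a variable of multiplicity
  k contributes c^k / k!. As the Euler derivative of a linear series is linear, only the splittings
  that detach a single variable d from m contribute to the product. Each of them yields
  \<open>count m d\<close> times the coefficient of m, and the multiplicities add up to the
  degree.\<close>

lemma mfps_log_exp_linear:
  fixes c :: "nat \<Rightarrow> 'a::field_char_0" and f :: "(nat, 'a) mfps"
  assumes f: "\<And>m. mfps_coeff f m = (if 0 \<in># m then 0 else
      (\<Prod>d\<in>set_mset m. c d ^ count m d / fact (count m d)))"
  shows "mfps_log f = mfps_sum (\<lambda>d. mfps_const (c d) * mfps_var d) {1..}"
proof -
  define g where "g = mfps_sum (\<lambda>d. mfps_const (c d) * mfps_var d) {1..}"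
  have g: "mfps_coeff g m = (\<Sum>d\<in>set_mset m - {0}. if m = {#d#} then c d else 0)" for m
    unfolding g_def by (subst mfps_coeff_mfps_sum_superset[of "set_mset m - {0}"])
       (auto simp: mfps_coeff_const_mult mfps_coeff_var intro!: sum.cong split: if_splits)
  have "mfps_euler f = f * mfps_euler g"
  proof (rule mfps_eqI)
    fix m :: "nat multiset"
    have "mfps_coeff (f * mfps_euler g) m =
        (\<Sum>(a, b)\<in>(\<lambda>d. (m - {#d#}, {#d#})) ` set_mset m.
           mfps_coeff f a * mfps_coeff (mfps_euler g) b)"
      unfolding mfps_coeff_mult
    proof (rule sum.mono_neutral_right)
      show "\<forall>i\<in>{(a, b). a + b = m} - (\<lambda>d. (m - {#d#}, {#d#})) ` set_mset m.
          (case i of (a, b) \<Rightarrow> mfps_coeff f a * mfps_coeff (mfps_euler g) b) = 0"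
        by (auto simp: mfps_coeff_euler g image_iff intro!: sum.neutral split: if_splits)
    qed (auto simp: finite_mset_splits)
    also have "\<dots> = (\<Sum>d\<in>set_mset m. mfps_coeff f (m - {#d#}) * mfps_coeff (mfps_euler g) {#d#})"
      by (subst sum.reindex) (auto simp: inj_on_def)
    also have "\<dots> = (\<Sum>d\<in>set_mset m. of_nat (count m d) * mfps_coeff f m)"
    proof (rule sum.cong)
      fix d assume d: "d \<in> set_mset m"
      then obtain m' where m': "m = add_mset d m'" by (meson mset_add)
      show "mfps_coeff f (m - {#d#}) * mfps_coeff (mfps_euler g) {#d#} = of_nat (count m d) * mfps_coeff f m"
      proof (cases "0 \<in># m")
        case True
        thus ?thesis using m' by (auto simp: f mfps_coeff_euler g)
      next
        case False
        \<comment> \<open>The contribution of all variables other than d, shared by m and by m with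
          one d removed.\<close>
        define R where "R = (\<Prod>e\<in>set_mset m' - {d}. c e ^ count m' e / fact (count m' e))"
        have "mfps_coeff f m' = (\<Prod>e\<in>insert d (set_mset m'). c e ^ count m' e / fact (count m' e))"
          using False m' by (simp add: f) (intro prod.mono_neutral_left, auto simp: not_in_iff)
        also have "\<dots> = c d ^ count m' d / fact (count m' d) * R"
          unfolding R_def by (subst prod.insert_remove) auto
        finally have 1: "mfps_coeff f m' = c d ^ count m' d / fact (count m' d) * R" .
        have "mfps_coeff f m = (\<Prod>e\<in>insert d (set_mset m'). c e ^ count m e / fact (count m e))"
          using False m' by (simp add: f)
        also have "\<dots> = c d ^ count m d / fact (count m d) * R"
          unfolding R_def by (subst prod.insert_remove) (auto simp: m' intro!: prod.cong)
        finally have 2: "mfps_coeff f m = c d ^ count m d / fact (count m d) * R" .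
        show ?thesis using False unfolding 2
          by (simp add: m' 1 mfps_coeff_euler g del: of_nat_Suc)
      qed
    qed auto
    also have "\<dots> = of_nat (size m) * mfps_coeff f m"
      by (simp add: sum_distrib_right[symmetric] size_multiset_overloaded_eq)
    finally show "mfps_coeff (mfps_euler f) m = mfps_coeff (f * mfps_euler g) m"
      by (simp add: mfps_coeff_euler)
  qed
  moreover have "mfps_coeff f {#} = 1" "mfps_coeff g {#} = 0"
    by (auto simp: f g)
  ultimately show ?thesis
    unfolding g_def[symmetric] by (intro mfps_log_eqI)
qed

section \<open>Computing with meromorphic functions\<close>

lemma mero_eq_refl: "f meromorphic_on UNIV \<Longrightarrow> mero_eq f f"
  by (simp add: mero_eq_def)

lemma mero_mult:
  "f meromorphic_on UNIV \<Longrightarrow> g meromorphic_on UNIV \<Longrightarrow> mero f * mero g = mero (\<lambda>z. f z * g z)"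
  unfolding mero_def by (intro times_mero.abs_eq mero_eq_refl)

lemma mero_add:
  "f meromorphic_on UNIV \<Longrightarrow> g meromorphic_on UNIV \<Longrightarrow> mero f + mero g = mero (\<lambda>z. f z + g z)"
  unfolding mero_def by (intro plus_mero.abs_eq mero_eq_refl)

lemma mero_uminus: "f meromorphic_on UNIV \<Longrightarrow> - mero f = mero (\<lambda>z. - f z)"
  unfolding mero_def by (intro uminus_mero.abs_eq mero_eq_refl)

lemma mero_0: "0 = mero (\<lambda>_. 0)"
  by (simp add: mero_def zero_mero_def)

lemma mero_1: "1 = mero (\<lambda>_. 1)"
  by (simp add: mero_def one_mero_def)

lemma mero_sum:
  "(\<And>i. i \<in> A \<Longrightarrow> f i meromorphic_on UNIV) \<Longrightarrow> (\<Sum>i\<in>A. mero (f i)) = mero (\<lambda>z. \<Sum>i\<in>A. f i z)"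
  by (induction A rule: infinite_finite_induct)
     (auto simp: mero_0 intro!: mero_add meromorphic_intros)

lemma mero_prod:
  "(\<And>i. i \<in> A \<Longrightarrow> f i meromorphic_on UNIV) \<Longrightarrow> (\<Prod>i\<in>A. mero (f i)) = mero (\<lambda>z. \<Prod>i\<in>A. f i z)"
  by (induction A rule: infinite_finite_induct)
     (auto simp: mero_1 intro!: mero_mult meromorphic_intros)

lemma mero_power: "f meromorphic_on UNIV \<Longrightarrow> mero f ^ n = mero (\<lambda>z. f z ^ n)"
  by (induction n) (auto simp: mero_1 intro!: mero_mult meromorphic_intros)

lemma mero_divide_of_nat:
  assumes "f meromorphic_on UNIV"
  shows "mero f / of_nat n = mero (\<lambda>z. f z / of_nat n)"
  unfolding of_nat_mero mero_def using assms
  by (intro divide_mero.abs_eq mero_eq_refl) (auto intro!: meromorphic_intros)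

text \<open>The identity theorem: a function meromorphic on the plane either vanishes or is nonzero
  outside a sparse set, and the second alternative is excluded near any point of
  \<open>U\<close>.\<close>

lemma mero_eqI:
  assumes f: "f meromorphic_on UNIV" and g: "g meromorphic_on UNIV"
    and U: "open U" "U \<noteq> {}" and eq: "\<And>z. z \<in> U \<Longrightarrow> f z = g z"
  shows "mero f = mero g"
proof -
  have d: "(\<lambda>z. f z - g z) meromorphic_on UNIV"
    using f g by (intro meromorphic_intros)
  from U obtain z0 where z0: "z0 \<in> U" by blast
  hence "frequently (\<lambda>z. f z - g z = 0) (at z0)"
    using eventually_at_in_open'[OF U(1) z0] eq
    by (intro eventually_frequently) (auto elim!: eventually_mono)
  hence "\<not> eventually (\<lambda>z. f z - g z \<noteq> 0) (at z0)"
    by (simp add: frequently_def)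
  hence "\<not> eventually (\<lambda>z. f z - g z \<noteq> 0) (cosparse UNIV)"
    using eventually_cosparse_imp_eventually_at[of _ UNIV z0 UNIV] by auto
  moreover have "eventually (\<lambda>z. f z - g z = 0) (cosparse UNIV) \<or>
      eventually (\<lambda>z. f z - g z \<noteq> 0) (cosparse UNIV)"
    using d by (intro meromorphic_imp_constant_or_avoid) auto
  ultimately have "mero_eq f g"
    using f g by (simp add: mero_eq_def)
  thus ?thesis
    unfolding mero_def using Quotient_rel_abs[OF Quotient_mero] by blast
qed

lemma meromorphic_exp_mult [meromorphic_intros]: "(\<lambda>z. exp (c * z)) meromorphic_on A"
  by (intro analytic_on_imp_meromorphic_on analytic_intros)

lemma meromorphic_sin_mult: "(\<lambda>z. sin (c * z / 2)) meromorphic_on A"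
  by (intro analytic_on_imp_meromorphic_on analytic_intros) auto

section \<open>Hook lengths\<close>

text \<open>Row lengths numbered from 0 and padded by zeros, so that \<rho> serves as an exponent
  vector in any number of variables.\<close>

definition prow :: "nat list \<Rightarrow> nat \<Rightarrow> nat" where
  "prow \<rho> i = (if i < length \<rho> then \<rho> ! i else 0)"

lemma prow_antimono: "\<rho> \<in> partitions n \<Longrightarrow> i \<le> k \<Longrightarrow> prow \<rho> k \<le> prow \<rho> i"
  by (cases "i = k") (auto simp: partitions_def prow_def sorted_wrt_iff_nth_less)

lemma prow_pos: "\<rho> \<in> partitions n \<Longrightarrow> i < length \<rho> \<Longrightarrow> 0 < prow \<rho> i"
  by (auto simp: partitions_def prow_def) (metis gr0I nth_mem)

lemma sum_prow:
  assumes "\<rho> \<in> partitions n" "length \<rho> \<le> N"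
  shows "(\<Sum>i<N. prow \<rho> i) = n"
proof -
  have "(\<Sum>i<N. prow \<rho> i) = (\<Sum>i<length \<rho>. prow \<rho> i)"
    by (rule sum.mono_neutral_right) (use assms in \<open>auto simp: prow_def\<close>)
  also have "\<dots> = sum_list \<rho>"
    by (simp add: sum_list_sum_nth prow_def atLeast0LessThan)
  finally show ?thesis using assms by (simp add: partitions_def)
qed

lemma partition_length_le:
  assumes "\<rho> \<in> partitions n"
  shows "length \<rho> \<le> n"
proof -
  have "(\<Sum>i<length \<rho>. 1) \<le> (\<Sum>i<length \<rho>. prow \<rho> i)"
    by (rule sum_mono) (use prow_pos[OF assms] in \<open>auto simp: Suc_le_eq\<close>)
  thus ?thesis using sum_prow[OF assms order_refl] by simp
qed

lemma mem_young_diagram_iff: "(i, j) \<in> young_diagram \<rho> \<longleftrightarrow> 1 \<le> i \<and> 1 \<le> j \<and> j \<le> prow \<rho> (i - 1)"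
  by (auto simp: young_diagram_def prow_def part_def split: if_splits)

lemma young_diagram_altdef:
  assumes "length \<rho> \<le> N"
  shows "young_diagram \<rho> = (\<lambda>(i, j). (Suc i, j)) ` (SIGMA i:{..<N}. {1..prow \<rho> i})"
proof -
  have "(i, j) \<in> (\<lambda>(i, j). (Suc i, j)) ` (SIGMA i:{..<N}. {1..prow \<rho> i})"
    if "(i, j) \<in> young_diagram \<rho>" for i j
    using that assms
    by (intro image_eqI[of _ _ "(i - 1, j)"]) (auto simp: mem_young_diagram_iff prow_def split: if_splits)
  thus ?thesis by (auto simp: mem_young_diagram_iff)
qed

lemma finite_young_diagram [simp, intro]: "finite (young_diagram \<rho>)"
  by (subst young_diagram_altdef[OF order_refl]) auto

lemma sum_young_diagram:
  assumes "length \<rho> \<le> N"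
  shows "(\<Sum>e\<in>young_diagram \<rho>. f e) = (\<Sum>i<N. \<Sum>j=1..prow \<rho> i. f (Suc i, j))"
proof -
  have "(\<Sum>e\<in>young_diagram \<rho>. f e) = (\<Sum>p\<in>(SIGMA i:{..<N}. {1..prow \<rho> i}). f (Suc (fst p), snd p))"
    unfolding young_diagram_altdef[OF assms]
    by (subst sum.reindex) (auto simp: inj_on_def case_prod_unfold)
  also have "\<dots> = (\<Sum>i<N. \<Sum>j=1..prow \<rho> i. f (Suc i, j))"
    by (subst sum.Sigma) (auto simp: case_prod_unfold)
  finally show ?thesis .
qed

lemma prod_young_diagram:
  assumes "length \<rho> \<le> N"
  shows "(\<Prod>e\<in>young_diagram \<rho>. f e) = (\<Prod>i<N. \<Prod>j=1..prow \<rho> i. f (Suc i, j))"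
proof -
  have "(\<Prod>e\<in>young_diagram \<rho>. f e) = (\<Prod>p\<in>(SIGMA i:{..<N}. {1..prow \<rho> i}). f (Suc (fst p), snd p))"
    unfolding young_diagram_altdef[OF assms]
    by (subst prod.reindex) (auto simp: inj_on_def case_prod_unfold)
  also have "\<dots> = (\<Prod>i<N. \<Prod>j=1..prow \<rho> i. f (Suc i, j))"
    by (subst prod.Sigma) (auto simp: case_prod_unfold)
  finally show ?thesis .
qed

lemma card_young_diagram: "\<rho> \<in> partitions n \<Longrightarrow> card (young_diagram \<rho>) = n"
  using sum_young_diagram[OF order_refl, of "\<lambda>_. 1::nat" \<rho>] sum_prow[OF _ order_refl, of \<rho> n] by simp

lemma down_closed_eq_atLeastAtMost:
  fixes S :: "nat set"
  assumes "finite S" "0 \<notin> S" "\<And>i k. i \<in> S \<Longrightarrow> 1 \<le> k \<Longrightarrow> k \<le> i \<Longrightarrow> k \<in> S"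
  shows "S = {1..card S}"
proof (cases "S = {}")
  case False
  have "S = {1..Max S}"
  proof (intro equalityI subsetI)
    fix x assume "x \<in> S"
    thus "x \<in> {1..Max S}" using assms(1,2) by (cases x) auto
  next
    fix x assume "x \<in> {1..Max S}"
    thus "x \<in> S" using assms(3)[of "Max S" x] Max_in[OF assms(1) False] by auto
  qed
  thus ?thesis by (metis card_atLeastAtMost diff_Suc_1 One_nat_def)
qed auto

text \<open>The rows of length at least j form an initial segment, whose size is by definition the
  length of column j.\<close>

lemma le_conj_part_iff:
  assumes "\<rho> \<in> partitions n" "1 \<le> k" "1 \<le> j"
  shows "k \<le> conj_part \<rho> j \<longleftrightarrow> j \<le> prow \<rho> (k - 1)"
proof -
  let ?S = "{i \<in> {1..length \<rho>}. j \<le> part \<rho> i}"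
  have S: "i \<in> ?S \<longleftrightarrow> 1 \<le> i \<and> j \<le> prow \<rho> (i - 1)" for i
    using assms(3) by (auto simp: prow_def part_def)
  have "?S = {1..card ?S}"
  proof (rule down_closed_eq_atLeastAtMost)
    fix i k assume "i \<in> ?S" "1 \<le> k" "k \<le> i"
    thus "k \<in> ?S" unfolding S
      using prow_antimono[OF assms(1), of "k - 1" "i - 1"] by (auto intro: order_trans diff_le_mono)
  qed auto
  hence "k \<in> ?S \<longleftrightarrow> k \<in> {1..conj_part \<rho> j}"
    by (simp add: conj_part_def)
  thus ?thesis using assms S by auto
qed

lemma hook_length_Suc:
  "hook_length \<rho> (Suc i, j) = int (prow \<rho> i) + int (conj_part \<rho> j) - int i - int j"
  if "1 \<le> j" "j \<le> prow \<rho> i"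
  using that by (auto simp: hook_length_def part_def prow_def split: if_splits)

text \<open>The exponents \<rho> + \<delta> of the alternant that belongs to \<rho>, also known as
  beta-numbers.\<close>

definition beta :: "nat \<Rightarrow> nat list \<Rightarrow> nat \<Rightarrow> nat" where
  "beta N \<rho> i = prow \<rho> i + (N - 1 - i)"

lemma beta_strict:
  assumes "\<rho> \<in> partitions n" "i < k" "k < N"
  shows "beta N \<rho> k < beta N \<rho> i"
  using prow_antimono[OF assms(1), of i k] assms by (auto simp: beta_def)

text \<open>The classical complementarity: the hook lengths of row i and the differences to the
  beta-numbers of the lower rows together exhaust 1, ..., \<open>beta N \<rho> i\<close>. Each
  family is strictly monotone, hence injective; the two are disjoint, and their sizes
  \<open>prow \<rho> i\<close> and N - 1 - i add up to the right number.\<close>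

lemma hook_lengths_in_row:
  assumes \<rho>: "\<rho> \<in> partitions n" and N: "length \<rho> \<le> N" and i: "i < N"
  shows "inj_on (\<lambda>j. nat (hook_length \<rho> (Suc i, j))) {1..prow \<rho> i}" (is "inj_on ?h ?J")
    and "inj_on (\<lambda>k. beta N \<rho> i - beta N \<rho> k) {i<..<N}" (is "inj_on ?b ?K")
    and "(\<lambda>j. nat (hook_length \<rho> (Suc i, j))) ` {1..prow \<rho> i} \<inter>
           (\<lambda>k. beta N \<rho> i - beta N \<rho> k) ` {i<..<N} = {}"
    and "(\<lambda>j. nat (hook_length \<rho> (Suc i, j))) ` {1..prow \<rho> i} \<union>
           (\<lambda>k. beta N \<rho> i - beta N \<rho> k) ` {i<..<N} = {1..beta N \<rho> i}"
    and "\<And>j. j \<in> {1..prow \<rho> i} \<Longrightarrow> hook_length \<rho> (Suc i, j) > 0"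
proof -
  have c1: "Suc i \<le> conj_part \<rho> j" if "j \<in> ?J" for j
    using that le_conj_part_iff[OF \<rho>, of "Suc i" j] by auto
  have cN: "conj_part \<rho> j \<le> N" if "j \<in> ?J" for j
  proof (rule ccontr)
    assume "\<not> conj_part \<rho> j \<le> N"
    hence "j \<le> prow \<rho> N" using le_conj_part_iff[OF \<rho>, of "Suc N" j] that by auto
    thus False using that N by (auto simp: prow_def)
  qed
  have cmono: "conj_part \<rho> j' \<le> conj_part \<rho> j" if "j \<in> ?J" "j' \<in> ?J" "j \<le> j'" for j j'
    using that le_conj_part_iff[OF \<rho>, of "conj_part \<rho> j'" j]
      le_conj_part_iff[OF \<rho>, of "conj_part \<rho> j'" j'] c1[of j'] by auto
  have h: "int (?h j) = int (prow \<rho> i) + int (conj_part \<rho> j) - int i - int j" 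
    and hpos: "hook_length \<rho> (Suc i, j) > 0" if "j \<in> ?J" for j
    using that c1[OF that] by (auto simp: hook_length_Suc)
  show "\<And>j. j \<in> ?J \<Longrightarrow> hook_length \<rho> (Suc i, j) > 0" by (fact hpos)
  have dec: "?h j' < ?h j" if "j \<in> ?J" "j' \<in> ?J" "j < j'" for j j'
    using h[OF that(1)] h[OF that(2)] cmono[OF that(1,2)] that(3) by linarith
  show inj_h: "inj_on ?h ?J"
    by (rule linorder_inj_onI') (use dec in fastforce)
  have b: "int (?b k) = int (prow \<rho> i) - int i - int (prow \<rho> k) + int k"
    "prow \<rho> k \<le> prow \<rho> i" if "k \<in> ?K" for k
    using that i prow_antimono[OF \<rho>, of i k] by (auto simp: beta_def)
  have binc: "?b k < ?b k'" if "k \<in> ?K" "k' \<in> ?K" "k < k'" for k k'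
    using b[OF that(1)] b[OF that(2)] prow_antimono[OF \<rho>, of k k'] that(3) by linarith
  show inj_b: "inj_on ?b ?K"
    by (rule linorder_inj_onI') (use binc in fastforce)
  have ne: "?h j \<noteq> ?b k" if "j \<in> ?J" "k \<in> ?K" for j k
  proof
    assume "?h j = ?b k"
    hence *: "int (conj_part \<rho> j) + int (prow \<rho> k) = int j + int k"
      using h[OF that(1)] b[OF that(2)] by linarith
    \<comment> \<open>The square (Suc k, j) lies in the diagram or not. Accordingly, the sum of
      \<open>conj_part \<rho> j\<close> and \<open>prow \<rho> k\<close> is larger or smaller than j
      + k, so that it never equals j + k.\<close>
    have **: "Suc k \<le> conj_part \<rho> j \<longleftrightarrow> j \<le> prow \<rho> k"
      using le_conj_part_iff[OF \<rho>, of "Suc k" j] that by auto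
    show False
      using * ** by (cases "j \<le> prow \<rho> k") linarith+
  qed
  show disj: "?h ` ?J \<inter> ?b ` ?K = {}"
    using ne by blast
  show "?h ` ?J \<union> ?b ` ?K = {1..beta N \<rho> i}"
  proof (rule card_subset_eq)
    show "?h ` ?J \<union> ?b ` ?K \<subseteq> {1..beta N \<rho> i}"
    proof -
      have "?h j \<in> {1..beta N \<rho> i}" if "j \<in> ?J" for j
      proof -
        have "int (?h j) \<le> int (prow \<rho> i) + int N - int i - 1"
          using h[OF that] cN[OF that] that by auto
        moreover have "int (?h j) > 0" using hpos[OF that] by simp
        ultimately have "1 \<le> ?h j" "?h j \<le> beta N \<rho> i"
          using i unfolding beta_def by linarith+
        thus ?thesis by simp
      qed
      moreover have "?b k \<in> {1..beta N \<rho> i}" if "k \<in> ?K" for k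
        using that beta_strict[OF \<rho>, of i k N] by auto
      ultimately show ?thesis by blast
    qed
    have "card (?h ` ?J \<union> ?b ` ?K) = prow \<rho> i + (N - 1 - i)"
      using disj inj_h inj_b by (subst card_Un_disjoint) (auto simp: card_image)
    thus "card (?h ` ?J \<union> ?b ` ?K) = card {1..beta N \<rho> i}"
      by (simp add: beta_def)
  qed auto
qed

lemma hook_length_pos: "\<rho> \<in> partitions n \<Longrightarrow> e \<in> young_diagram \<rho> \<Longrightarrow> hook_length \<rho> e > 0"
  using hook_lengths_in_row(5)[of \<rho> n "length \<rho>"]
  by (subst (asm) young_diagram_altdef[OF order_refl]) auto

section \<open>q-Pochhammer symbols and Vandermonde products at powers of q\<close>

definition qpoch :: "complex \<Rightarrow> nat \<Rightarrow> complex" where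
  "qpoch q m = (\<Prod>k=1..m. 1 - q ^ k)"

definition hook_prod :: "complex \<Rightarrow> nat list \<Rightarrow> complex" where
  "hook_prod q \<rho> = (\<Prod>e\<in>young_diagram \<rho>. 1 - q ^ nat (hook_length \<rho> e))"

lemma prod_beta_hook:
  assumes \<rho>: "\<rho> \<in> partitions n" and N: "length \<rho> \<le> N"
  shows "(\<Prod>i<N. \<Prod>k\<in>{i<..<N}. 1 - q ^ (beta N \<rho> i - beta N \<rho> k)) * hook_prod q \<rho> =
           (\<Prod>i<N. qpoch q (beta N \<rho> i))"
  unfolding hook_prod_def prod_young_diagram[OF N] prod.distrib[symmetric]
proof (rule prod.cong)
  fix i assume "i \<in> {..<N}"
  hence i: "i < N" by simp
  let ?h = "\<lambda>j. nat (hook_length \<rho> (Suc i, j))" and ?b = "\<lambda>k. beta N \<rho> i - beta N \<rho> k"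
  note * = hook_lengths_in_row[OF \<rho> N i]
  have "qpoch q (beta N \<rho> i) = (\<Prod>k\<in>?h ` {1..prow \<rho> i} \<union> ?b ` {i<..<N}. 1 - q ^ k)"
    unfolding *(4) by (simp add: qpoch_def)
  also have "\<dots> = (\<Prod>k\<in>?h ` {1..prow \<rho> i}. 1 - q ^ k) * (\<Prod>k\<in>?b ` {i<..<N}. 1 - q ^ k)"
    using *(3) by (intro prod.union_disjoint) auto
  also have "\<dots> = (\<Prod>j=1..prow \<rho> i. 1 - q ^ ?h j) * (\<Prod>k\<in>{i<..<N}. 1 - q ^ ?b k)"
    using *(1,2) by (simp add: prod.reindex)
  finally show "(\<Prod>k\<in>{i<..<N}. 1 - q ^ ?b k) * (\<Prod>j=1..prow \<rho> i. 1 - q ^ ?h j) = qpoch q (beta N \<rho> i)"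
    by simp
qed auto

definition vander :: "nat \<Rightarrow> (nat \<Rightarrow> complex) \<Rightarrow> complex" where
  "vander N y = (\<Prod>j<N. \<Prod>i<j. y j - y i)"

lemma prod_lessThan_swap:
  fixes N :: nat
  shows "(\<Prod>j<N. \<Prod>i<j. f i j) = (\<Prod>i<N. \<Prod>j\<in>{i<..<N}. f i j)"
proof -
  have "(\<Prod>j<N. \<Prod>i<j. f i j) = (\<Prod>p\<in>(SIGMA j:{..<N}. {..<j}). f (snd p) (fst p))"
    by (subst prod.Sigma) (auto simp: case_prod_unfold)
  also have "\<dots> = (\<Prod>p\<in>(SIGMA i:{..<N}. {i<..<N}). f (fst p) (snd p))"
    by (rule prod.reindex_bij_witness[of _ prod.swap prod.swap]) auto
  also have "\<dots> = (\<Prod>i<N. \<Prod>j\<in>{i<..<N}. f i j)"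
    by (subst prod.Sigma) (auto simp: case_prod_unfold)
  finally show ?thesis .
qed

text \<open>From each difference the power with the smaller exponent, that of the lower row j, is
  factored out. Row j is the lower one in j pairs, which explains the exponent of q; the remaining
  factors are those complementary to the hooks.\<close>

lemma vander_hook:
  assumes \<rho>: "\<rho> \<in> partitions n" and N: "length \<rho> \<le> N"
  shows "vander N (\<lambda>i. q ^ beta N \<rho> i) * hook_prod q \<rho> =
    q ^ (\<Sum>j<N. j * beta N \<rho> j) * (\<Prod>i<N. qpoch q (beta N \<rho> i))"
proof -
  have "vander N (\<lambda>i. q ^ beta N \<rho> i) =
      (\<Prod>j<N. \<Prod>i<j. q ^ beta N \<rho> j * (1 - q ^ (beta N \<rho> i - beta N \<rho> j)))"
    unfolding vander_def
  proof (intro prod.cong refl)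
    fix i j assume "j \<in> {..<N}" "i \<in> {..<j}"
    hence "beta N \<rho> j < beta N \<rho> i" using beta_strict[OF \<rho>] by auto
    thus "q ^ beta N \<rho> j - q ^ beta N \<rho> i = q ^ beta N \<rho> j * (1 - q ^ (beta N \<rho> i - beta N \<rho> j))"
      by (simp add: algebra_simps flip: power_add)
  qed
  also have "\<dots> = (\<Prod>j<N. q ^ (j * beta N \<rho> j)) * (\<Prod>j<N. \<Prod>i<j. 1 - q ^ (beta N \<rho> i - beta N \<rho> j))"
    by (simp add: prod.distrib power_mult[symmetric] mult.commute)
  also have "(\<Prod>j<N. \<Prod>i<j. 1 - q ^ (beta N \<rho> i - beta N \<rho> j)) =
      (\<Prod>i<N. \<Prod>j\<in>{i<..<N}. 1 - q ^ (beta N \<rho> i - beta N \<rho> j))"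
    by (rule prod_lessThan_swap)
  finally show ?thesis
    using prod_beta_hook[OF \<rho> N, of q] by (simp add: power_sum mult.assoc)
qed

lemma power_neq_1: "norm (q :: complex) < 1 \<Longrightarrow> 0 < k \<Longrightarrow> 1 - q ^ k \<noteq> 0"
  by (metis eq_iff_diff_eq_0 norm_one norm_power power_eq_1_iff not_less_iff_gr_or_eq norm_ge_zero
      power_less_one_iff less_irrefl)

lemma qpoch_nonzero: "norm q < 1 \<Longrightarrow> qpoch q m \<noteq> 0"
  using power_neq_1 by (auto simp: qpoch_def)

lemma hook_prod_nonzero: "norm q < 1 \<Longrightarrow> \<rho> \<in> partitions n \<Longrightarrow> hook_prod q \<rho> \<noteq> 0"
  using power_neq_1 hook_length_pos by (auto simp: hook_prod_def)

lemma qpoch_add: "qpoch q (m + k) = qpoch q m * (\<Prod>j=1..k. 1 - q ^ (m + j))"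
  by (induction k) (auto simp: qpoch_def)

text \<open>The statistic n(\<rho>) of the theory of symmetric functions.\<close>

definition nrow :: "nat list \<Rightarrow> nat" where
  "nrow \<rho> = (\<Sum>i<length \<rho>. i * prow \<rho> i)"

text \<open>The contributions of \<delta> to the exponent of q cancel, which leaves n(\<rho>). The
  quotients of Pochhammer symbols leave one factor for each square of the diagram, a number that
  does not depend on N.\<close>

lemma vander_ratio:
  assumes \<rho>: "\<rho> \<in> partitions n" and N: "length \<rho> \<le> N" and q: "norm q < 1" "q \<noteq> 0"
  shows "vander N (\<lambda>i. q ^ beta N \<rho> i) / vander N (\<lambda>i. q ^ (N - 1 - i)) =
    q ^ nrow \<rho> / hook_prod q \<rho> * (\<Prod>i<length \<rho>. \<Prod>j=1..prow \<rho> i. 1 - q ^ (N - 1 - i + j))"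
    and "vander N (\<lambda>i. q ^ (N - 1 - i)) \<noteq> 0"
proof -
  \<comment> \<open>The denominator is the numerator for the empty partition, whose hook product is
    1.\<close>
  have d: "vander N (\<lambda>i. q ^ (N - 1 - i)) = q ^ (\<Sum>j<N. j * (N - 1 - j)) * (\<Prod>i<N. qpoch q (N - 1 - i))"
    using vander_hook[of "[]" 0 N q]
    by (simp add: partitions_def beta_def prow_def hook_prod_def young_diagram_def)
  show d0: "vander N (\<lambda>i. q ^ (N - 1 - i)) \<noteq> 0"
    unfolding d using q qpoch_nonzero by auto
  have "(\<Sum>j<N. j * beta N \<rho> j) = (\<Sum>j<N. j * (N - 1 - j)) + (\<Sum>j<N. j * prow \<rho> j)"
    unfolding sum.distrib[symmetric] by (rule sum.cong) (simp_all only: beta_def distrib_left add.commute)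
  also have "(\<Sum>j<N. j * prow \<rho> j) = nrow \<rho>"
    unfolding nrow_def by (rule sum.mono_neutral_right) (use N in \<open>auto simp: prow_def\<close>)
  finally have 1: "(\<Sum>j<N. j * beta N \<rho> j) = (\<Sum>j<N. j * (N - 1 - j)) + nrow \<rho>" .
  have "(\<Prod>i<N. qpoch q (beta N \<rho> i)) =
      (\<Prod>i<N. qpoch q (N - 1 - i)) * (\<Prod>i<N. \<Prod>j=1..prow \<rho> i. 1 - q ^ (N - 1 - i + j))"
    unfolding beta_def prod.distrib[symmetric]
    by (rule prod.cong) (simp_all only: add.commute[of "prow _ _"] qpoch_add)
  also have "(\<Prod>i<N. \<Prod>j=1..prow \<rho> i. 1 - q ^ (N - 1 - i + j)) =
      (\<Prod>i<length \<rho>. \<Prod>j=1..prow \<rho> i. 1 - q ^ (N - 1 - i + j))"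
    by (rule prod.mono_neutral_right) (use N in \<open>auto simp: prow_def\<close>)
  finally have "vander N (\<lambda>i. q ^ beta N \<rho> i) * hook_prod q \<rho> = vander N (\<lambda>i. q ^ (N - 1 - i)) *
      (q ^ nrow \<rho> * (\<Prod>i<length \<rho>. \<Prod>j=1..prow \<rho> i. 1 - q ^ (N - 1 - i + j)))"
    unfolding vander_hook[OF \<rho> N] d 1 by (simp add: power_add)
  thus "vander N (\<lambda>i. q ^ beta N \<rho> i) / vander N (\<lambda>i. q ^ (N - 1 - i)) =
    q ^ nrow \<rho> / hook_prod q \<rho> * (\<Prod>i<length \<rho>. \<Prod>j=1..prow \<rho> i. 1 - q ^ (N - 1 - i + j))"
    using d0 hook_prod_nonzero[OF q(1) \<rho>] by (simp add: field_simps)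
qed

lemma tendsto_vander_ratio:
  assumes \<rho>: "\<rho> \<in> partitions n" and q: "norm q < 1" "q \<noteq> 0"
  shows "(\<lambda>N. vander N (\<lambda>i. q ^ beta N \<rho> i) / vander N (\<lambda>i. q ^ (N - 1 - i)))
    \<longlonglongrightarrow> q ^ nrow \<rho> / hook_prod q \<rho>"
proof -
  have *: "(\<lambda>N. q ^ (N - 1 - i + j)) \<longlonglongrightarrow> 0" for i j
  proof -
    have "(\<lambda>N. q ^ N) \<longlonglongrightarrow> 0" using q(1) by (rule LIMSEQ_power_zero)
    hence "(\<lambda>N. q ^ (N + j)) \<longlonglongrightarrow> 0" by (rule LIMSEQ_ignore_initial_segment)
    \<comment> \<open>Shifting N by \<open>Suc i\<close> makes the truncated subtraction
      exact.\<close>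
    hence "(\<lambda>N. q ^ ((N + Suc i) - 1 - i + j)) \<longlonglongrightarrow> 0" by simp
    thus ?thesis by (rule LIMSEQ_offset)
  qed
  have "(\<lambda>N. q ^ nrow \<rho> / hook_prod q \<rho> * (\<Prod>i<length \<rho>. \<Prod>j=1..prow \<rho> i. 1 - q ^ (N - 1 - i + j)))
    \<longlonglongrightarrow> q ^ nrow \<rho> / hook_prod q \<rho> * (\<Prod>i<length \<rho>. \<Prod>j=1..prow \<rho> i. 1 - 0)"
    by (intro tendsto_intros *)
  moreover have "eventually (\<lambda>N. q ^ nrow \<rho> / hook_prod q \<rho> *
      (\<Prod>i<length \<rho>. \<Prod>j=1..prow \<rho> i. 1 - q ^ (N - 1 - i + j)) =
      vander N (\<lambda>i. q ^ beta N \<rho> i) / vander N (\<lambda>i. q ^ (N - 1 - i))) sequentially"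
    using eventually_ge_at_top[of "length \<rho>"]
    by eventually_elim (use vander_ratio(1)[OF \<rho> _ q] in simp)
  ultimately show ?thesis by (simp add: tendsto_cong)
qed

section \<open>From trigonometric terms to powers of q\<close>

text \<open>A hook consists of an arm, a leg and the square itself. Reversing each row turns the arm
  length into j - 1 and reversing each column turns the leg length into i - 1, without changing the
  sums.\<close>

lemma sum_hook_length:
  assumes \<rho>: "\<rho> \<in> partitions n"
  shows "(\<Sum>e\<in>young_diagram \<rho>. hook_length \<rho> e) = (\<Sum>(i, j)\<in>young_diagram \<rho>. int i + int j - 1)"
proof -
  have mem: "(i, j) \<in> young_diagram \<rho> \<longleftrightarrow> 1 \<le> i \<and> 1 \<le> j \<and> i \<le> conj_part \<rho> j" for i j
    using le_conj_part_iff[OF \<rho>, of i j] by (auto simp: mem_young_diagram_iff)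
  have part: "part \<rho> i = prow \<rho> (i - 1)" if "(i, j) \<in> young_diagram \<rho>" for i j
    using that by (auto simp: mem_young_diagram_iff part_def prow_def split: if_splits)
  have "(\<Sum>e\<in>young_diagram \<rho>. hook_length \<rho> e) =
      (\<Sum>(i, j)\<in>young_diagram \<rho>. int (prow \<rho> (i - 1)) - int j) +
      (\<Sum>(i, j)\<in>young_diagram \<rho>. int (conj_part \<rho> j) - int i) + (\<Sum>(i, j)\<in>young_diagram \<rho>. 1)"
    unfolding sum.distrib[symmetric]
    by (rule sum.cong) (auto simp: hook_length_def part case_prod_unfold)
  also have "(\<Sum>(i, j)\<in>young_diagram \<rho>. int (prow \<rho> (i - 1)) - int j) =
      (\<Sum>(i, j)\<in>young_diagram \<rho>. int j - 1)"
    by (rule sum.reindex_bij_witness[of _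
          "\<lambda>(i, j). (i, prow \<rho> (i - 1) + 1 - j)" "\<lambda>(i, j). (i, prow \<rho> (i - 1) + 1 - j)"])
       (auto simp: mem_young_diagram_iff)
  also have "(\<Sum>(i, j)\<in>young_diagram \<rho>. int (conj_part \<rho> j) - int i) =
      (\<Sum>(i, j)\<in>young_diagram \<rho>. int i - 1)"
    by (rule sum.reindex_bij_witness[of _
          "\<lambda>(i, j). (conj_part \<rho> j + 1 - i, j)" "\<lambda>(i, j). (conj_part \<rho> j + 1 - i, j)"])
       (auto simp: mem)
  also have "(\<Sum>(i, j)\<in>young_diagram \<rho>. int j - 1) + (\<Sum>(i, j)\<in>young_diagram \<rho>. int i - 1) +
      (\<Sum>(i, j)\<in>young_diagram \<rho>. 1) = (\<Sum>(i, j)\<in>young_diagram \<rho>. int i + int j - 1)"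
    unfolding sum.distrib[symmetric] by (rule sum.cong) auto
  finally show ?thesis .
qed

lemma kappa_conv_content: "kappa \<rho> = 2 * (\<Sum>(i, j)\<in>young_diagram \<rho>. int j - int i)"
proof -
  have *: "2 * (\<Sum>j=1..m. int j - int (Suc i)) = int m * (int m - 2 * int i - 1)" for m i
    by (induction m) (auto simp: algebra_simps)
  have "2 * (\<Sum>(i, j)\<in>young_diagram \<rho>. int j - int i) =
      (\<Sum>i<length \<rho>. int (prow \<rho> i) * (int (prow \<rho> i) - 2 * int i - 1))"
    by (subst sum_young_diagram[OF order_refl]) (simp only: prod.case sum_distrib_left[of 2] flip: *)
  also have "\<dots> = kappa \<rho>"
    unfolding kappa_def
    by (rule sum.reindex_bij_witness[of _ "\<lambda>i. i - 1" Suc]) (auto simp: part_def prow_def)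
  finally show ?thesis ..
qed

text \<open>Euler's formula with the phase factored out. The phase is a power of
  \<open>exp (- \<i> * z / 2)\<close>, a square root of q, so that the phases of several hooks
  combine by adding integers.\<close>

lemma two_sin_half:
  "2 * sin (of_int h * z / 2) =
    - \<i> * exp (of_int (- h) * (- \<i> * z / 2)) * (1 - exp (- \<i> * z) ^ nat h)" if "h > 0"
proof -
  have 1: "exp (- \<i> * z) ^ nat h = exp (of_int h * (- \<i> * z))"
    using that by (simp add: exp_of_nat_mult[symmetric])
  have 2: "exp (of_int (- h) * (- \<i> * z / 2)) * exp (of_int h * (- \<i> * z)) =
      exp (- \<i> * (of_int h * z / 2))"
    unfolding exp_add[symmetric] by (simp add: field_simps)
  have 3: "exp (of_int (- h) * (- \<i> * z / 2)) = exp (\<i> * (of_int h * z / 2))"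
    by (simp add: algebra_simps)
  have "- \<i> * exp (of_int (- h) * (- \<i> * z / 2)) * (1 - exp (- \<i> * z) ^ nat h) =
      - \<i> * (exp (\<i> * (of_int h * z / 2)) - exp (- \<i> * (of_int h * z / 2)))"
    unfolding 1 2[symmetric] 3[symmetric] by (simp only: right_diff_distrib mult_1_right mult.assoc)
  thus ?thesis by (simp add: sin_exp_eq field_simps)
qed

text \<open>The phases of the sines and the exponential of \<open>kappa\<close> combine to a power
  of the square root of q. Its exponent is the sum of the hook lengths minus the sum of the
  contents; after the rearrangement in \<open>sum_hook_length\<close>, a square (i, j) contributes
  (i + j - 1) - (j - i) = 2 (i - 1) + 1.\<close>

lemma hook_term:
  assumes \<rho>: "\<rho> \<in> partitions n"
  shows "exp (1 / 4 * of_int (kappa \<rho>) * \<i> * z) /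
      (\<Prod>e\<in>young_diagram \<rho>. 2 * sin (of_int (hook_length \<rho> e) * z / 2)) =
    (\<i> * exp (- \<i> * z / 2)) ^ n * exp (- \<i> * z) ^ nrow \<rho> / hook_prod (exp (- \<i> * z)) \<rho>"
proof -
  define w where "w = - \<i> * z / 2"
  define q where "q = exp (- \<i> * z)"
  let ?Y = "young_diagram \<rho>"
  have q: "q = exp (2 * w)" by (simp add: q_def w_def)
  have "(\<Prod>e\<in>?Y. 2 * sin (of_int (hook_length \<rho> e) * z / 2)) =
      (\<Prod>e\<in>?Y. - \<i> * exp (of_int (- hook_length \<rho> e) * w) * (1 - q ^ nat (hook_length \<rho> e)))"
    unfolding w_def q_def by (intro prod.cong two_sin_half hook_length_pos[OF \<rho>] refl)
  also have "\<dots> = (- \<i>) ^ n * exp (of_int (- (\<Sum>e\<in>?Y. hook_length \<rho> e)) * w) * hook_prod q \<rho>"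
    unfolding prod.distrib prod_constant card_young_diagram[OF \<rho>] hook_prod_def
    by (simp add: exp_sum[symmetric] sum_distrib_right sum_negf)
  finally have 1: "(\<Prod>e\<in>?Y. 2 * sin (of_int (hook_length \<rho> e) * z / 2)) = \<dots>" .
  have 2: "exp (1 / 4 * of_int (kappa \<rho>) * \<i> * z) = exp (of_int (- (\<Sum>(i, j)\<in>?Y. int j - int i)) * w)"
    by (simp add: kappa_conv_content w_def mult.assoc)
  have "exp (of_int (- (\<Sum>(i, j)\<in>?Y. int j - int i)) * w) / exp (of_int (- (\<Sum>e\<in>?Y. hook_length \<rho> e)) * w)
      = exp (of_int ((\<Sum>e\<in>?Y. hook_length \<rho> e) - (\<Sum>(i, j)\<in>?Y. int j - int i)) * w)"
    by (simp add: exp_diff[symmetric] algebra_simps)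
  also have "(\<Sum>e\<in>?Y. hook_length \<rho> e) - (\<Sum>(i, j)\<in>?Y. int j - int i) =
      (\<Sum>(i, j)\<in>?Y. 2 * (int i - 1) + 1)"
    unfolding sum_hook_length[OF \<rho>] sum_subtractf[symmetric] by (rule sum.cong) auto
  also have "\<dots> = (\<Sum>i<length \<rho>. \<Sum>j=1..prow \<rho> i. 2 * int i + 1)"
    by (subst sum_young_diagram[OF order_refl]) (simp add: add.commute)
  also have "\<dots> = (\<Sum>i<length \<rho>. 2 * int (i * prow \<rho> i) + int (prow \<rho> i))"
    by (rule sum.cong) (auto simp: algebra_simps)
  also have "\<dots> = 2 * int (nrow \<rho>) + int n"
    using arg_cong[OF sum_prow[OF \<rho> order_refl], of int]
    by (simp add: nrow_def sum.distrib sum_distrib_left[symmetric])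
  also have "exp (of_int (2 * int (nrow \<rho>) + int n) * w) = q ^ nrow \<rho> * exp w ^ n"
    unfolding q by (simp add: exp_add[symmetric] exp_of_nat_mult[symmetric] algebra_simps)
  finally have 3: "exp (of_int (- (\<Sum>(i, j)\<in>?Y. int j - int i)) * w) /
      exp (of_int (- (\<Sum>e\<in>?Y. hook_length \<rho> e)) * w) = q ^ nrow \<rho> * exp w ^ n" .
  have 4: "1 / (- \<i>) ^ n = \<i> ^ n"
    by (simp add: power_one_over[symmetric])
  let ?A = "exp (of_int (- (\<Sum>(i, j)\<in>?Y. int j - int i)) * w)"
    and ?B = "exp (of_int (- (\<Sum>e\<in>?Y. hook_length \<rho> e)) * w)"
  have "?A / ((- \<i>) ^ n * ?B * hook_prod q \<rho>) = 1 / (- \<i>) ^ n * (?A / ?B) / hook_prod q \<rho>"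
    by (simp only: divide_divide_eq_left times_divide_times_eq mult_1_left)
  also have "\<dots> = (\<i> * exp w) ^ n * q ^ nrow \<rho> / hook_prod q \<rho>"
    unfolding 3 4 by (simp add: power_mult_distrib mult.commute mult.left_commute)
  finally show ?thesis
    unfolding 1 2 by (simp only: q_def w_def)
qed

lemma power_sum_term:
  assumes "d \<ge> 1"
  shows "- (\<i> ^ (d + 1) / (2 * sin (of_nat d * z / 2))) =
    (\<i> * exp (- \<i> * z / 2)) ^ d / (1 - exp (- \<i> * z) ^ d)"
proof -
  define E where "E = exp (- \<i> * z / 2)"
  define X where "X = 1 - exp (- \<i> * z) ^ d"
  have "exp (of_int (- int d) * (- \<i> * z / 2)) = inverse (E ^ d)"
    unfolding E_def exp_of_nat_mult[symmetric] exp_minus[symmetric] by (simp add: algebra_simps)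
  hence eq: "2 * sin (of_nat d * z / 2) = - \<i> * inverse (E ^ d) * X"
    using two_sin_half[of "int d" z] assms by (simp add: X_def)
  have "E \<noteq> 0" by (simp add: E_def)
  \<comment> \<open>At the zeros of \<open>X\<close> both sides are 0, by the convention for
    division by zero.\<close>
  thus ?thesis
    unfolding E_def[symmetric] X_def[symmetric] eq
    by (cases "X = 0") (simp_all add: field_simps power_mult_distrib)
qed

section \<open>Alternating sums and the Vandermonde determinant\<close>

lemma sign_comp: "finite S \<Longrightarrow> u permutes S \<Longrightarrow> v permutes S \<Longrightarrow> sign (u \<circ> v) = sign u * sign v"
  by (meson sign_compose permutes_imp_permutation)

text \<open>Composition with the transposition pairs permutations of opposite sign and equal
  value.\<close>

lemma alternating_sum_eq_0:
  fixes f :: "('a \<Rightarrow> 'a) \<Rightarrow> complex"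
  assumes "a \<in> S" "b \<in> S" "a \<noteq> b" "\<And>u. u permutes S \<Longrightarrow> f (u \<circ> Transposition.transpose a b) = f u"
    and "finite S"
  shows "(\<Sum>u | u permutes S. of_int (sign u) * f u) = 0"
proof -
  let ?t = "Transposition.transpose a b"
  have t: "?t permutes S" using assms by (intro permutes_swap_id) auto
  have "(\<Sum>u | u permutes S. of_int (sign u) * f u) =
      (\<Sum>u | u permutes S. of_int (sign (u \<circ> ?t)) * f (u \<circ> ?t))"
    by (rule sum.reindex_bij_witness[of _ "\<lambda>u. u \<circ> ?t" "\<lambda>u. u \<circ> ?t"])
       (use t in \<open>auto simp: o_assoc[symmetric] intro: permutes_compose\<close>)
  also have "\<dots> = (\<Sum>u | u permutes S. - (of_int (sign u) * f u))"
  proof (intro sum.cong refl)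
    fix u assume "u \<in> {u. u permutes S}"
    hence u: "u permutes S" by simp
    have "sign (u \<circ> ?t) = - sign u"
      using sign_comp[OF assms(5) u t] assms(3) by (simp add: sign_swap_id)
    thus "of_int (sign (u \<circ> ?t)) * f (u \<circ> ?t) = - (of_int (sign u) * f u)"
      using assms(4)[OF u] by simp
  qed
  finally show ?thesis by (simp add: sum_negf)
qed

text \<open>
  Replacing the powers \<open>y\<^sup>i\<close> by the monic polynomials \<open>\<Prod>\<^bsub>k<i\<^esub> (y - y\<^sub>k)\<close> does not change the determinant
  and makes the matrix triangular.
\<close>

lemma vandermonde_determinant:
  fixes y :: "nat \<Rightarrow> complex"
  shows "(\<Sum>u | u permutes {..<N}. of_int (sign u) * (\<Prod>i<N. y (u i) ^ i)) =
    (\<Prod>j<N. \<Prod>i<j. y j - y i)"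
proof -
  let ?P = "{u. u permutes {..<N}}"
  define p where "p = (\<lambda>i. \<Prod>k<i. [:- y k, 1:])"
  have deg: "degree (p i) = i" for i
    unfolding p_def by (subst degree_prod_eq_sum_degree) auto
  have lc: "coeff (p i) i = 1" for i
    using lead_coeff_prod[of "\<lambda>k. [:- y k, 1:]" "{..<i}"] deg[of i] by (simp add: p_def)
  have poly: "poly (p i) x = (\<Prod>k<i. x - y k)" for i x
    by (simp add: p_def poly_prod)
  let ?D = "\<Sum>u\<in>?P. of_int (sign u) * (\<Prod>i<N. poly (p i) (y (u i)))"
  let ?K = "PiE {..<N} (\<lambda>i. {..i})"
  let ?a = "\<lambda>\<kappa>. \<Sum>u\<in>?P. of_int (sign u) * (\<Prod>i<N. y (u i) ^ \<kappa> i)"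
  have "(\<Prod>i<N. poly (p i) (y (u i))) =
      (\<Sum>\<kappa>\<in>?K. (\<Prod>i<N. coeff (p i) (\<kappa> i)) * (\<Prod>i<N. y (u i) ^ \<kappa> i))" for u
    unfolding poly_altdef deg prod.distrib[symmetric] by (rule prod_sum_PiE) auto
  hence "?D = (\<Sum>u\<in>?P. \<Sum>\<kappa>\<in>?K. (\<Prod>i<N. coeff (p i) (\<kappa> i)) * (of_int (sign u) * (\<Prod>i<N. y (u i) ^ \<kappa> i)))"
    by (simp add: sum_distrib_left mult_ac)
  also have "\<dots> = (\<Sum>\<kappa>\<in>?K. (\<Prod>i<N. coeff (p i) (\<kappa> i)) * ?a \<kappa>)"
    unfolding sum_distrib_left by (rule sum.swap)
  also have "\<dots> = (\<Sum>\<kappa>\<in>{\<lambda>i\<in>{..<N}. i}. (\<Prod>i<N. coeff (p i) (\<kappa> i)) * ?a \<kappa>)"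
  proof (rule sum.mono_neutral_right)
    show "\<forall>\<kappa>\<in>?K - {\<lambda>i\<in>{..<N}. i}. (\<Prod>i<N. coeff (p i) (\<kappa> i)) * ?a \<kappa> = 0"
    proof
      fix \<kappa> assume \<kappa>: "\<kappa> \<in> ?K - {\<lambda>i\<in>{..<N}. i}"
      \<comment> \<open>An injective \<kappa> with \<kappa> i \<le> i is the identity, by induction
        on i. Every other choice of exponents gives a matrix with two equal columns, whose
        determinant vanishes.\<close>
      have "\<not> inj_on \<kappa> {..<N}"
      proof
        assume inj: "inj_on \<kappa> {..<N}"
        have "\<kappa> i = i" if "i < N" for i
          using that
        proof (induction i rule: less_induct)
          case (less i)
          have "\<kappa> i \<le> i" using \<kappa> less.prems by (auto simp: PiE_iff)
          moreover have "\<not> \<kappa> i < i"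
            using less.IH[of "\<kappa> i"] inj_onD[OF inj, of "\<kappa> i" i] less.prems by auto
          ultimately show ?case by simp
        qed
        hence "\<kappa> = (\<lambda>i\<in>{..<N}. i)"
          using \<kappa> by (intro ext) (auto simp: PiE_iff extensional_def)
        thus False using \<kappa> by auto
      qed
      then obtain i j where ij: "i < N" "j < N" "i \<noteq> j" "\<kappa> i = \<kappa> j"
        by (auto simp: inj_on_def)
      have "?a \<kappa> = 0"
      proof (rule alternating_sum_eq_0[of i _ j])
        fix u assume "u permutes {..<N}"
        have t: "Transposition.transpose i j permutes {..<N}"
          using ij by (intro permutes_swap_id) auto
        have "\<kappa> (Transposition.transpose i j k) = \<kappa> k" for k
          using ij by (auto simp: Transposition.transpose_def)
        thus "(\<Prod>k<N. y ((u \<circ> Transposition.transpose i j) k) ^ \<kappa> k) = (\<Prod>k<N. y (u k) ^ \<kappa> k)"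
          using prod.permute[OF t, of "\<lambda>k. y (u k) ^ \<kappa> k"] by (simp add: o_def)
      qed (use ij in auto)
      thus "(\<Prod>i<N. coeff (p i) (\<kappa> i)) * ?a \<kappa> = 0" by simp
    qed
  qed (auto intro!: finite_PiE)
  also have "\<dots> = (\<Sum>u\<in>?P. of_int (sign u) * (\<Prod>i<N. y (u i) ^ i))"
    by (simp add: lc)
  finally have 1: "?D = \<dots>" .
  have "?D = (\<Sum>u\<in>{id}. of_int (sign u) * (\<Prod>i<N. poly (p i) (y (u i))))"
  proof (rule sum.mono_neutral_right)
    show "\<forall>u\<in>?P - {id}. of_int (sign u) * (\<Prod>i<N. poly (p i) (y (u i))) = 0"
    proof
      fix u assume u: "u \<in> ?P - {id}"
      \<comment> \<open>A permutation of an initial segment with u i \<ge> i throughout is the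
        identity. Where u i < i, the polynomial \<open>p i\<close> has the root
        \<open>y (u i)\<close>.\<close>
      then obtain i where i: "i < N" "u i < i"
        using permutes_natset_ge[of u "{..<N}"] by (force simp: not_le)
      have "poly (p i) (y (u i)) = 0"
        unfolding poly by (rule prod_zero) (use i in auto)
      hence "(\<Prod>i<N. poly (p i) (y (u i))) = 0"
        by (intro prod_zero) (use i in auto)
      thus "of_int (sign u) * (\<Prod>i<N. poly (p i) (y (u i))) = 0" by simp
    qed
  qed (auto simp: permutes_id finite_permutations)
  thus ?thesis using 1 by (simp add: poly)
qed

section \<open>Alternants\<close>

definition delta :: "nat \<Rightarrow> nat \<Rightarrow> nat" where
  "delta N i = N - 1 - i"

lemma beta_eq: "beta N \<rho> i = prow \<rho> i + delta N i"
  by (simp add: beta_def delta_def)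

text \<open>
  Given a finite family \<open>A\<close> of objects of weight \<open>c\<close>, this is the coefficient of \<open>x\<^sup>\<alpha>\<close> in the product of the
  Vandermonde alternant and of the weight enumerator \<open>\<Sum>\<^bsub>F\<in>A\<^esub> x\<^bsup>c F\<^esup>\<close>, in \<open>N\<close> variables.
\<close>

definition alt_coeff :: "nat \<Rightarrow> 'f set \<Rightarrow> ('f \<Rightarrow> nat \<Rightarrow> nat) \<Rightarrow> (nat \<Rightarrow> nat) \<Rightarrow> int" where
  "alt_coeff N A c \<alpha> = (\<Sum>w | w permutes {..<N}. \<Sum>F\<in>A.
     if (\<lambda>i. c F i + delta N (w i)) = \<alpha> then sign w else 0)"

text \<open>This makes the weight enumerator a symmetric polynomial; it is expressed by bijections
  on the objects because the enumerator is never formed as a polynomial.\<close>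

definition sym_weight :: "nat \<Rightarrow> 'f set \<Rightarrow> ('f \<Rightarrow> nat \<Rightarrow> nat) \<Rightarrow> bool" where
  "sym_weight N A c \<longleftrightarrow>
     (\<forall>u. u permutes {..<N} \<longrightarrow> (\<exists>b. bij_betw b A A \<and> (\<forall>F\<in>A. c (b F) = c F \<circ> u)))"

definition weights :: "nat \<Rightarrow> nat \<Rightarrow> (nat \<Rightarrow> nat) set" where
  "weights N m = {\<alpha>. (\<forall>i\<ge>N. \<alpha> i = 0) \<and> (\<Sum>i<N. \<alpha> i) = m}"

definition strict_weights :: "nat \<Rightarrow> nat \<Rightarrow> (nat \<Rightarrow> nat) set" where
  "strict_weights N m = {\<alpha> \<in> weights N m. \<forall>i j. i < j \<longrightarrow> j < N \<longrightarrow> \<alpha> j < \<alpha> i}"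

definition xpow :: "nat \<Rightarrow> (nat \<Rightarrow> complex) \<Rightarrow> (nat \<Rightarrow> nat) \<Rightarrow> complex" where
  "xpow N x \<alpha> = (\<Prod>i<N. x i ^ \<alpha> i)"

lemma finite_weights [simp, intro]: "finite (weights N m)"
proof (rule finite_subset)
  show "weights N m \<subseteq> (\<lambda>f i. if i < N then f i else 0) ` ({..<N} \<rightarrow>\<^sub>E {..m})"
  proof
    fix \<alpha> assume \<alpha>: "\<alpha> \<in> weights N m"
    have "\<alpha> i \<le> m" if "i < N" for i
      using \<alpha> that member_le_sum[of i "{..<N}" \<alpha>] by (auto simp: weights_def)
    thus "\<alpha> \<in> (\<lambda>f i. if i < N then f i else 0) ` ({..<N} \<rightarrow>\<^sub>E {..m})"
      using \<alpha> by (intro image_eqI[of _ _ "restrict \<alpha> {..<N}"]) (auto simp: weights_def fun_eq_iff)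
  qed
qed (auto intro!: finite_PiE)

lemma weights_perm: "\<alpha> \<in> weights N m \<Longrightarrow> u permutes {..<N} \<Longrightarrow> \<alpha> \<circ> u \<in> weights N m"
  using sum.permute[of u "{..<N}" \<alpha>] by (auto simp: weights_def o_def permutes_not_in)

lemma delta_in_weights: "delta N \<in> weights N (\<Sum>i<N. delta N i)"
  by (auto simp: weights_def delta_def)

lemma finite_perms [simp, intro]: "finite S \<Longrightarrow> finite {w. w permutes S}"
  by (rule finite_permutations)

lemma alternant_times_enumerator:
  assumes "finite A" and c: "\<And>F. F \<in> A \<Longrightarrow> c F \<in> weights N n"
  shows "(\<Sum>w | w permutes {..<N}. of_int (sign w) * xpow N x (delta N \<circ> w)) * (\<Sum>F\<in>A. xpow N x (c F)) =
    (\<Sum>\<alpha>\<in>weights N (n + (\<Sum>i<N. delta N i)). of_int (alt_coeff N A c \<alpha>) * xpow N x \<alpha>)"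
proof -
  let ?W = "weights N (n + (\<Sum>i<N. delta N i))" and ?P = "{w. w permutes {..<N}}"
  let ?v = "\<lambda>w F i. c F i + delta N (w i)"
  have v: "?v w F \<in> ?W" if "w \<in> ?P" "F \<in> A" for w F
    using c[OF that(2)] weights_perm[OF delta_in_weights, of w N] that
    by (auto simp: weights_def sum.distrib)
  have "(\<Sum>\<alpha>\<in>?W. of_int (alt_coeff N A c \<alpha>) * xpow N x \<alpha>) =
      (\<Sum>\<alpha>\<in>?W. \<Sum>w\<in>?P. \<Sum>F\<in>A. if ?v w F = \<alpha> then of_int (sign w) * xpow N x (?v w F) else 0)"
    unfolding alt_coeff_def by (auto simp: sum_distrib_right intro!: sum.cong)
  also have "\<dots> = (\<Sum>w\<in>?P. \<Sum>F\<in>A. \<Sum>\<alpha>\<in>?W. if ?v w F = \<alpha> then of_int (sign w) * xpow N x (?v w F) else 0)"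
    by (subst sum.swap) (intro sum.cong refl sum.swap)
  also have "\<dots> = (\<Sum>w\<in>?P. \<Sum>F\<in>A. of_int (sign w) * xpow N x (?v w F))"
    by (intro sum.cong refl, subst sum.delta') (use v in auto)
  also have "\<dots> = (\<Sum>w\<in>?P. of_int (sign w) * xpow N x (delta N \<circ> w)) * (\<Sum>F\<in>A. xpow N x (c F))"
    unfolding sum_product
    by (intro sum.cong refl) (simp add: xpow_def power_add prod.distrib mult_ac)
  finally show ?thesis ..
qed

text \<open>A symmetric enumerator times an alternant is alternating: the objects are moved by b
  while the exponents of the alternant are moved by u.\<close>

lemma alt_coeff_perm:
  assumes "sym_weight N A c" and u: "u permutes {..<N}"
  shows "alt_coeff N A c (\<alpha> \<circ> u) = sign u * alt_coeff N A c \<alpha>"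
proof -
  obtain b where b: "bij_betw b A A" "\<And>F. F \<in> A \<Longrightarrow> c (b F) = c F \<circ> u"
    using assms unfolding sym_weight_def by blast
  let ?P = "{w. w permutes {..<N}}"
  have bij: "bij_betw (\<lambda>w. w \<circ> u) ?P ?P"
    by (rule bij_betwI[of _ _ _ "\<lambda>w. w \<circ> inv u"])
       (use u in \<open>auto simp: permutes_compose permutes_inv o_assoc[symmetric] permutes_inv_o\<close>)
  have eq: "(\<lambda>i. (c F \<circ> u) i + delta N ((w \<circ> u) i)) = \<alpha> \<circ> u \<longleftrightarrow> (\<lambda>i. c F i + delta N (w i)) = \<alpha>" for F w
    using permutes_surj[OF u] by (auto simp: fun_eq_iff) (metis surjD)
  have "alt_coeff N A c (\<alpha> \<circ> u) =
      (\<Sum>w\<in>?P. \<Sum>F\<in>A. if (\<lambda>i. c (b F) i + delta N ((w \<circ> u) i)) = \<alpha> \<circ> u then sign (w \<circ> u) else 0)"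
    unfolding alt_coeff_def
    by (subst sum.reindex_bij_betw[OF bij, symmetric], subst sum.reindex_bij_betw[OF b(1), symmetric]) simp
  also have "\<dots> = (\<Sum>w\<in>?P. \<Sum>F\<in>A. if (\<lambda>i. c F i + delta N (w i)) = \<alpha> then sign u * sign w else 0)"
  proof (intro sum.cong refl)
    fix w F assume "w \<in> ?P" "F \<in> A"
    thus "(if (\<lambda>i. c (b F) i + delta N ((w \<circ> u) i)) = \<alpha> \<circ> u then sign (w \<circ> u) else 0) =
      (if (\<lambda>i. c F i + delta N (w i)) = \<alpha> then sign u * sign w else 0)"
      using u unfolding b(2)[OF \<open>F \<in> A\<close>] eq
      by (auto simp: sign_comp[of "{..<N}"])
  qed
  also have "\<dots> = sign u * alt_coeff N A c \<alpha>"
    unfolding alt_coeff_def sum_distrib_left by (intro sum.cong refl) auto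
  finally show ?thesis .
qed

lemma strict_decreasing_eqI:
  fixes f g :: "nat \<Rightarrow> nat"
  assumes "\<And>i j. i < j \<Longrightarrow> j < N \<Longrightarrow> f j < f i" "\<And>i j. i < j \<Longrightarrow> j < N \<Longrightarrow> g j < g i"
    and "f ` {..<N} = g ` {..<N}" "i < N"
  shows "f i = g i"
proof -
  have "sorted_wrt (>) (map f [0..<N])" "sorted_wrt (>) (map g [0..<N])"
    using assms(1,2) by (auto simp: sorted_wrt_iff_nth_less)
  hence "rev (map f [0..<N]) = rev (map g [0..<N])"
    using assms(3) by (intro strict_sorted_equal) (auto simp: sorted_wrt_rev atLeast0LessThan)
  thus ?thesis using assms(4) by auto
qed

text \<open>Exponents with a repeated entry are fixed by a transposition, so their coefficients
  vanish. Each of the others is a rearrangement of one strictly decreasing exponent by exactly one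
  permutation, so that the sum splits into alternants.\<close>

lemma sum_weights_alternating:
  fixes f :: "(nat \<Rightarrow> nat) \<Rightarrow> int"
  assumes alt: "\<And>\<alpha> u. u permutes {..<N} \<Longrightarrow> f (\<alpha> \<circ> u) = sign u * f \<alpha>"
  shows "(\<Sum>\<alpha>\<in>weights N m. of_int (f \<alpha>) * xpow N x \<alpha>) =
    (\<Sum>\<beta>\<in>strict_weights N m. of_int (f \<beta>) *
       (\<Sum>u | u permutes {..<N}. of_int (sign u) * xpow N x (\<beta> \<circ> u)))"
proof -
  let ?P = "{u. u permutes {..<N}}" and ?I = "{\<alpha> \<in> weights N m. inj_on \<alpha> {..<N}}"
  have "f \<alpha> = 0" if \<alpha>: "\<not> inj_on \<alpha> {..<N}" for \<alpha>
  proof -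
    obtain i j where ij: "i < N" "j < N" "i \<noteq> j" "\<alpha> i = \<alpha> j"
      using \<alpha> by (auto simp: inj_on_def)
    hence "\<alpha> \<circ> Transposition.transpose i j = \<alpha>"
      by (auto simp: fun_eq_iff Transposition.transpose_def)
    moreover have "Transposition.transpose i j permutes {..<N}"
      using ij by (intro permutes_swap_id) auto
    ultimately show ?thesis
      using alt[of "Transposition.transpose i j" \<alpha>] ij by (simp add: sign_swap_id)
  qed
  hence "(\<Sum>\<alpha>\<in>weights N m. of_int (f \<alpha>) * xpow N x \<alpha>) = (\<Sum>\<alpha>\<in>?I. of_int (f \<alpha>) * xpow N x \<alpha>)"
    by (intro sum.mono_neutral_right) auto
  also have "\<dots> = (\<Sum>(\<beta>, u)\<in>strict_weights N m \<times> ?P. of_int (f (\<beta> \<circ> u)) * xpow N x (\<beta> \<circ> u))"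
  proof -
    have strictD: "\<beta> j < \<beta> i" if "\<beta> \<in> strict_weights N m" "i < j" "j < N" for \<beta> i j
      using that by (auto simp: strict_weights_def)
    have inj\<beta>: "inj_on \<beta> {..<N}" if "\<beta> \<in> strict_weights N m" for \<beta>
      by (rule linorder_inj_onI') (use strictD[OF that] in fastforce)
    have "bij_betw (\<lambda>(\<beta>, u). \<beta> \<circ> u) (strict_weights N m \<times> ?P) ?I"
      unfolding bij_betw_def
    proof (intro conjI inj_onI equalityI subsetI; clarify?)
      fix \<beta> u \<beta>' u'
      assume *: "\<beta> \<in> strict_weights N m" "\<beta>' \<in> strict_weights N m"
        "u permutes {..<N}" "u' permutes {..<N}" "\<beta> \<circ> u = \<beta>' \<circ> u'"
      have "\<beta> ` {..<N} = \<beta>' ` {..<N}"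
        using *(3-5) by (metis image_comp permutes_image)
      hence "\<beta> i = \<beta>' i" if "i < N" for i
        using strict_decreasing_eqI[of N \<beta> \<beta>' i] strictD *(1,2) that by blast
      hence "\<beta> = \<beta>'"
        using *(1,2) by (auto simp: fun_eq_iff strict_weights_def weights_def) (metis not_less)
      moreover have "u i = u' i" for i
      proof (cases "i < N")
        case True
        have "u i < N" "u' i < N"
          using permutes_in_image[OF *(3), of i] permutes_in_image[OF *(4), of i] True by auto
        thus ?thesis
          using inj\<beta>[OF *(1)] *(5) \<open>\<beta> = \<beta>'\<close> by (auto simp: inj_on_def fun_eq_iff)
      next
        case False
        thus ?thesis using *(3,4) by (simp add: permutes_not_in)
      qed
      ultimately show "\<beta> = \<beta>' \<and> u = u'" by auto
    next
      fix \<beta> u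
      assume *: "\<beta> \<in> strict_weights N m" "u permutes {..<N}"
      have "inj_on \<beta> (u ` {..<N})" using inj\<beta>[OF *(1)] permutes_image[OF *(2)] by simp
      hence "inj_on (\<beta> \<circ> u) {..<N}"
        by (rule comp_inj_on[OF permutes_inj_on[OF *(2)]])
      thus "\<beta> \<circ> u \<in> weights N m \<and> inj_on (\<beta> \<circ> u) {..<N}"
        using * weights_perm by (auto simp: strict_weights_def)
    next
      fix \<alpha> assume \<alpha>: "\<alpha> \<in> weights N m" "inj_on \<alpha> {..<N}"
      \<comment> \<open>The values of \<alpha> in decreasing order; padded by zeros they form the
        strictly decreasing representative.\<close>
      define l where "l = rev (sorted_list_of_set (\<alpha> ` {..<N}))"
      define \<beta> where "\<beta> = (\<lambda>i. if i < N then l ! i else 0)"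
      have len: "length l = N" by (simp add: l_def card_image[OF \<alpha>(2)])
      have dec: "\<beta> j < \<beta> i" if "i < j" "j < N" for i j
      proof -
        have "sorted_wrt (<) (rev l)" by (simp add: l_def)
        hence "sorted_wrt (>) l" by (simp add: sorted_wrt_rev)
        thus ?thesis using that len by (auto simp: \<beta>_def sorted_wrt_iff_nth_less)
      qed
      have "image_mset \<beta> (mset_set {..<N}) = mset (map \<beta> [0..<N])"
        by (simp add: mset_set_upto_eq_mset_upto)
      also have "map \<beta> [0..<N] = l"
        by (rule nth_equalityI) (auto simp: \<beta>_def len)
      also have "mset l = image_mset \<alpha> (mset_set {..<N})"
        using mset_set_set[of "sorted_list_of_set (\<alpha> ` {..<N})"]
        by (simp add: l_def image_mset_mset_set[OF \<alpha>(2)])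
      finally obtain p where p: "p permutes {..<N}" "\<forall>i\<in>{..<N}. \<alpha> i = \<beta> (p i)"
        using image_mset_eq_implies_permutes[of "{..<N}" \<alpha> \<beta>]
        by (metis finite_lessThan)
      have \<alpha>p: "\<alpha> = \<beta> \<circ> p"
      proof
        show "\<alpha> i = (\<beta> \<circ> p) i" for i
          using p(2) \<alpha>(1) permutes_not_in[OF p(1), of i]
          by (cases "i < N") (auto simp: weights_def \<beta>_def)
      qed
      have "\<beta> = \<alpha> \<circ> inv p"
        unfolding \<alpha>p using p(1) by (simp add: o_assoc[symmetric] permutes_inv_o)
      hence "\<beta> \<in> strict_weights N m"
        using weights_perm[OF \<alpha>(1) permutes_inv[OF p(1)]] dec by (auto simp: strict_weights_def)
      thus "\<alpha> \<in> (\<lambda>(\<beta>, u). \<beta> \<circ> u) ` (strict_weights N m \<times> ?P)"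
        using \<alpha>p p(1) by (intro image_eqI[of _ _ "(\<beta>, p)"]) auto
    qed
    from sum.reindex_bij_betw[OF this, of "\<lambda>\<alpha>. of_int (f \<alpha>) * xpow N x \<alpha>"]
    show ?thesis by (simp add: case_prod_unfold)
  qed
  also have "\<dots> = (\<Sum>\<beta>\<in>strict_weights N m. of_int (f \<beta>) *
       (\<Sum>u\<in>?P. of_int (sign u) * xpow N x (\<beta> \<circ> u)))"
    unfolding sum_distrib_left
    by (subst sum.cartesian_product [symmetric]) (auto simp: alt mult_ac intro!: sum.cong)
  finally show ?thesis .
qed

text \<open>Subtracting \<delta> and cutting off the trailing zeros inverts the map. The bound n
  \<le> N leaves room for all rows, because a partition of n has at most n parts.\<close>

lemma bij_betw_beta:
  assumes "n \<le> N"
  shows "bij_betw (beta N) (partitions n) (strict_weights N (n + (\<Sum>i<N. delta N i)))"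
  unfolding bij_betw_def
proof (intro conjI inj_onI equalityI subsetI; (elim imageE)?)
  fix \<rho> \<rho>' assume *: "\<rho> \<in> partitions n" "\<rho>' \<in> partitions n" "beta N \<rho> = beta N \<rho>'"
  have eq: "prow \<rho> i = prow \<rho>' i" for i
    using fun_cong[OF *(3), of i] by (simp add: beta_def)
  have "length \<rho> = length \<rho>'"
  proof (rule ccontr)
    assume "length \<rho> \<noteq> length \<rho>'"
    hence "length \<rho> < length \<rho>' \<or> length \<rho>' < length \<rho>" by auto
    thus False
      using prow_pos[OF *(2), of "length \<rho>"] prow_pos[OF *(1), of "length \<rho>'"]
        eq[of "length \<rho>"] eq[of "length \<rho>'"] by (auto simp: prow_def)
  qed
  thus "\<rho> = \<rho>'"
  proof (rule nth_equalityI)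
    fix i assume "i < length \<rho>"
    thus "\<rho> ! i = \<rho>' ! i"
      using eq[of i] \<open>length \<rho> = length \<rho>'\<close> by (simp add: prow_def)
  qed
next
  fix \<beta> \<rho> assume *: "\<rho> \<in> partitions n" "\<beta> = beta N \<rho>"
  hence "length \<rho> \<le> N" using partition_length_le assms order_trans by blast
  moreover from this have "(\<Sum>i<N. beta N \<rho> i) = n + (\<Sum>i<N. delta N i)"
    using sum_prow[OF *(1)] by (simp add: beta_eq sum.distrib)
  ultimately show "\<beta> \<in> strict_weights N (n + (\<Sum>i<N. delta N i))"
    using beta_strict[OF *(1)] *(2)
    by (auto simp: strict_weights_def weights_def) (auto simp: beta_def prow_def)
next
  fix \<beta> assume \<beta>: "\<beta> \<in> strict_weights N (n + (\<Sum>i<N. delta N i))"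
  have gap: "i \<le> k \<Longrightarrow> k < N \<Longrightarrow> \<beta> k + (k - i) \<le> \<beta> i" for i k
  proof (induction k rule: dec_induct)
    case (step k)
    moreover have "\<beta> (Suc k) < \<beta> k" using \<beta> step.prems by (auto simp: strict_weights_def)
    ultimately show ?case by auto
  qed auto
  have \<delta>: "delta N i \<le> \<beta> i" for i
  proof (cases "i < N")
    case True
    hence "i \<le> N - 1" "N - 1 < N" by auto
    from gap[OF this] show ?thesis by (simp add: delta_def)
  qed (simp add: delta_def)
  define lam where "lam = (\<lambda>i. \<beta> i - delta N i)"
  have 0: "lam i = 0" if "N \<le> i" for i
    using \<beta> that by (auto simp: lam_def strict_weights_def weights_def)
  have dec: "lam k \<le> lam i" if "i \<le> k" for i k
  proof (cases "k < N")
    case True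
    have "delta N i = delta N k + (k - i)" using that True by (auto simp: delta_def)
    thus ?thesis using gap[OF that True] by (auto simp: lam_def)
  qed (use 0 in auto)
  \<comment> \<open>The number of nonzero rows: \<open>lam\<close> is weakly decreasing, so it
    vanishes from m on.\<close>
  define m where "m = (LEAST m. lam m = 0)"
  have m: "lam m = 0" "m \<le> N"
    unfolding m_def using 0[of N] by (auto intro: LeastI Least_le)
  have pos: "0 < lam i" if "i < m" for i
    using not_less_Least[of i "\<lambda>m. lam m = 0"] that by (auto simp: m_def)
  define \<rho> where "\<rho> = map lam [0..<m]"
  have prow: "prow \<rho> i = lam i" for i
    using dec[of m i] m(1) by (auto simp: prow_def \<rho>_def)
  have "sum_list \<rho> = (\<Sum>i<N. lam i)"
    unfolding \<rho>_def interv_sum_list_conv_sum_set_nat atLeast0LessThan set_upt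
    by (rule sum.mono_neutral_left) (use m dec[of m] in auto)
  also have "\<dots> + (\<Sum>i<N. delta N i) = (\<Sum>i<N. \<beta> i)"
    unfolding sum.distrib[symmetric] lam_def using \<delta> by simp
  hence "(\<Sum>i<N. lam i) = n"
    using \<beta> by (auto simp: strict_weights_def weights_def)
  finally have "sum_list \<rho> = n" .
  moreover have "0 \<notin> set \<rho>"
    using pos by (force simp: \<rho>_def)
  ultimately have "\<rho> \<in> partitions n"
    using dec by (auto simp: partitions_def \<rho>_def sorted_wrt_iff_nth_less)
  moreover have "\<beta> = beta N \<rho>"
    using \<delta> by (auto simp: fun_eq_iff beta_eq prow lam_def)
  ultimately show "\<beta> \<in> beta N ` partitions n" by blast
qed

text \<open>The variable q^i raised to the power \<beta> (u i) is also the i-th power of q^(\<beta>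
  (u i)). Hence the alternant in the variables q^i is a Vandermonde determinant in the quantities
  q^(\<beta> i).\<close>

lemma alternant_geometric:
  "(\<Sum>u | u permutes {..<N}. of_int (sign u) * xpow N (\<lambda>i. q ^ i) (\<beta> \<circ> u)) =
    vander N (\<lambda>i. q ^ \<beta> i)"
  unfolding vander_def vandermonde_determinant[symmetric] xpow_def
  by (simp add: power_mult[symmetric] mult.commute)

lemma sum_alt_coeff_vander:
  assumes "n \<le> N" "finite A" "\<And>F. F \<in> A \<Longrightarrow> c F \<in> weights N n" "sym_weight N A c"
  shows "(\<Sum>\<rho>\<in>partitions n. of_int (alt_coeff N A c (beta N \<rho>)) * vander N (\<lambda>i. q ^ beta N \<rho> i)) =
    vander N (\<lambda>i. q ^ (N - 1 - i)) * (\<Sum>F\<in>A. xpow N (\<lambda>i. q ^ i) (c F))"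
proof -
  have "vander N (\<lambda>i. q ^ (N - 1 - i)) =
      (\<Sum>u | u permutes {..<N}. of_int (sign u) * xpow N (\<lambda>i. q ^ i) (delta N \<circ> u))"
    by (simp add: alternant_geometric delta_def)
  hence "vander N (\<lambda>i. q ^ (N - 1 - i)) * (\<Sum>F\<in>A. xpow N (\<lambda>i. q ^ i) (c F)) =
      (\<Sum>\<beta>\<in>strict_weights N (n + (\<Sum>i<N. delta N i)).
         of_int (alt_coeff N A c \<beta>) * vander N (\<lambda>i. q ^ \<beta> i))"
    using alternant_times_enumerator[OF assms(2,3), where x = "\<lambda>i. q ^ i"]
      sum_weights_alternating[where x = "\<lambda>i. q ^ i", OF alt_coeff_perm[OF assms(4)]]
    by (simp add: alternant_geometric)
  also have "\<dots> = (\<Sum>\<rho>\<in>partitions n. of_int (alt_coeff N A c (beta N \<rho>)) * vander N (\<lambda>i. q ^ beta N \<rho> i))"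
    by (rule sum.reindex_bij_betw[OF bij_betw_beta[OF assms(1)], symmetric])
  finally show ?thesis ..
qed

section \<open>Colorings of the parts, whose weight enumerator is a product of power sums\<close>

definition colorings :: "nat \<Rightarrow> nat list \<Rightarrow> (nat \<Rightarrow> nat) set" where
  "colorings N \<eta> = {..<length \<eta>} \<rightarrow>\<^sub>E {..<N}"

definition color_weight :: "nat list \<Rightarrow> (nat \<Rightarrow> nat) \<Rightarrow> nat \<Rightarrow> nat" where
  "color_weight \<eta> F i = (\<Sum>k | k < length \<eta> \<and> F k = i. \<eta> ! k)"

lemma finite_colorings [simp, intro]: "finite (colorings N \<eta>)"
  by (auto simp: colorings_def intro!: finite_PiE)

lemma color_weight_altdef: "color_weight \<eta> F i = (\<Sum>k<length \<eta>. if F k = i then \<eta> ! k else 0)"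
  unfolding color_weight_def by (rule sum.mono_neutral_cong_left) auto

lemma color_weight_in_weights:
  assumes "F \<in> colorings N \<eta>"
  shows "color_weight \<eta> F \<in> weights N (sum_list \<eta>)"
proof -
  have "(\<Sum>i<N. color_weight \<eta> F i) = (\<Sum>k<length \<eta>. \<Sum>i<N. if F k = i then \<eta> ! k else 0)"
    unfolding color_weight_altdef by (rule sum.swap)
  also have "\<dots> = (\<Sum>k<length \<eta>. \<eta> ! k)"
    using assms by (intro sum.cong refl, subst sum.delta') (auto simp: colorings_def)
  finally have "(\<Sum>i<N. color_weight \<eta> F i) = sum_list \<eta>"
    by (simp only: sum_list_sum_nth atLeast0LessThan)
  moreover have "color_weight \<eta> F i = 0" if "N \<le> i" for i
  proof -
    have "F k \<noteq> i" if "k < length \<eta>" for k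
      using assms that PiE_mem[of F "{..<length \<eta>}" "\<lambda>_. {..<N}" k] \<open>N \<le> i\<close>
      by (auto simp: colorings_def)
    thus ?thesis by (simp add: color_weight_altdef)
  qed
  ultimately show ?thesis by (auto simp: weights_def)
qed

lemma sym_weight_color_weight: "sym_weight N (colorings N \<eta>) (color_weight \<eta>)"
  unfolding sym_weight_def
proof (intro allI impI)
  fix u assume u: "u permutes {..<N}"
  let ?b = "\<lambda>u F. \<lambda>k\<in>{..<length \<eta>}. u (F k)"
  have inC: "?b v F \<in> colorings N \<eta>" if "v permutes {..<N}" "F \<in> colorings N \<eta>" for v F
    using that permutes_in_image[OF that(1)] by (auto simp: colorings_def PiE_iff)
  \<comment> \<open>Recoloring by the inverse of u is what moves the weight at \<open>u i\<close> to
    position i.\<close>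
  have "bij_betw (?b (inv u)) (colorings N \<eta>) (colorings N \<eta>)"
  proof (rule bij_betwI[of _ _ _ "?b u"])
    have out: "F k = undefined" if "F \<in> colorings N \<eta>" "\<not> k < length \<eta>" for F k
      using PiE_arb[of F "{..<length \<eta>}" "\<lambda>_. {..<N}" k] that by (simp add: colorings_def)
    show "?b u (?b (inv u) F) = F" "?b (inv u) (?b u F) = F" if "F \<in> colorings N \<eta>" for F
      using out[OF that] permutes_inverses[OF u] by (simp_all add: fun_eq_iff)
  qed (use inC u permutes_inv[OF u] in blast)+
  moreover have "color_weight \<eta> (?b (inv u) F) = color_weight \<eta> F \<circ> u" for F
    using u by (auto simp: fun_eq_iff color_weight_def permutes_inv_eq intro!: sum.cong)
  ultimately show "\<exists>b. bij_betw b (colorings N \<eta>) (colorings N \<eta>) \<and>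
      (\<forall>F\<in>colorings N \<eta>. color_weight \<eta> (b F) = color_weight \<eta> F \<circ> u)"
    by blast
qed

text \<open>Multiplying out the power sums selects one variable for each part, which is a
  coloring.\<close>

lemma sum_xpow_color_weight:
  "(\<Sum>F\<in>colorings N \<eta>. xpow N x (color_weight \<eta> F)) = (\<Prod>k<length \<eta>. \<Sum>i<N. x i ^ (\<eta> ! k))"
proof -
  have "(\<Prod>k<length \<eta>. \<Sum>i<N. x i ^ (\<eta> ! k)) = (\<Sum>F\<in>colorings N \<eta>. \<Prod>k<length \<eta>. x (F k) ^ (\<eta> ! k))"
    unfolding colorings_def by (rule prod_sum_PiE) auto
  also have "\<dots> = (\<Sum>F\<in>colorings N \<eta>. xpow N x (color_weight \<eta> F))"
  proof (intro sum.cong refl)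
    fix F assume F: "F \<in> colorings N \<eta>"
    have "xpow N x (color_weight \<eta> F) = (\<Prod>i<N. \<Prod>k<length \<eta>. x i ^ (if F k = i then \<eta> ! k else 0))"
      unfolding xpow_def color_weight_altdef power_sum ..
    also have "\<dots> = (\<Prod>k<length \<eta>. \<Prod>i<N. x i ^ (if F k = i then \<eta> ! k else 0))"
      by (rule prod.swap)
    also have "\<dots> = (\<Prod>k<length \<eta>. x (F k) ^ (\<eta> ! k))"
    proof (intro prod.cong refl)
      fix k assume "k \<in> {..<length \<eta>}"
      hence "F k < N" using F by (auto simp: colorings_def)
      have "(\<Prod>i<N. x i ^ (if F k = i then \<eta> ! k else 0)) = (\<Prod>i<N. if F k = i then x i ^ (\<eta> ! k) else 1)"
        by (rule prod.cong) auto
      thus "(\<Prod>i<N. x i ^ (if F k = i then \<eta> ! k else 0)) = x (F k) ^ (\<eta> ! k)"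
        using \<open>F k < N\<close> by simp
    qed
    finally show "(\<Prod>k<length \<eta>. x (F k) ^ (\<eta> ! k)) = xpow N x (color_weight \<eta> F)" ..
  qed
  finally show ?thesis ..
qed

section \<open>The principal specialization\<close>

lemma finite_partitions [simp, intro]: "finite (partitions n)"
proof (rule finite_subset)
  have "set \<rho> \<subseteq> {..n}" if "\<rho> \<in> partitions n" for \<rho>
    using that member_le_sum_list[of _ \<rho>] by (auto simp: partitions_def)
  thus "partitions n \<subseteq> {xs. set xs \<subseteq> {..n} \<and> length xs \<le> n}"
    using partition_length_le by blast
qed (rule finite_lists_length_le, simp)

text \<open>The expansion into Vandermonde determinants is divided by the one for \<delta>, and N
  tends to infinity: the quotients converge to the hook expressions, and the power sums in 1, q,
  ..., q^(N - 1) to geometric series. Assumption \<open>X\<close> states that the coefficients are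
  the same for all N \<ge> n, so that the limit can be taken term by term.\<close>

lemma principal_specialization:
  assumes \<eta>: "\<eta> \<in> partitions n" and q: "norm q < 1" "q \<noteq> 0"
    and X: "\<And>N \<rho>. n \<le> N \<Longrightarrow> \<rho> \<in> partitions n \<Longrightarrow>
      of_int (alt_coeff N (colorings N \<eta>) (color_weight \<eta>) (beta N \<rho>)) = X \<rho>"
  shows "(\<Sum>\<rho>\<in>partitions n. X \<rho> * (q ^ nrow \<rho> / hook_prod q \<rho>)) =
    (\<Prod>k<length \<eta>. 1 / (1 - q ^ (\<eta> ! k)))"
proof (rule LIMSEQ_unique)
  let ?S = "\<lambda>N. \<Sum>\<rho>\<in>partitions n. X \<rho> *
    (vander N (\<lambda>i. q ^ beta N \<rho> i) / vander N (\<lambda>i. q ^ (N - 1 - i)))"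
  show "?S \<longlonglongrightarrow> (\<Sum>\<rho>\<in>partitions n. X \<rho> * (q ^ nrow \<rho> / hook_prod q \<rho>))"
    by (intro tendsto_intros tendsto_vander_ratio q)
  have pos: "0 < \<eta> ! k" if "k < length \<eta>" for k
    using prow_pos[OF \<eta> that] that by (simp add: prow_def)
  have 0: "(\<lambda>N. q ^ (\<eta> ! k * N)) \<longlonglongrightarrow> 0" if "k < length \<eta>" for k
    using pos[OF that] q(1) unfolding power_mult
    by (intro LIMSEQ_power_zero) (simp add: norm_power power_less_one_iff)
  have lim: "(\<lambda>N. \<Prod>k<length \<eta>. (1 - q ^ (\<eta> ! k * N)) / (1 - q ^ (\<eta> ! k)))
      \<longlonglongrightarrow> (\<Prod>k<length \<eta>. (1 - 0) / (1 - q ^ (\<eta> ! k)))"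
    by (intro tendsto_intros 0) (use pos power_neq_1[OF q(1)] in auto)
  have "eventually (\<lambda>N. (\<Prod>k<length \<eta>. (1 - q ^ (\<eta> ! k * N)) / (1 - q ^ (\<eta> ! k))) = ?S N) sequentially"
    using eventually_ge_at_top[of n]
  proof eventually_elim
    case (elim N)
    have nz: "vander N (\<lambda>i. q ^ (N - 1 - i)) \<noteq> 0"
      using vander_ratio(2)[of "[]" 0 N q] q by (simp add: partitions_def)
    have "(\<Sum>\<rho>\<in>partitions n. X \<rho> * vander N (\<lambda>i. q ^ beta N \<rho> i)) =
        vander N (\<lambda>i. q ^ (N - 1 - i)) * (\<Prod>k<length \<eta>. \<Sum>i<N. (q ^ i) ^ (\<eta> ! k))"
      using sum_alt_coeff_vander[OF elim finite_colorings _ sym_weight_color_weight, of \<eta> q]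
        color_weight_in_weights[of _ N \<eta>] \<eta> X[OF elim]
      by (simp add: partitions_def sum_xpow_color_weight)
    also have "(\<Prod>k<length \<eta>. \<Sum>i<N. (q ^ i) ^ (\<eta> ! k)) =
        (\<Prod>k<length \<eta>. (1 - q ^ (\<eta> ! k * N)) / (1 - q ^ (\<eta> ! k)))"
    proof (intro prod.cong refl)
      fix k assume "k \<in> {..<length \<eta>}"
      hence "1 - q ^ (\<eta> ! k) \<noteq> 0" using pos power_neq_1[OF q(1)] by auto
      thus "(\<Sum>i<N. (q ^ i) ^ (\<eta> ! k)) = (1 - q ^ (\<eta> ! k * N)) / (1 - q ^ (\<eta> ! k))"
        using sum_gp_strict[of "q ^ (\<eta> ! k)" N]
        by (simp add: power_mult[symmetric] mult.commute)
    qed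
    finally have "(\<Sum>\<rho>\<in>partitions n. X \<rho> * vander N (\<lambda>i. q ^ beta N \<rho> i)) /
          vander N (\<lambda>i. q ^ (N - 1 - i)) =
        (\<Prod>k<length \<eta>. (1 - q ^ (\<eta> ! k * N)) / (1 - q ^ (\<eta> ! k)))"
      using nz by simp
    thus ?case
      by (simp only: sum_divide_distrib times_divide_eq_right)
  qed
  thus "?S \<longlonglongrightarrow> (\<Prod>k<length \<eta>. 1 / (1 - q ^ (\<eta> ! k)))"
    using Lim_transform_eventually[OF lim] by (simp only: diff_0_right)
qed

section \<open>Counting invariant maps\<close>

definition occ :: "'a set \<Rightarrow> ('a \<Rightarrow> 'z) \<Rightarrow> 'z \<Rightarrow> nat" where
  "occ Y F z = card {y \<in> Y. F y = z}"

definition inv_maps :: "'a set \<Rightarrow> 'z set \<Rightarrow> ('a \<Rightarrow> 'a) \<Rightarrow> ('a \<Rightarrow> 'z) set" where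
  "inv_maps Y Z g = {F \<in> Y \<rightarrow>\<^sub>E Z. F \<circ> g = F}"

definition occs :: "nat \<Rightarrow> 'z set \<Rightarrow> ('z \<Rightarrow> nat) set" where
  "occs n Z = {m. (\<forall>z. z \<notin> Z \<longrightarrow> m z = 0) \<and> (\<Sum>z\<in>Z. m z) = n}"

lemma finite_inv_maps [simp, intro]: "finite Y \<Longrightarrow> finite Z \<Longrightarrow> finite (inv_maps Y Z g)"
  unfolding inv_maps_def by (rule finite_subset[of _ "Y \<rightarrow>\<^sub>E Z"]) (auto intro!: finite_PiE)

lemma occ_in_occs:
  assumes "finite Y" "finite Z" "F \<in> Y \<rightarrow>\<^sub>E Z"
  shows "occ Y F \<in> occs (card Y) Z"
proof -
  have "card Y = card (\<Union>z\<in>Z. {y \<in> Y. F y = z})"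
    using assms(3) by (intro arg_cong[where f = card]) auto
  also have "\<dots> = (\<Sum>z\<in>Z. occ Y F z)"
    unfolding occ_def by (rule card_UN_disjoint) (use assms in auto)
  finally show ?thesis
    using assms(3) by (force simp: occs_def occ_def card_eq_0_iff)
qed

text \<open>By induction on Y: some value has positive multiplicity, since the multiplicities add up
  to the number of elements, and it is spent on the new element.\<close>

lemma occs_realized:
  assumes "finite Y" "finite Z" "m \<in> occs (card Y) Z"
  shows "\<exists>F\<in>Y \<rightarrow>\<^sub>E Z. occ Y F = m"
  using assms(1,3)
proof (induction Y arbitrary: m rule: finite_induct)
  case empty
  hence "m z = 0" for z
    using assms(2) by (cases "z \<in> Z") (auto simp: occs_def)
  thus ?case by (intro bexI[of _ "\<lambda>_. undefined"]) (auto simp: occ_def fun_eq_iff)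
next
  case (insert y Y)
  have m: "m z = 0" if "z \<notin> Z" for z using insert.prems that by (auto simp: occs_def)
  have s: "(\<Sum>z\<in>Z. m z) = Suc (card Y)" using insert by (auto simp: occs_def)
  hence "\<exists>z\<in>Z. m z \<noteq> 0" by (metis sum.neutral nat.distinct(1))
  then obtain z where z: "z \<in> Z" "m z > 0" by blast
  have "(\<Sum>x\<in>Z. (m(z := m z - 1)) x) = card Y"
    using s z assms(2) by (simp add: sum.remove[of Z z])
  hence "m(z := m z - 1) \<in> occs (card Y) Z"
    using m z by (auto simp: occs_def)
  then obtain F where F: "F \<in> Y \<rightarrow>\<^sub>E Z" "occ Y F = m(z := m z - 1)"
    using insert.IH by blast
  have "occ (insert y Y) (F(y := z)) x = m x" for x
  proof -
    have "{e \<in> insert y Y. (F(y := z)) e = x} = (if x = z then insert y {e \<in> Y. F e = x} else {e \<in> Y. F e = x})"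
      using insert.hyps by auto
    hence "occ (insert y Y) (F(y := z)) x = (if x = z then Suc (occ Y F x) else occ Y F x)"
      using insert.hyps by (simp add: occ_def)
    thus ?thesis using F(2) z(2) by (auto simp: fun_upd_def)
  qed
  hence "occ (insert y Y) (F(y := z)) = m" ..
  moreover have "F(y := z) \<in> insert y Y \<rightarrow>\<^sub>E Z"
    using F(1) z(1) by (auto simp: PiE_iff extensional_def)
  ultimately show ?case by blast
qed

lemma occ_comp:
  assumes "g permutes Y"
  shows "occ Y (F \<circ> g) = occ Y F"
proof
  fix z
  have "{y \<in> Y. F y = z} = g ` {y \<in> Y. (F \<circ> g) y = z}"
  proof (intro equalityI subsetI)
    fix y assume "y \<in> {y \<in> Y. F y = z}"
    thus "y \<in> g ` {y \<in> Y. (F \<circ> g) y = z}"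
      using permutes_inverses(1)[OF assms] permutes_in_image[OF permutes_inv[OF assms]]
      by (intro image_eqI[of _ _ "inv g y"]) auto
  qed (use permutes_in_image[OF assms] in auto)
  thus "occ Y (F \<circ> g) z = occ Y F z"
    unfolding occ_def using card_image[OF permutes_inj_on[OF assms]] by metis
qed

lemma eq_occ_imp_permuted:
  assumes "finite Y" "F \<in> Y \<rightarrow>\<^sub>E Z" "F' \<in> Y \<rightarrow>\<^sub>E Z" "occ Y F = occ Y F'"
  obtains p where "p permutes Y" "F = F' \<circ> p"
proof -
  have "image_mset F (mset_set Y) = image_mset F' (mset_set Y)"
  proof (rule multiset_eqI)
    fix z
    have "card {y \<in> Y. F y = z} = card {y \<in> Y. F' y = z}"
      using fun_cong[OF assms(4), of z] by (simp add: occ_def)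
    thus "count (image_mset F (mset_set Y)) z = count (image_mset F' (mset_set Y)) z"
      using assms(1) by (simp add: count_image_mset_eq_card_vimage)
  qed
  then obtain p where p: "p permutes Y" "\<forall>x\<in>Y. F x = F' (p x)"
    by (rule image_mset_eq_implies_permutes[OF assms(1)])
  have "F = F' \<circ> p"
  proof
    fix x show "F x = (F' \<circ> p) x"
      using p(2) PiE_arb[OF assms(2), of x] PiE_arb[OF assms(3), of x] permutes_not_in[OF p(1), of x]
      by (cases "x \<in> Y") simp_all
  qed
  with p(1) that show ?thesis by blast
qed

lemma comp_in_PiE: "F \<in> Y \<rightarrow>\<^sub>E Z \<Longrightarrow> g permutes Y \<Longrightarrow> F \<circ> g \<in> Y \<rightarrow>\<^sub>E Z"
  by (auto simp: PiE_iff extensional_def permutes_in_image permutes_not_in)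

lemma finite_occs:
  assumes "finite (Z :: 'z set)"
  shows "finite (occs n Z)"
proof -
  have "occs n Z \<subseteq> occ {..<n} ` ({..<n} \<rightarrow>\<^sub>E Z)"
    using occs_realized[of "{..<n}" Z] assms by fastforce
  thus ?thesis by (rule finite_subset) (use assms in \<open>auto intro!: finite_PiE\<close>)
qed

text \<open>Both sides count the pairs of a permutation and a map fixed by it, weighted by \<open>t\<close> of its content.\<close>

lemma burnside_occ:
  fixes t :: "('z \<Rightarrow> nat) \<Rightarrow> 'b::comm_ring_1"
  assumes Y: "finite Y" and Z: "finite Z"
  shows "(\<Sum>g | g permutes Y. \<Sum>F\<in>inv_maps Y Z g. t (occ Y F)) =
    of_nat (fact (card Y)) * (\<Sum>m\<in>occs (card Y) Z. t m)"
proof -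
  let ?G = "{g. g permutes Y}" and ?M = "Y \<rightarrow>\<^sub>E Z"
  have fin: "finite ?G" "finite ?M" using Y Z by (auto intro!: finite_PiE)
  have "(\<Sum>g\<in>?G. \<Sum>F\<in>inv_maps Y Z g. t (occ Y F)) =
      (\<Sum>g\<in>?G. \<Sum>F\<in>?M. if F \<circ> g = F then t (occ Y F) else 0)"
    unfolding inv_maps_def using fin(2) by (simp add: sum.inter_filter)
  also have "\<dots> = (\<Sum>F\<in>?M. \<Sum>g\<in>?G. if F \<circ> g = F then t (occ Y F) else 0)"
    by (rule sum.swap)
  also have "\<dots> = (\<Sum>F\<in>?M. of_nat (card {g \<in> ?G. F \<circ> g = F}) * t (occ Y F))"
    using fin(1) by (simp add: sum.inter_filter[symmetric])
  also have "\<dots> = (\<Sum>m\<in>occs (card Y) Z. \<Sum>F\<in>{F \<in> ?M. occ Y F = m}.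
      of_nat (card {g \<in> ?G. F \<circ> g = F}) * t (occ Y F))"
    by (rule sum.group[symmetric]) (use fin occ_in_occs[OF Y Z] finite_occs[OF Z] in auto)
  also have "\<dots> = (\<Sum>m\<in>occs (card Y) Z. of_nat (fact (card Y)) * t m)"
  proof (intro sum.cong refl)
    fix m assume m: "m \<in> occs (card Y) Z"
    let ?Mm = "{F \<in> ?M. occ Y F = m}"
    obtain F0 where F0: "F0 \<in> ?M" "occ Y F0 = m"
      using occs_realized[OF Y Z m] by blast
    \<comment> \<open>The stabilizer of F has as many elements as the set of permutations that carry
      the fixed map \<open>F0\<close> to F. These sets partition the whole group when F runs through
      the maps of content m, so each content accounts for \<open>fact (card Y)\<close>.\<close>
    have stab: "card {g \<in> ?G. F \<circ> g = F} = card {g \<in> ?G. F0 \<circ> g = F}" if "F \<in> ?Mm" for F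
    proof -
      have "F \<in> ?M" "occ Y F = occ Y F0" using that F0 by auto
      from eq_occ_imp_permuted[OF Y this(1) F0(1) this(2)]
      obtain p where p: "p permutes Y" "F = F0 \<circ> p" by blast
      have "F0 = F \<circ> inv p"
        using p by (simp add: o_assoc[symmetric] permutes_inv_o)
      hence f: "F0 \<circ> (p \<circ> g) = F \<circ> g" "F \<circ> (inv p \<circ> g) = F0 \<circ> g" for g
        using p by (simp_all add: o_assoc)
      have "bij_betw (\<lambda>g. p \<circ> g) {g \<in> ?G. F \<circ> g = F} {g \<in> ?G. F0 \<circ> g = F}"
      proof (rule bij_betwI[of _ _ _ "\<lambda>g. inv p \<circ> g"])
        show "(\<lambda>g. p \<circ> g) \<in> {g \<in> ?G. F \<circ> g = F} \<rightarrow> {g \<in> ?G. F0 \<circ> g = F}"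
          by (rule funcsetI) (simp add: f(1) p(1) permutes_compose)
        show "(\<lambda>g. inv p \<circ> g) \<in> {g \<in> ?G. F0 \<circ> g = F} \<rightarrow> {g \<in> ?G. F \<circ> g = F}"
          by (rule funcsetI) (simp add: f(2) permutes_inv[OF p(1)] permutes_compose)
      qed (simp_all add: o_assoc permutes_inv_o[OF p(1)])
      thus ?thesis by (rule bij_betw_same_card)
    qed
    have "(\<Sum>F\<in>?Mm. card {g \<in> ?G. F \<circ> g = F}) = (\<Sum>F\<in>?Mm. card {g \<in> ?G. F0 \<circ> g = F})"
      by (rule sum.cong) (use stab in auto)
    also have "\<dots> = card (\<Union>F\<in>?Mm. {g \<in> ?G. F0 \<circ> g = F})"
      by (rule card_UN_disjoint[symmetric]) (use fin in auto)
    also have "(\<Union>F\<in>?Mm. {g \<in> ?G. F0 \<circ> g = F}) = ?G"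
      using comp_in_PiE[OF F0(1)] F0(2) by (auto simp: occ_comp)
    also have "card ?G = fact (card Y)"
      using card_permutations[OF refl Y] by simp
    finally have "(\<Sum>F\<in>?Mm. card {g \<in> ?G. F \<circ> g = F}) = fact (card Y)" .
    from arg_cong[OF this, of "of_nat :: nat \<Rightarrow> 'b"]
    show "(\<Sum>F\<in>?Mm. of_nat (card {g \<in> ?G. F \<circ> g = F}) * t (occ Y F)) = of_nat (fact (card Y)) * t m"
      by (simp add: sum_distrib_right[symmetric])
  qed
  also have "\<dots> = of_nat (fact (card Y)) * (\<Sum>m\<in>occs (card Y) Z. t m)"
    by (rule sum_distrib_left[symmetric])
  finally show ?thesis .
qed

section \<open>Pieri's rule\<close>

text \<open>
  The recursion computes the coefficient of \<open>x\<^sup>\<alpha>\<close> in the product of the Vandermonde alternant with the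
  complete homogeneous polynomials of degrees \<open>\<mu> 0, \<dots>, \<mu> (v - 1)\<close>.
\<close>

definition below :: "nat \<Rightarrow> nat \<Rightarrow> (nat \<Rightarrow> nat) \<Rightarrow> (nat \<Rightarrow> nat) set" where
  "below N r \<alpha> = {\<beta>. (\<forall>i. \<beta> i \<le> \<alpha> i) \<and> (\<Sum>i<N. \<beta> i) + r = (\<Sum>i<N. \<alpha> i)}"

fun pieri :: "nat \<Rightarrow> (nat \<Rightarrow> nat) \<Rightarrow> nat \<Rightarrow> (nat \<Rightarrow> nat) \<Rightarrow> int" where
  "pieri N \<mu> 0 \<alpha> = (\<Sum>w | w permutes {..<N}. if delta N \<circ> w = \<alpha> then sign w else 0)"
| "pieri N \<mu> (Suc v) \<alpha> = (\<Sum>\<beta>\<in>below N (\<mu> v) \<alpha>. pieri N \<mu> v \<beta>)"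

definition supported :: "nat \<Rightarrow> (nat \<Rightarrow> nat) \<Rightarrow> bool" where
  "supported N \<alpha> \<longleftrightarrow> (\<forall>i\<ge>N. \<alpha> i = 0)"

definition strict_dec :: "nat \<Rightarrow> (nat \<Rightarrow> nat) \<Rightarrow> bool" where
  "strict_dec N \<alpha> \<longleftrightarrow> (\<forall>i. Suc i < N \<longrightarrow> \<alpha> (Suc i) < \<alpha> i)"

lemma finite_below:
  assumes "supported N \<alpha>"
  shows "finite (below N r \<alpha>)"
proof (rule finite_subset)
  show "below N r \<alpha> \<subseteq> weights N ((\<Sum>i<N. \<alpha> i) - r)"
    using assms by (auto simp: below_def weights_def supported_def) (metis le_zero_eq)
qed simp

lemma supported_below: "supported N \<alpha> \<Longrightarrow> \<beta> \<in> below N r \<alpha> \<Longrightarrow> supported N \<beta>"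
  by (auto simp: below_def supported_def) (metis le_zero_eq)

lemma below_comp:
  assumes u: "u permutes {..<N}" and \<beta>: "\<beta> \<in> below N r \<alpha>"
  shows "\<beta> \<circ> u \<in> below N r (\<alpha> \<circ> u)"
  using \<beta> sum.permute[OF u, of \<alpha>] sum.permute[OF u, of \<beta>] by (simp add: below_def)

text \<open>Complete homogeneous polynomials are symmetric, so their product with an alternant is
  alternating. In the recursion this is the equivariance of \<open>below\<close>.\<close>

lemma pieri_perm:
  assumes u: "u permutes {..<N}"
  shows "pieri N \<mu> v (\<alpha> \<circ> u) = sign u * pieri N \<mu> v \<alpha>"
proof (induction v arbitrary: \<alpha>)
  case 0
  let ?P = "{w. w permutes {..<N}}"
  have "pieri N \<mu> 0 (\<alpha> \<circ> u) = (\<Sum>w\<in>?P. if delta N \<circ> (w \<circ> u) = \<alpha> \<circ> u then sign (w \<circ> u) else 0)"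
    unfolding pieri.simps
    by (rule sum.reindex_bij_witness[of _ "\<lambda>w. w \<circ> u" "\<lambda>w. w \<circ> inv u"])
       (use u in \<open>auto simp: o_assoc[symmetric] permutes_inv_o intro: permutes_compose permutes_inv\<close>)
  also have "\<dots> = (\<Sum>w\<in>?P. if delta N \<circ> w = \<alpha> then sign u * sign w else 0)"
  proof (intro sum.cong refl)
    fix w assume "w \<in> ?P"
    moreover have "delta N \<circ> (w \<circ> u) = \<alpha> \<circ> u \<longleftrightarrow> delta N \<circ> w = \<alpha>"
      using permutes_inv_o(1)[OF u] by (metis comp_id o_assoc)
    ultimately show "(if delta N \<circ> (w \<circ> u) = \<alpha> \<circ> u then sign (w \<circ> u) else 0) =
        (if delta N \<circ> w = \<alpha> then sign u * sign w else 0)"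
      using u by (simp add: sign_comp[of "{..<N}"])
  qed
  also have "\<dots> = sign u * pieri N \<mu> 0 \<alpha>"
    by (auto simp: sum_distrib_left intro!: sum.cong)
  finally show ?case .
next
  case (Suc v)
  have "pieri N \<mu> (Suc v) (\<alpha> \<circ> u) = (\<Sum>\<beta>\<in>below N (\<mu> v) \<alpha>. pieri N \<mu> v (\<beta> \<circ> u))"
    unfolding pieri.simps
  proof (rule sum.reindex_bij_witness[of _ "\<lambda>\<beta>. \<beta> \<circ> u" "\<lambda>\<beta>. \<beta> \<circ> inv u"])
    show "\<beta> \<circ> inv u \<in> below N (\<mu> v) \<alpha>" if "\<beta> \<in> below N (\<mu> v) (\<alpha> \<circ> u)" for \<beta>
      using below_comp[OF permutes_inv[OF u] that] u by (simp add: o_assoc[symmetric] permutes_inv_o)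
  qed (use u below_comp[OF u] in \<open>auto simp: o_assoc[symmetric] permutes_inv_o\<close>)
  thus ?case
    by (simp only: Suc.IH sum_distrib_left pieri.simps)
qed

text \<open>A sign-reversing involution: at the first i with \<beta> i \<le> \<alpha> (Suc i), the
  entries of \<beta> at i and Suc i are exchanged. The result is again below \<alpha>, has the same
  first violation and the opposite coefficient. What survives are the horizontal strips of Pieri's
  rule.\<close>

lemma pieri_interlacing:
  assumes \<alpha>: "supported N \<alpha>" "strict_dec N \<alpha>"
  shows "pieri N \<mu> (Suc v) \<alpha> =
    (\<Sum>\<beta> | \<beta> \<in> below N (\<mu> v) \<alpha> \<and> (\<forall>i. Suc i < N \<longrightarrow> \<alpha> (Suc i) < \<beta> i). pieri N \<mu> v \<beta>)"
proof -
  let ?B = "below N (\<mu> v) \<alpha>"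
  let ?bad = "\<lambda>\<beta> i. Suc i < N \<and> \<beta> i \<le> \<alpha> (Suc i)"
  let ?C = "{\<beta> \<in> ?B. \<exists>i. ?bad \<beta> i}"
  let ?i = "\<lambda>\<beta>. LEAST i. ?bad \<beta> i"
  let ?t = "\<lambda>i::nat. Transposition.transpose i (Suc i)"
  let ?s = "\<lambda>\<beta>. \<beta> \<circ> ?t (?i \<beta>)"
  have t: "?t i permutes {..<N}" if "Suc i < N" for i
    using that by (intro permutes_swap_id) auto
  have swap: "?s \<beta> \<in> ?C" "?i (?s \<beta>) = ?i \<beta>" "pieri N \<mu> v (?s \<beta>) = - pieri N \<mu> v \<beta>" if "\<beta> \<in> ?C" for \<beta>
  proof -
    have \<beta>: "\<beta> \<in> ?B" "?bad \<beta> (?i \<beta>)"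
      using that LeastI_ex[of "?bad \<beta>"] by auto
    define i where "i = ?i \<beta>"
    have i: "Suc i < N" "\<beta> i \<le> \<alpha> (Suc i)" using \<beta>(2) by (auto simp: i_def)
    have least: "\<alpha> (Suc k) < \<beta> k" if "k < i" for k
      using not_less_Least[of k "?bad \<beta>"] that i(1) by (auto simp: i_def)
    have le: "\<beta> k \<le> \<alpha> k" for k using \<beta>(1) by (auto simp: below_def)
    have s: "(\<beta> \<circ> ?t i) k = (if k = i then \<beta> (Suc i) else if k = Suc i then \<beta> i else \<beta> k)" for k
      by (simp add: Transposition.transpose_def)
    have "\<alpha> (Suc i) < \<alpha> i" using \<alpha>(2) i(1) by (auto simp: strict_dec_def)
    hence "(\<beta> \<circ> ?t i) k \<le> \<alpha> k" for k
      unfolding s using le[of "Suc i"] le[of i] le[of k] i(2) by auto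
    moreover have "(\<Sum>k<N. (\<beta> \<circ> ?t i) k) = (\<Sum>k<N. \<beta> k)"
      using sum.permute[OF t[OF i(1)], of \<beta>] by simp
    ultimately have B: "\<beta> \<circ> ?t i \<in> ?B" using \<beta>(1) by (simp add: below_def)
    \<comment> \<open>The new entry at i was the entry at \<open>Suc i\<close> and therefore bounded
      by \<open>\<alpha> (Suc i)\<close>, so the violation at i persists; the earlier positions are
      untouched.\<close>
    have bad: "?bad (\<beta> \<circ> ?t i) i" using i(1) s[of i] le[of "Suc i"] by simp
    have "?i (\<beta> \<circ> ?t i) = i"
    proof (rule Least_equality[where P = "?bad (\<beta> \<circ> ?t i)", OF bad])
      fix k assume "?bad (\<beta> \<circ> ?t i) k"
      thus "i \<le> k" using least[of k] s[of k] by (cases "k < i") auto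
    qed
    thus "?i (?s \<beta>) = ?i \<beta>" by (simp only: i_def)
    show "?s \<beta> \<in> ?C" using B bad by (auto simp only: i_def)
    show "pieri N \<mu> v (?s \<beta>) = - pieri N \<mu> v \<beta>"
      using pieri_perm[OF t[OF i(1)], of \<mu> v \<beta>] by (simp add: i_def sign_swap_id)
  qed
  have fin: "finite ?B" by (rule finite_below[OF \<alpha>(1)])
  have inv: "?s (?s \<beta>) = \<beta>" if "\<beta> \<in> ?C" for \<beta>
    unfolding swap(2)[OF that] by (simp add: o_assoc[symmetric])
  have "(\<Sum>\<beta>\<in>?C. pieri N \<mu> v \<beta>) = (\<Sum>\<beta>\<in>?C. - pieri N \<mu> v \<beta>)"
    by (rule sum.reindex_bij_witness[of _ ?s ?s]) (use swap inv in auto)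
  hence "(\<Sum>\<beta>\<in>?C. pieri N \<mu> v \<beta>) = 0" by (simp add: sum_negf)
  moreover have "(\<Sum>\<beta>\<in>?B. pieri N \<mu> v \<beta>) = (\<Sum>\<beta>\<in>?C. pieri N \<mu> v \<beta>) + (\<Sum>\<beta>\<in>?B - ?C. pieri N \<mu> v \<beta>)"
    by (subst add.commute, rule sum.subset_diff) (use fin in auto)
  moreover have "?B - ?C = {\<beta> \<in> ?B. \<forall>i. Suc i < N \<longrightarrow> \<alpha> (Suc i) < \<beta> i}"
    by (auto simp: not_le)
  ultimately show ?thesis by simp
qed

lemma strict_dec_less:
  assumes "strict_dec N \<alpha>" "i < j" "j < N"
  shows "\<alpha> j < \<alpha> i"
  using assms(2,3)
proof (induction j)
  case (Suc j)
  have "\<alpha> (Suc j) < \<alpha> j" using assms(1) Suc.prems by (auto simp: strict_dec_def)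
  moreover have "\<alpha> j \<le> \<alpha> i" using Suc by (cases "i = j") auto
  ultimately show ?case by simp
qed auto

lemma strict_dec_ge_delta:
  assumes "strict_dec N \<alpha>"
  shows "delta N i \<le> \<alpha> i"
proof (cases "i < N")
  case True
  hence "i \<le> N - 1" by simp
  thus ?thesis
  proof (induction rule: inc_induct)
    case (step i)
    hence "\<alpha> (Suc i) < \<alpha> i" using assms by (auto simp: strict_dec_def)
    thus ?case using step by (auto simp: delta_def)
  qed (simp add: delta_def)
qed (simp add: delta_def)

lemma strict_dec_delta: "strict_dec N (delta N)"
  by (auto simp: strict_dec_def delta_def)

lemma supported_delta: "supported N (delta N)"
  by (auto simp: supported_def delta_def)

lemma supported_comp: "supported N \<alpha> \<Longrightarrow> u permutes {..<N} \<Longrightarrow> supported N (\<alpha> \<circ> u)"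
  by (auto simp: supported_def permutes_not_in)

lemma strict_dec_eq_delta:
  assumes "strict_dec N \<alpha>" "w permutes {..<N}" "delta N \<circ> w = \<alpha>"
  shows "\<alpha> = delta N"
proof
  fix i
  have "\<alpha> ` {..<N} = delta N ` {..<N}"
    unfolding assms(3)[symmetric] image_comp[symmetric] permutes_image[OF assms(2)] ..
  hence "i < N \<Longrightarrow> \<alpha> i = delta N i"
    using strict_decreasing_eqI[of N \<alpha> "delta N" i] strict_dec_less[OF assms(1)]
      strict_dec_less[OF strict_dec_delta] by blast
  moreover have "\<not> i < N \<Longrightarrow> \<alpha> i = delta N i"
    using supported_comp[OF supported_delta assms(2)] supported_delta[of N] assms(3)
    by (auto simp: supported_def)
  ultimately show "\<alpha> i = delta N i" by blast
qed

lemma strict_dec_interlacing: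
  assumes "strict_dec N \<alpha>" "\<beta> \<in> below N r \<alpha>" "\<forall>i. Suc i < N \<longrightarrow> \<alpha> (Suc i) < \<beta> i"
  shows "strict_dec N \<beta>"
  using assms by (auto simp: strict_dec_def below_def) (metis le_less_trans)

text \<open>The triangularity of Kostka numbers. By interlacing, each horizontal strip reaches at
  most one row further down, so that after v strips only the first v rows exceed \<delta>. Hence the
  boxes of the first v' strips all lie in the first v' rows.\<close>

lemma pieri_nonzero:
  assumes "supported N \<alpha>" "strict_dec N \<alpha>" "pieri N \<mu> v \<alpha> \<noteq> 0" "v \<le> N"
  shows "(\<forall>i\<ge>v. \<alpha> i = delta N i) \<and>
    (\<forall>v'\<le>v. (\<Sum>i<v'. delta N i) + (\<Sum>u<v'. \<mu> u) \<le> (\<Sum>i<v'. \<alpha> i)) \<and>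
    (\<Sum>i<N. \<alpha> i) = (\<Sum>i<N. delta N i) + (\<Sum>u<v. \<mu> u)"
  using assms
proof (induction v arbitrary: \<alpha>)
  case 0
  have "\<exists>w. w permutes {..<N} \<and> delta N \<circ> w = \<alpha>"
    using 0(3) by (auto simp: sum.If_cases elim!: sum.not_neutral_contains_not_neutral split: if_splits)
  hence "\<alpha> = delta N" using strict_dec_eq_delta[OF 0(2)] by blast
  thus ?case by simp
next
  case (Suc v)
  obtain \<beta> where \<beta>: "\<beta> \<in> below N (\<mu> v) \<alpha>" "\<forall>i. Suc i < N \<longrightarrow> \<alpha> (Suc i) < \<beta> i" "pieri N \<mu> v \<beta> \<noteq> 0"
    using Suc.prems(3) unfolding pieri_interlacing[OF Suc.prems(1,2)]
    by (auto elim!: sum.not_neutral_contains_not_neutral)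
  have le: "\<beta> i \<le> \<alpha> i" for i using \<beta>(1) by (auto simp: below_def)
  have IH: "\<And>i. v \<le> i \<Longrightarrow> \<beta> i = delta N i"
      "\<And>v'. v' \<le> v \<Longrightarrow> (\<Sum>i<v'. delta N i) + (\<Sum>u<v'. \<mu> u) \<le> (\<Sum>i<v'. \<beta> i)"
      "(\<Sum>i<N. \<beta> i) = (\<Sum>i<N. delta N i) + (\<Sum>u<v. \<mu> u)"
    using Suc.IH[OF supported_below[OF Suc.prems(1) \<beta>(1)] strict_dec_interlacing[OF Suc.prems(2) \<beta>(1,2)] \<beta>(3)]
      Suc.prems(4) by auto
  have tail: "\<alpha> i = delta N i" if i: "Suc v \<le> i" for i
  proof (cases "i < N")
    case True
    \<comment> \<open>Interlacing puts \<alpha> i strictly below \<open>delta N (i - 1)\<close>,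
      which is \<open>delta N i\<close> plus 1; strict decrease gives the reverse bound.\<close>
    have "\<alpha> i < \<beta> (i - 1)" using \<beta>(2)[rule_format, of "i - 1"] i True by auto
    also have "\<dots> = delta N (i - 1)" using IH(1)[of "i - 1"] i by auto
    finally have "\<alpha> i \<le> delta N i" using i True by (auto simp: delta_def)
    thus ?thesis using strict_dec_ge_delta[OF Suc.prems(2), of i] by simp
  qed (use Suc.prems(1) in \<open>auto simp: supported_def delta_def\<close>)
  have total: "(\<Sum>i<N. \<alpha> i) = (\<Sum>i<N. delta N i) + (\<Sum>u<Suc v. \<mu> u)"
    using \<beta>(1) IH(3) by (simp add: below_def)
  have split: "(\<Sum>i<N. f i) = (\<Sum>i<Suc v. f i) + (\<Sum>i\<in>{Suc v..<N}. f i)" for f :: "nat \<Rightarrow> nat"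
    using sum.atLeastLessThan_concat[of 0 "Suc v" N f] Suc.prems(4) by (simp only: atLeast0LessThan)
  have "(\<Sum>i\<in>{Suc v..<N}. \<alpha> i) = (\<Sum>i\<in>{Suc v..<N}. delta N i)"
    by (rule sum.cong) (use tail in auto)
  \<comment> \<open>For v' = Suc v the partial sum is the total one up to entries of \<delta>, so
    the bound even holds with equality.\<close>
  hence "(\<Sum>i<Suc v. delta N i) + (\<Sum>u<Suc v. \<mu> u) = (\<Sum>i<Suc v. \<alpha> i)"
    using total split[of \<alpha>] split[of "delta N"] by linarith
  moreover have "(\<Sum>i<v'. delta N i) + (\<Sum>u<v'. \<mu> u) \<le> (\<Sum>i<v'. \<alpha> i)" if "v' \<le> v" for v'
    using IH(2)[OF that] sum_mono[of "{..<v'}" \<beta> \<alpha>] le by force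
  ultimately have "(\<Sum>i<v'. delta N i) + (\<Sum>u<v'. \<mu> u) \<le> (\<Sum>i<v'. \<alpha> i)" if "v' \<le> Suc v" for v'
    using that by (cases "v' = Suc v") auto
  thus ?case using tail total by blast
qed

text \<open>The Kostka number of equal shape and content is 1: since the partial sums are tight, the
  last strip can only be the whole excess \<open>\<mu> v\<close> of row v, and removing it leaves
  the same situation with one row less.\<close>

lemma pieri_eq_1:
  assumes "supported N \<alpha>" "strict_dec N \<alpha>" "v \<le> N" "\<And>i. v \<le> i \<Longrightarrow> \<alpha> i = delta N i"
    and "\<And>v'. v' \<le> v \<Longrightarrow> (\<Sum>i<v'. \<alpha> i) = (\<Sum>i<v'. delta N i) + (\<Sum>u<v'. \<mu> u)"
  shows "pieri N \<mu> v \<alpha> = 1"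
  using assms
proof (induction v arbitrary: \<alpha>)
  case 0
  hence \<alpha>: "\<alpha> = delta N" by auto
  have "w = id" if w: "w permutes {..<N}" "delta N \<circ> w = delta N" for w
  proof
    fix i
    have "delta N (w i) = delta N i" using w(2) by (metis comp_apply)
    thus "w i = id i"
      using permutes_in_image[OF w(1), of i] permutes_not_in[OF w(1), of i]
      by (cases "i < N") (auto simp: delta_def)
  qed
  hence "pieri N \<mu> 0 \<alpha> = (\<Sum>w\<in>{id}. if delta N \<circ> w = \<alpha> then sign w else 0)"
    unfolding pieri.simps by (intro sum.mono_neutral_right) (auto simp: \<alpha> permutes_id)
  thus ?case by (simp add: \<alpha>)
next
  case (Suc v)
  define \<beta> where "\<beta> = (\<lambda>i. if i < v then \<alpha> i else delta N i)"
  let ?I = "{\<beta> \<in> below N (\<mu> v) \<alpha>. \<forall>i. Suc i < N \<longrightarrow> \<alpha> (Suc i) < \<beta> i}"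
  have v: "\<alpha> v = delta N v + \<mu> v"
    using Suc.prems(5)[of v] Suc.prems(5)[of "Suc v"] by simp
  have \<alpha>\<beta>: "\<alpha> i = \<beta> i + (if i = v then \<mu> v else 0)" for i
    using v Suc.prems(4)[of i] by (auto simp: \<beta>_def)
  have "(\<Sum>i<N. \<alpha> i) = (\<Sum>i<N. \<beta> i) + \<mu> v"
    unfolding \<alpha>\<beta> sum.distrib using Suc.prems(3) by simp
  hence \<beta>_below: "\<beta> \<in> below N (\<mu> v) \<alpha>"
    using \<alpha>\<beta> by (auto simp: below_def)
  have "\<alpha> (Suc i) < \<beta> i" if "Suc i < N" for i
  proof (cases "i < v")
    case True
    thus ?thesis using Suc.prems(2) that by (auto simp: \<beta>_def strict_dec_def)
  next
    case False
    thus ?thesis using Suc.prems(4)[of "Suc i"] that by (auto simp: \<beta>_def delta_def)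
  qed
  hence \<beta>I: "\<beta> \<in> ?I" using \<beta>_below by blast
  \<comment> \<open>A contributing \<gamma> equals \<delta> from row v on. Its first v entries are
    bounded by those of \<alpha> and have at least the same sum, so they are equal to them.\<close>
  have unique: "\<gamma> = \<beta>" if \<gamma>: "\<gamma> \<in> ?I" "pieri N \<mu> v \<gamma> \<noteq> 0" for \<gamma>
  proof
    fix i
    have le: "\<gamma> i \<le> \<alpha> i" for i using \<gamma>(1) by (auto simp: below_def)
    have nz: "\<And>i. v \<le> i \<Longrightarrow> \<gamma> i = delta N i"
      "(\<Sum>i<v. delta N i) + (\<Sum>u<v. \<mu> u) \<le> (\<Sum>i<v. \<gamma> i)"
      using pieri_nonzero[of N \<gamma> \<mu> v] \<gamma> supported_below[OF Suc.prems(1)]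
        strict_dec_interlacing[OF Suc.prems(2)] Suc.prems(3) by auto
    have "(\<Sum>i<v. \<alpha> i) \<le> (\<Sum>i<v. \<gamma> i)"
      using nz(2) Suc.prems(5)[of v] by simp
    hence "(\<Sum>i<v. \<gamma> i) = (\<Sum>i<v. \<alpha> i)"
      using sum_mono[of "{..<v}" \<gamma> \<alpha>] le by (meson antisym)
    hence "\<gamma> i = \<alpha> i" if "i < v"
      using sum_mono_inv[of \<gamma> "{..<v}" \<alpha> i] le that by auto
    thus "\<gamma> i = \<beta> i" using nz(1)[of i] by (auto simp: \<beta>_def)
  qed
  have "pieri N \<mu> (Suc v) \<alpha> = (\<Sum>\<gamma>\<in>?I. pieri N \<mu> v \<gamma>)"
    by (rule pieri_interlacing[OF Suc.prems(1,2)])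
  also have "\<dots> = (\<Sum>\<gamma>\<in>{\<beta>}. pieri N \<mu> v \<gamma>)"
    by (rule sum.mono_neutral_right)
       (use unique \<beta>I finite_below[OF Suc.prems(1)] in auto)
  also have "\<dots> = 1"
  proof -
    have "(\<Sum>i<v'. \<beta> i) = (\<Sum>i<v'. \<alpha> i)" if "v' \<le> v" for v'
      by (rule sum.cong) (use that in \<open>auto simp: \<beta>_def\<close>)
    hence "pieri N \<mu> v \<beta> = 1"
      using \<beta>I Suc.prems(3,5) supported_below[OF Suc.prems(1) \<beta>_below]
        strict_dec_interlacing[OF Suc.prems(2) \<beta>_below]
      by (intro Suc.IH) (auto simp: \<beta>_def)
    thus ?thesis by simp
  qed
  finally show ?case .
qed

text \<open>By induction, w fixes everything below v. The partial sum for \<open>Suc v\<close> then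
  forces w v \<le> v because \<delta> is decreasing, and injectivity excludes w v < v.\<close>

lemma delta_dominance:
  assumes w: "w permutes {..<N}" and dom: "\<And>v. v \<le> N \<Longrightarrow> (\<Sum>u<v. delta N u) \<le> (\<Sum>u<v. delta N (w u))"
  shows "w = id"
proof -
  have "w v = v" if "v < N" for v
    using that
  proof (induction v rule: less_induct)
    case (less v)
    have "(\<Sum>u<v. delta N (w u)) = (\<Sum>u<v. delta N u)"
      by (rule sum.cong) (use less in auto)
    hence "delta N v \<le> delta N (w v)"
      using dom[of "Suc v"] less.prems by simp
    hence "w v \<le> v"
      using less.prems permutes_in_image[OF w, of v] by (auto simp: delta_def)
    moreover have "\<not> w v < v"
    proof
      assume *: "w v < v"
      hence "w (w v) = w v" using less by auto
      thus False using permutes_inj[OF w] * by (metis injD less_irrefl)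
    qed
    ultimately show ?case by simp
  qed
  thus ?thesis using permutes_not_in[OF w] by (intro ext) (metis id_apply lessThan_iff)
qed

section \<open>Matrices with prescribed row and column sums\<close>

text \<open>For fixed w these matrices count how often x^\<beta> arises from the monomial with
  exponent \<delta> w times complete homogeneous polynomials: column j records the monomial taken
  from the factor of degree \<open>\<mu> j\<close>. Entries outside the N by v rectangle are 0, so
  that a matrix is a single function.\<close>

definition mats :: "nat \<Rightarrow> (nat \<Rightarrow> nat) \<Rightarrow> (nat \<Rightarrow> nat) \<Rightarrow> nat \<Rightarrow> (nat \<Rightarrow> nat) \<Rightarrow> (nat \<times> nat \<Rightarrow> nat) set" where
  "mats N \<mu> w v \<beta> = {A. (\<forall>i j. \<not> (i < N \<and> j < v) \<longrightarrow> A (i, j) = 0) \<and>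
     (\<lambda>i. (\<Sum>j<v. A (i, j)) + delta N (w i)) = \<beta> \<and> (\<forall>j<v. (\<Sum>i<N. A (i, j)) = \<mu> j)}"

lemma finite_mats: "finite (mats N \<mu> w v \<beta>)"
proof (rule finite_subset)
  let ?Z = "{..<N} \<times> {..<v}"
  let ?M = "\<Sum>i<N. \<beta> i"
  show "mats N \<mu> w v \<beta> \<subseteq> (\<lambda>f z. if z \<in> ?Z then f z else 0) ` (?Z \<rightarrow>\<^sub>E {..?M})"
  proof
    fix A assume A: "A \<in> mats N \<mu> w v \<beta>"
    have "A (i, j) \<le> ?M" if "i < N" "j < v" for i j
    proof -
      have "A (i, j) \<le> (\<Sum>j<v. A (i, j))" using that by (intro member_le_sum) auto
      also have "\<dots> \<le> \<beta> i" using A by (auto simp: mats_def)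
      also have "\<dots> \<le> ?M" using that by (intro member_le_sum) auto
      finally show ?thesis .
    qed
    thus "A \<in> (\<lambda>f z. if z \<in> ?Z then f z else 0) ` (?Z \<rightarrow>\<^sub>E {..?M})"
      using A by (intro image_eqI[of _ _ "restrict A ?Z"]) (auto simp: mats_def fun_eq_iff)
  qed
qed (auto intro!: finite_PiE)

text \<open>The last column is determined by \<alpha> and the other columns, so deleting it is
  injective; the row data of what remains range over \<open>below\<close>.\<close>

lemma card_mats_Suc:
  assumes \<alpha>: "supported N \<alpha>" and w: "w permutes {..<N}"
  shows "card (mats N \<mu> w (Suc v) \<alpha>) = (\<Sum>\<beta>\<in>below N (\<mu> v) \<alpha>. card (mats N \<mu> w v \<beta>))"
proof -
  let ?f = "\<lambda>A (i, j). if j = v then 0 else A (i, j)"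
  let ?g = "\<lambda>A (i, j). if j = v then \<alpha> i - ((\<Sum>j<v. A (i, j)) + delta N (w i)) else A (i, j)"
  let ?U = "\<Union>\<beta>\<in>below N (\<mu> v) \<alpha>. mats N \<mu> w v \<beta>"
  have "bij_betw ?f (mats N \<mu> w (Suc v) \<alpha>) ?U"
  proof (rule bij_betwI[of _ _ _ ?g])
    show "?f \<in> mats N \<mu> w (Suc v) \<alpha> \<rightarrow> ?U"
    proof
      fix A assume A: "A \<in> mats N \<mu> w (Suc v) \<alpha>"
      let ?\<beta> = "\<lambda>i. (\<Sum>j<v. A (i, j)) + delta N (w i)"
      have 1: "\<alpha> i = ?\<beta> i + A (i, v)" for i using A by (auto simp: mats_def)
      have "(\<Sum>i<N. \<alpha> i) = (\<Sum>i<N. ?\<beta> i) + \<mu> v"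
        using A unfolding 1 sum.distrib[of _ "\<lambda>i. A (i, v)"] by (simp add: mats_def)
      hence "?\<beta> \<in> below N (\<mu> v) \<alpha>" using 1 by (simp add: below_def)
      moreover have "?f A \<in> mats N \<mu> w v ?\<beta>" using A by (auto simp: mats_def)
      ultimately show "?f A \<in> ?U" by blast
    qed
    show "?g \<in> ?U \<rightarrow> mats N \<mu> w (Suc v) \<alpha>"
    proof
      fix A assume "A \<in> ?U"
      then obtain \<beta> where \<beta>: "\<beta> \<in> below N (\<mu> v) \<alpha>" "A \<in> mats N \<mu> w v \<beta>" by blast
      have b: "(\<Sum>j<v. A (i, j)) + delta N (w i) = \<beta> i" for i
        using \<beta>(2) by (auto simp: mats_def)
      have le: "\<beta> i \<le> \<alpha> i" for i using \<beta>(1) by (auto simp: below_def)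
      have "(\<Sum>i<N. \<alpha> i - \<beta> i) = \<mu> v"
        using \<beta>(1) le by (subst sum_subtractf_nat) (auto simp: below_def)
      hence "(\<Sum>i<N. ?g A (i, j)) = \<mu> j" if "j < Suc v" for j
        using that \<beta>(2) by (cases "j = v") (simp_all add: b mats_def)
      moreover have "(\<Sum>j<Suc v. ?g A (i, j)) + delta N (w i) = \<alpha> i" for i
      proof -
        have "(\<Sum>j<Suc v. ?g A (i, j)) = (\<Sum>j<v. A (i, j)) + (\<alpha> i - \<beta> i)"
          by (simp add: b)
        thus ?thesis using b[of i] le[of i] by simp
      qed
      moreover have "?g A (i, j) = 0" if "\<not> (i < N \<and> j < Suc v)" for i j
        using that \<beta>(2) \<alpha> by (auto simp: mats_def supported_def)
      ultimately show "?g A \<in> mats N \<mu> w (Suc v) \<alpha>"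
        unfolding mats_def by blast
    qed
    show "?g (?f A) = A" if A: "A \<in> mats N \<mu> w (Suc v) \<alpha>" for A
    proof -
      have "\<alpha> i = (\<Sum>j<v. A (i, j)) + A (i, v) + delta N (w i)" for i
        using A by (auto simp: mats_def)
      thus ?thesis by (auto simp: fun_eq_iff)
    qed
    show "?f (?g A) = A" if "A \<in> ?U" for A
      using that by (auto simp: fun_eq_iff mats_def)
  qed
  hence "card (mats N \<mu> w (Suc v) \<alpha>) = card ?U" by (rule bij_betw_same_card)
  also have "\<dots> = (\<Sum>\<beta>\<in>below N (\<mu> v) \<alpha>. card (mats N \<mu> w v \<beta>))"
    by (rule card_UN_disjoint) (use finite_below[OF \<alpha>] finite_mats in \<open>auto simp: mats_def\<close>)
  finally show ?thesis .
qed

lemma pieri_eq_sum_mats: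
  assumes "supported N \<alpha>"
  shows "pieri N \<mu> v \<alpha> = (\<Sum>w | w permutes {..<N}. sign w * int (card (mats N \<mu> w v \<alpha>)))"
  using assms
proof (induction v arbitrary: \<alpha>)
  case 0
  have "mats N \<mu> w 0 \<alpha> = (if delta N \<circ> w = \<alpha> then {\<lambda>_. 0} else {})" for w
    by (auto simp: mats_def fun_eq_iff)
  thus ?case by (auto intro!: sum.cong)
next
  case (Suc v)
  have "pieri N \<mu> (Suc v) \<alpha> =
      (\<Sum>\<beta>\<in>below N (\<mu> v) \<alpha>. \<Sum>w | w permutes {..<N}. sign w * int (card (mats N \<mu> w v \<beta>)))"
    using Suc.IH supported_below[OF Suc.prems] by simp
  also have "\<dots> = (\<Sum>w | w permutes {..<N}. \<Sum>\<beta>\<in>below N (\<mu> v) \<alpha>. sign w * int (card (mats N \<mu> w v \<beta>)))"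
    by (rule sum.swap)
  also have "\<dots> = (\<Sum>w | w permutes {..<N}. sign w * int (card (mats N \<mu> w (Suc v) \<alpha>)))"
    by (intro sum.cong refl) (simp add: card_mats_Suc[OF Suc.prems] sum_distrib_left)
  finally show ?case .
qed

section \<open>Pairings with permutation characters\<close>

text \<open>The permutation character on the maps of content \<mu>, that is, the character induced
  from the trivial one of a Young subgroup.\<close>

definition fixed_count :: "'a set \<Rightarrow> nat \<Rightarrow> ('a \<Rightarrow> 'a) \<Rightarrow> (nat \<Rightarrow> nat) \<Rightarrow> nat" where
  "fixed_count Y N g \<mu> = card {F \<in> inv_maps Y {..<N} g. occ Y F = \<mu>}"

text \<open>For \<alpha> = \<rho> + \<delta> this is the class function \<phi> of the overview: a
  map invariant under g colors the cycles of g, so the enumerator is the product of the power sums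
  of the cycle lengths.\<close>

definition alt_char :: "'a set \<Rightarrow> nat \<Rightarrow> (nat \<Rightarrow> nat) \<Rightarrow> ('a \<Rightarrow> 'a) \<Rightarrow> int" where
  "alt_char Y N \<alpha> g = alt_coeff N (inv_maps Y {..<N} g) (occ Y) \<alpha>"

text \<open>Two invariant maps are the same as one invariant map into pairs, whose content is a
  matrix with the two contents as its row and column sums.\<close>

lemma sum_inv_maps_prod:
  fixes h :: "(nat \<Rightarrow> nat) \<Rightarrow> (nat \<Rightarrow> nat) \<Rightarrow> 'b::comm_monoid_add"
  assumes Y: "finite Y" and g: "g permutes Y"
  shows "(\<Sum>F\<in>inv_maps Y {..<N} g. \<Sum>F'\<in>inv_maps Y {..<N} g. h (occ Y F) (occ Y F')) =
    (\<Sum>G\<in>inv_maps Y ({..<N} \<times> {..<N}) g.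
       h (\<lambda>i. \<Sum>j<N. occ Y G (i, j)) (\<lambda>j. \<Sum>i<N. occ Y G (i, j)))"
proof -
  let ?I = "inv_maps Y {..<N} g" and ?J = "inv_maps Y ({..<N} \<times> {..<N}) g"
  let ?pair = "\<lambda>(F, F'). \<lambda>y\<in>Y. (F y, F' y)"
  have memI: "F \<in> ?I \<longleftrightarrow> (\<forall>y. if y \<in> Y then F y < N else F y = undefined) \<and> (\<forall>y. F (g y) = F y)" for F
    by (auto simp: inv_maps_def PiE_iff extensional_def fun_eq_iff)
  have memJ: "F \<in> ?J \<longleftrightarrow> (\<forall>y. if y \<in> Y then fst (F y) < N \<and> snd (F y) < N else F y = undefined) \<and>
      (\<forall>y. F (g y) = F y)" for F
    by (auto simp: inv_maps_def PiE_iff extensional_def fun_eq_iff mem_Times_iff)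
  have gY: "g y \<in> Y \<longleftrightarrow> y \<in> Y" for y using g by (rule permutes_in_image)
  have bij: "bij_betw ?pair (?I \<times> ?I) ?J"
  proof (rule bij_betwI[of _ _ _ "\<lambda>G. (\<lambda>y\<in>Y. fst (G y), \<lambda>y\<in>Y. snd (G y))"])
    show "?pair \<in> ?I \<times> ?I \<rightarrow> ?J"
      by (auto simp: memI memJ gY)
    show "(\<lambda>G. (\<lambda>y\<in>Y. fst (G y), \<lambda>y\<in>Y. snd (G y))) \<in> ?J \<rightarrow> ?I \<times> ?I"
      by (auto simp: memI memJ gY)
    show "(\<lambda>y\<in>Y. fst (?pair p y), \<lambda>y\<in>Y. snd (?pair p y)) = p" if "p \<in> ?I \<times> ?I" for p
      using that by (cases p) (auto simp: memI fun_eq_iff)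
    show "?pair (\<lambda>y\<in>Y. fst (G y), \<lambda>y\<in>Y. snd (G y)) = G" if "G \<in> ?J" for G
      using that by (auto simp: memJ fun_eq_iff)
  qed
  have rows: "occ Y F i = (\<Sum>j<N. occ Y (?pair (F, F')) (i, j))" and
    cols: "occ Y F' i = (\<Sum>j<N. occ Y (?pair (F, F')) (j, i))"
    if "F \<in> ?I" "F' \<in> ?I" for F F' i
  proof -
    have "{y \<in> Y. F y = i} = (\<Union>j<N. {y \<in> Y. ?pair (F, F') y = (i, j)})"
      "{y \<in> Y. F' y = i} = (\<Union>j<N. {y \<in> Y. ?pair (F, F') y = (j, i)})"
      using that by (auto simp: memI)
    thus "occ Y F i = (\<Sum>j<N. occ Y (?pair (F, F')) (i, j))"
      "occ Y F' i = (\<Sum>j<N. occ Y (?pair (F, F')) (j, i))"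
      unfolding occ_def using Y by (auto intro!: card_UN_disjoint)
  qed
  have "(\<Sum>F\<in>?I. \<Sum>F'\<in>?I. h (occ Y F) (occ Y F')) = (\<Sum>p\<in>?I \<times> ?I. h (occ Y (fst p)) (occ Y (snd p)))"
    by (simp add: sum.cartesian_product case_prod_unfold)
  also have "\<dots> = (\<Sum>p\<in>?I \<times> ?I. h (\<lambda>i. \<Sum>j<N. occ Y (?pair p) (i, j)) (\<lambda>j. \<Sum>i<N. occ Y (?pair p) (i, j)))"
  proof (intro sum.cong refl)
    fix p assume "p \<in> ?I \<times> ?I"
    then obtain F F' where p: "p = (F, F')" "F \<in> ?I" "F' \<in> ?I" by auto
    have "occ Y F = (\<lambda>i. \<Sum>j<N. occ Y (?pair p) (i, j))" "occ Y F' = (\<lambda>j. \<Sum>i<N. occ Y (?pair p) (i, j))"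
      unfolding p(1) using rows[OF p(2,3)] cols[OF p(2,3)] by (intro ext; blast)+
    thus "h (occ Y (fst p)) (occ Y (snd p)) =
        h (\<lambda>i. \<Sum>j<N. occ Y (?pair p) (i, j)) (\<lambda>j. \<Sum>i<N. occ Y (?pair p) (i, j))"
      by (simp add: p(1))
  qed
  also have "\<dots> = (\<Sum>G\<in>?J. h (\<lambda>i. \<Sum>j<N. occ Y G (i, j)) (\<lambda>j. \<Sum>i<N. occ Y G (i, j)))"
    by (rule sum.reindex_bij_betw[OF bij])
  finally show ?thesis .
qed

text \<open>Burnside's count of the invariant maps into pairs leaves one term for each content
  matrix, and the matrices with column sums \<mu> are those of a product of complete homogeneous
  polynomials. This is how the sum over the group trades power sums for complete homogeneous
  polynomials, a combinatorial form of the Cauchy identity.\<close>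

lemma alt_char_pairing_pieri:
  assumes Y: "finite Y" and \<alpha>: "\<alpha> \<in> weights N (card Y + (\<Sum>i<N. delta N i))" and \<mu>: "supported N \<mu>"
  shows "(\<Sum>g | g permutes Y. alt_char Y N \<alpha> g * int (fixed_count Y N g \<mu>)) =
    fact (card Y) * pieri N \<mu> N \<alpha>"
proof -
  let ?G = "{g. g permutes Y}" and ?P = "{w. w permutes {..<N}}" and ?Z = "{..<N} \<times> {..<N}"
  let ?I = "\<lambda>g. inv_maps Y {..<N} g"
  let ?h = "\<lambda>a b. \<Sum>w\<in>?P. if (\<lambda>i. a i + delta N (w i)) = \<alpha> \<and> b = \<mu> then sign w else 0"
  let ?t = "\<lambda>m. ?h (\<lambda>i. \<Sum>j<N. m (i, j)) (\<lambda>j. \<Sum>i<N. m (i, j))"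
  have "(\<Sum>g\<in>?G. alt_char Y N \<alpha> g * int (fixed_count Y N g \<mu>)) =
      (\<Sum>g\<in>?G. \<Sum>F\<in>?I g. \<Sum>F'\<in>?I g. ?h (occ Y F) (occ Y F'))"
  proof (intro sum.cong refl)
    fix g
    have fin: "finite (?I g)" using Y by auto
    have "alt_char Y N \<alpha> g = (\<Sum>F\<in>?I g. \<Sum>w\<in>?P. if (\<lambda>i. occ Y F i + delta N (w i)) = \<alpha> then sign w else 0)"
      unfolding alt_char_def alt_coeff_def by (rule sum.swap)
    moreover have "int (fixed_count Y N g \<mu>) = (\<Sum>F'\<in>?I g. if occ Y F' = \<mu> then 1 else 0)"
      using fin by (simp add: fixed_count_def sum.inter_filter[symmetric])
    ultimately have "alt_char Y N \<alpha> g * int (fixed_count Y N g \<mu>) =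
        (\<Sum>F\<in>?I g. \<Sum>F'\<in>?I g. (\<Sum>w\<in>?P. if (\<lambda>i. occ Y F i + delta N (w i)) = \<alpha> then sign w else 0) *
          (if occ Y F' = \<mu> then 1 else 0))"
      by (simp only: sum_product)
    moreover have "(\<Sum>w\<in>?P. if (\<lambda>i. occ Y F i + delta N (w i)) = \<alpha> then sign w else 0) *
        (if occ Y F' = \<mu> then 1 else 0) = ?h (occ Y F) (occ Y F')" for F F'
      by (cases "occ Y F' = \<mu>") simp_all
    ultimately show "alt_char Y N \<alpha> g * int (fixed_count Y N g \<mu>) =
        (\<Sum>F\<in>?I g. \<Sum>F'\<in>?I g. ?h (occ Y F) (occ Y F'))"
      by simp
  qed
  also have "\<dots> = (\<Sum>g\<in>?G. \<Sum>G\<in>inv_maps Y ?Z g. ?t (occ Y G))"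
    by (intro sum.cong refl, subst sum_inv_maps_prod[OF Y]) auto
  also have "\<dots> = fact (card Y) * (\<Sum>m\<in>occs (card Y) ?Z. ?t m)"
    by (subst burnside_occ[OF Y]) auto
  also have "(\<Sum>m\<in>occs (card Y) ?Z. ?t m) = (\<Sum>w\<in>?P. \<Sum>m\<in>occs (card Y) ?Z.
      if (\<lambda>i. (\<Sum>j<N. m (i, j)) + delta N (w i)) = \<alpha> \<and> (\<lambda>j. \<Sum>i<N. m (i, j)) = \<mu> then sign w else 0)"
    by (rule sum.swap)
  also have "\<dots> = (\<Sum>w\<in>?P. sign w * int (card (mats N \<mu> w N \<alpha>)))"
  proof (intro sum.cong refl)
    fix w assume "w \<in> ?P"
    hence w: "w permutes {..<N}" by simp
    have "{m \<in> occs (card Y) ?Z. (\<lambda>i. (\<Sum>j<N. m (i, j)) + delta N (w i)) = \<alpha> \<and>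
        (\<lambda>j. \<Sum>i<N. m (i, j)) = \<mu>} = mats N \<mu> w N \<alpha>" (is "?L = _")
    proof (intro equalityI subsetI)
      fix m assume "m \<in> ?L"
      thus "m \<in> mats N \<mu> w N \<alpha>" by (auto simp: mats_def occs_def)
    next
      fix m assume m: "m \<in> mats N \<mu> w N \<alpha>"
      have "(\<Sum>i<N. delta N (w i)) = (\<Sum>i<N. delta N i)"
        using sum.permute[OF w, of "delta N"] by simp
      moreover have "(\<Sum>i<N. (\<Sum>j<N. m (i, j)) + delta N (w i)) = card Y + (\<Sum>i<N. delta N i)"
        using m \<alpha> by (auto simp: mats_def weights_def)
      ultimately have "(\<Sum>z\<in>?Z. m z) = card Y"
        by (simp add: sum.distrib sum.cartesian_product case_prod_unfold)
      moreover have "(\<Sum>i<N. m (i, j)) = \<mu> j" for j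
        using m \<mu> by (cases "j < N") (auto simp: mats_def supported_def)
      ultimately show "m \<in> ?L"
        using m by (auto simp: mats_def occs_def)
    qed
    moreover have "(\<Sum>m\<in>occs (card Y) ?Z.
      if (\<lambda>i. (\<Sum>j<N. m (i, j)) + delta N (w i)) = \<alpha> \<and> (\<lambda>j. \<Sum>i<N. m (i, j)) = \<mu> then sign w else 0) =
      sign w * int (card ?L)"
      by (subst sum.inter_filter[symmetric]) (auto simp: finite_occs)
    ultimately show "(\<Sum>m\<in>occs (card Y) ?Z.
      if (\<lambda>i. (\<Sum>j<N. m (i, j)) + delta N (w i)) = \<alpha> \<and> (\<lambda>j. \<Sum>i<N. m (i, j)) = \<mu> then sign w else 0) =
      sign w * int (card (mats N \<mu> w N \<alpha>))" by simp
  qed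
  also have "\<dots> = pieri N \<mu> N \<alpha>"
    by (rule pieri_eq_sum_mats[symmetric]) (use \<alpha> in \<open>auto simp: weights_def supported_def\<close>)
  finally show ?thesis .
qed

text \<open>The Jacobi-Trudi expansion, of which only the diagonal term survives. Expanding the
  alternant gives a signed sum over w of permutation characters with contents \<sigma> + \<delta> -
  \<delta> w. If such a content is dominated by \<sigma>, then the partial sums of \<delta> are at
  most those of \<delta> w, which forces w = id.\<close>

lemma alt_char_pairing:
  fixes \<psi> :: "('a \<Rightarrow> 'a) \<Rightarrow> complex"
  assumes Y: "finite Y" and \<sigma>: "\<sigma> \<in> weights N n"
    and dom: "\<And>\<mu> v. \<mu> \<in> weights N n \<Longrightarrow> (\<Sum>g | g permutes Y. \<psi> g * of_nat (fixed_count Y N g \<mu>)) \<noteq> 0 \<Longrightarrow>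
      v \<le> N \<Longrightarrow> (\<Sum>u<v. \<mu> u) \<le> (\<Sum>u<v. \<sigma> u)"
  shows "(\<Sum>g | g permutes Y. \<psi> g * of_int (alt_char Y N (\<lambda>i. \<sigma> i + delta N i) g)) =
    (\<Sum>g | g permutes Y. \<psi> g * of_nat (fixed_count Y N g \<sigma>))"
proof -
  let ?G = "{g. g permutes Y}" and ?P = "{w. w permutes {..<N}}"
  let ?S = "\<lambda>w g. {F \<in> inv_maps Y {..<N} g. (\<lambda>i. occ Y F i + delta N (w i)) = (\<lambda>i. \<sigma> i + delta N i)}"
  have "alt_char Y N (\<lambda>i. \<sigma> i + delta N i) g = (\<Sum>w\<in>?P. sign w * int (card (?S w g)))" for g
    unfolding alt_char_def alt_coeff_def
    by (intro sum.cong refl, subst sum.inter_filter[symmetric]) (use Y in auto)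
  hence "(\<Sum>g\<in>?G. \<psi> g * of_int (alt_char Y N (\<lambda>i. \<sigma> i + delta N i) g)) =
      (\<Sum>g\<in>?G. \<Sum>w\<in>?P. of_int (sign w) * (\<psi> g * of_nat (card (?S w g))))"
    by (simp add: sum_distrib_left mult_ac)
  also have "\<dots> = (\<Sum>w\<in>?P. of_int (sign w) * (\<Sum>g\<in>?G. \<psi> g * of_nat (card (?S w g))))"
    unfolding sum_distrib_left by (rule sum.swap)
  also have "\<dots> = (\<Sum>w\<in>{id}. of_int (sign w) * (\<Sum>g\<in>?G. \<psi> g * of_nat (card (?S w g))))"
  proof (rule sum.mono_neutral_right)
    show "\<forall>w\<in>?P - {id}. of_int (sign w) * (\<Sum>g\<in>?G. \<psi> g * of_nat (card (?S w g))) = 0"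
    proof
      fix w assume w: "w \<in> ?P - {id}"
      have "(\<Sum>g\<in>?G. \<psi> g * of_nat (card (?S w g))) = 0"
      proof (cases "\<forall>i. delta N (w i) \<le> \<sigma> i + delta N i")
        \<comment> \<open>The content prescribed by w would have a negative entry, so no map has
          it.\<close>
        case False
        then obtain i where "\<not> delta N (w i) \<le> \<sigma> i + delta N i" by blast
        hence "(\<lambda>i. occ Y F i + delta N (w i)) \<noteq> (\<lambda>i. \<sigma> i + delta N i)" for F
          by (metis le_add2)
        hence S: "?S w g = {}" for g by blast
        show ?thesis unfolding S by simp
      next
        case True
        define \<mu> where "\<mu> = (\<lambda>i. \<sigma> i + delta N i - delta N (w i))"
        have eq: "\<mu> i + delta N (w i) = \<sigma> i + delta N i" for i using True by (simp add: \<mu>_def)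
        have S: "?S w g = {F \<in> inv_maps Y {..<N} g. occ Y F = \<mu>}" for g
          unfolding eq[symmetric] by (auto simp: fun_eq_iff)
        have sums: "(\<Sum>i<v. \<mu> i) + (\<Sum>i<v. delta N (w i)) = (\<Sum>i<v. \<sigma> i) + (\<Sum>i<v. delta N i)" for v
          by (simp add: sum.distrib[symmetric] eq)
        have "\<mu> i = 0" if "N \<le> i" for i
          using \<sigma> that by (simp add: \<mu>_def weights_def delta_def)
        moreover have "(\<Sum>i<N. delta N (w i)) = (\<Sum>i<N. delta N i)"
          using sum.permute[of w "{..<N}" "delta N"] w by simp
        ultimately have \<mu>: "\<mu> \<in> weights N n"
          using sums[of N] \<sigma> by (auto simp: weights_def)
        show ?thesis
        proof (rule ccontr)
          assume "\<not> ?thesis"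
          hence le: "(\<Sum>u<v. \<mu> u) \<le> (\<Sum>u<v. \<sigma> u)" if "v \<le> N" for v
            unfolding S using dom[OF \<mu> _ that] by (simp add: fixed_count_def)
          have "(\<Sum>u<v. delta N u) \<le> (\<Sum>u<v. delta N (w u))" if "v \<le> N" for v
            using sums[of v] le[OF that] by linarith
          hence "w = id" using delta_dominance[of w N] w by blast
          thus False using w by blast
        qed
      qed
      thus "of_int (sign w) * (\<Sum>g\<in>?G. \<psi> g * of_nat (card (?S w g))) = 0" by simp
    qed
  qed (auto simp: permutes_id)
  also have "?S id g = {F \<in> inv_maps Y {..<N} g. occ Y F = \<sigma>}" for g
    by (auto simp: fun_eq_iff)
  hence "(\<Sum>w\<in>{id}. of_int (sign w) * (\<Sum>g\<in>?G. \<psi> g * of_nat (card (?S w g)))) =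
      (\<Sum>g\<in>?G. \<psi> g * of_nat (fixed_count Y N g \<sigma>))"
    by (simp add: fixed_count_def)
  finally show ?thesis .
qed

text \<open>The values are integers, so the norm needs no conjugation. The pairing lemma, applied
  with the class function itself as \<psi>, replaces one factor by a permutation character; Pieri's
  rule supplies both the dominance condition and the final value 1.\<close>

lemma alt_char_norm:
  assumes Y: "finite Y" and \<sigma>: "\<sigma> \<in> weights N (card Y)" and dec: "strict_dec N (\<lambda>i. \<sigma> i + delta N i)"
  shows "(\<Sum>g | g permutes Y. (of_int (alt_char Y N (\<lambda>i. \<sigma> i + delta N i) g))\<^sup>2) =
    (of_nat (fact (card Y)) :: complex)"
proof -
  let ?\<alpha> = "\<lambda>i. \<sigma> i + delta N i"
  have \<alpha>: "?\<alpha> \<in> weights N (card Y + (\<Sum>i<N. delta N i))"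
    using \<sigma> delta_in_weights[of N] by (auto simp: weights_def sum.distrib)
  have supp: "supported N ?\<alpha>" using \<alpha> by (auto simp: weights_def supported_def)
  have pair: "(\<Sum>g | g permutes Y. of_int (alt_char Y N ?\<alpha> g) * of_nat (fixed_count Y N g \<mu>)) =
      (of_nat (fact (card Y)) * of_int (pieri N \<mu> N ?\<alpha>) :: complex)" if "\<mu> \<in> weights N (card Y)" for \<mu>
  proof -
    have "supported N \<mu>" using that by (auto simp: weights_def supported_def)
    from arg_cong[OF alt_char_pairing_pieri[OF Y \<alpha> this], of "of_int :: int \<Rightarrow> complex"]
    show ?thesis by simp
  qed
  have "(\<Sum>g | g permutes Y. (of_int (alt_char Y N ?\<alpha> g))\<^sup>2) =
      (\<Sum>g | g permutes Y. of_int (alt_char Y N ?\<alpha> g) * (of_int (alt_char Y N ?\<alpha> g)) :: complex)"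
    by (simp only: power2_eq_square)
  also have "\<dots> = (\<Sum>g | g permutes Y. of_int (alt_char Y N ?\<alpha> g) * of_nat (fixed_count Y N g \<sigma>))"
  proof (rule alt_char_pairing[OF Y \<sigma>])
    fix \<mu> v assume \<mu>: "\<mu> \<in> weights N (card Y)" and v: "v \<le> N" and
      "(\<Sum>g | g permutes Y. of_int (alt_char Y N ?\<alpha> g) * of_nat (fixed_count Y N g \<mu>)) \<noteq> (0 :: complex)"
    hence "pieri N \<mu> N ?\<alpha> \<noteq> 0" unfolding pair[OF \<mu>] by auto
    hence "(\<Sum>i<v. delta N i) + (\<Sum>u<v. \<mu> u) \<le> (\<Sum>i<v. ?\<alpha> i)"
      using pieri_nonzero[OF supp dec] v by blast
    thus "(\<Sum>u<v. \<mu> u) \<le> (\<Sum>u<v. \<sigma> u)" by (simp add: sum.distrib)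
  qed
  also have "\<dots> = of_nat (fact (card Y))"
  proof -
    have "pieri N \<sigma> N ?\<alpha> = 1"
    proof (rule pieri_eq_1[OF supp dec order_refl])
      show "\<sigma> i + delta N i = delta N i" if "N \<le> i" for i
        using \<sigma> that by (simp add: weights_def)
      show "(\<Sum>i<v. \<sigma> i + delta N i) = (\<Sum>i<v. delta N i) + (\<Sum>u<v. \<sigma> u)" for v
        by (simp only: sum.distrib add.commute)
    qed
    thus ?thesis by (simp add: pair[OF \<sigma>])
  qed
  finally show ?thesis .
qed

section \<open>Group algebras\<close>

lemma permutes_comp_inv_cancel:
  assumes "h permutes Y"
  shows "inv h \<circ> (h \<circ> g) = g" "h \<circ> (inv h \<circ> g) = g" "f \<circ> h \<circ> inv h = f" "f \<circ> inv h \<circ> h = f"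
    "h \<circ> inv h = id" "inv h \<circ> h = id" "inv (inv h) = h"
  using permutes_inv_o[OF assms] permutes_inv_inv[OF assms] by (simp_all add: o_assoc) (simp_all add: o_assoc[symmetric])

lemma permutes_inv_comp:
  assumes "g permutes Y" "h permutes Y"
  shows "inv (g \<circ> h) = inv h \<circ> inv g"
  using assms by (intro o_inv_distrib permutes_bij)

lemma permutes_comp_iff:
  assumes "h permutes Y"
  shows "h \<circ> g permutes Y \<longleftrightarrow> g permutes Y" "g \<circ> h permutes Y \<longleftrightarrow> g permutes Y"
proof -
  show "h \<circ> g permutes Y \<longleftrightarrow> g permutes Y"
    using permutes_compose[of "h \<circ> g" Y "inv h"] permutes_compose[of g Y h] permutes_inv[OF assms] assms
      permutes_comp_inv_cancel(1)[OF assms, of g] by auto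
  show "g \<circ> h permutes Y \<longleftrightarrow> g permutes Y"
    using permutes_compose[of "inv h" Y "g \<circ> h"] permutes_compose[of h Y g] permutes_inv[OF assms] assms
      permutes_comp_inv_cancel(3)[OF assms, of g] by auto
qed

lemma sum_permutes_shift:
  assumes "h permutes Y"
  shows "(\<Sum>g | g permutes Y. f (h \<circ> g)) = (\<Sum>g | g permutes Y. f g)"
    "(\<Sum>g | g permutes Y. f (g \<circ> h)) = (\<Sum>g | g permutes Y. f g)"
proof -
  note inv = permutes_inv[OF assms] and c = permutes_comp_inv_cancel[OF assms]
  show "(\<Sum>g | g permutes Y. f (h \<circ> g)) = (\<Sum>g | g permutes Y. f g)"
    by (rule sum.reindex_bij_witness[of _ "\<lambda>g. inv h \<circ> g" "\<lambda>g. h \<circ> g"])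
       (use c assms inv in \<open>simp_all add: permutes_compose\<close>)
  show "(\<Sum>g | g permutes Y. f (g \<circ> h)) = (\<Sum>g | g permutes Y. f g)"
    by (rule sum.reindex_bij_witness[of _ "\<lambda>g. g \<circ> inv h" "\<lambda>g. g \<circ> h"])
       (use c assms inv in \<open>simp_all add: permutes_compose\<close>)
qed

lemma sum_permutes_inv: "(\<Sum>g | g permutes Y. f (inv g)) = (\<Sum>g | g permutes Y. f g)"
  by (rule sum.reindex_bij_witness[of _ inv inv])
     (auto simp: permutes_inv permutes_inv_inv)

lemma sum_fun_apply: "sum F A x = (\<Sum>i\<in>A. F i x)" for F :: "'i \<Rightarrow> 'b \<Rightarrow> 'c::comm_monoid_add"
  by (induction A rule: infinite_finite_induct) auto

lemma conv_assoc: "conv Y (conv Y x y) z = conv Y x (conv Y y z)"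
proof
  fix g
  let ?G = "{h. h permutes Y}"
  have "conv Y (conv Y x y) z g = (\<Sum>m\<in>?G. \<Sum>h\<in>?G. x h * y (inv h \<circ> m) * z (inv m \<circ> g))"
    unfolding conv_def by (simp add: sum_distrib_right)
  also have "\<dots> = (\<Sum>h\<in>?G. \<Sum>m\<in>?G. x h * y (inv h \<circ> m) * z (inv m \<circ> g))"
    by (rule sum.swap)
  also have "\<dots> = (\<Sum>h\<in>?G. \<Sum>k\<in>?G. x h * y k * z (inv k \<circ> (inv h \<circ> g)))"
  proof (rule sum.cong[OF refl])
    fix h assume "h \<in> ?G"
    hence h: "h permutes Y" by simp
    have "(\<Sum>m\<in>?G. x h * y (inv h \<circ> m) * z (inv m \<circ> g)) =
        (\<Sum>k\<in>?G. x h * y (inv h \<circ> (h \<circ> k)) * z (inv (h \<circ> k) \<circ> g))"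
      by (rule sum_permutes_shift(1)[OF h, symmetric])
    also have "\<dots> = (\<Sum>k\<in>?G. x h * y k * z (inv k \<circ> (inv h \<circ> g)))"
      using h by (intro sum.cong refl) (simp add: permutes_comp_inv_cancel permutes_inv_comp o_assoc)
    finally show "(\<Sum>m\<in>?G. x h * y (inv h \<circ> m) * z (inv m \<circ> g)) = \<dots>" .
  qed
  also have "\<dots> = conv Y x (conv Y y z) g"
    unfolding conv_def by (simp add: sum_distrib_left mult.assoc)
  finally show "conv Y (conv Y x y) z g = conv Y x (conv Y y z) g" .
qed

lemma conv_scale_left: "conv Y (cfun_scale t x) y = cfun_scale t (conv Y x y)"
  by (auto simp: conv_def cfun_scale_def fun_eq_iff sum_distrib_left mult.assoc)

lemma conv_scale_right: "conv Y x (cfun_scale t y) = cfun_scale t (conv Y x y)"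
  by (auto simp: conv_def cfun_scale_def fun_eq_iff sum_distrib_left mult_ac)

lemma conv_sum_left: "conv Y (sum F A) y = (\<Sum>i\<in>A. conv Y (F i) y)"
  by (rule ext, simp add: conv_def sum_fun_apply sum_distrib_right) (subst sum.swap, rule refl)

lemma conv_sum_right: "conv Y x (sum F A) = (\<Sum>i\<in>A. conv Y x (F i))"
  by (rule ext, simp add: conv_def sum_fun_apply sum_distrib_left) (subst sum.swap, rule refl)

lemma conv_supported:
  assumes "y \<in> group_algebra Y"
  shows "conv Y x y \<in> group_algebra Y"
proof -
  have "conv Y x y g = 0" if "\<not> g permutes Y" for g
    unfolding conv_def using assms that
    by (intro sum.neutral) (auto simp: group_algebra_def permutes_comp_iff permutes_inv)
  thus ?thesis by (simp add: group_algebra_def)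
qed

lemma conv_perm_elem_left:
  assumes "finite Y" "g permutes Y"
  shows "conv Y (perm_elem g) x = (\<lambda>h. x (inv g \<circ> h))"
proof
  fix h
  have "conv Y (perm_elem g) x h = (\<Sum>k | k permutes Y. if k = g then x (inv k \<circ> h) else 0)"
    unfolding conv_def perm_elem_def by (rule sum.cong) auto
  thus "conv Y (perm_elem g) x h = x (inv g \<circ> h)"
    using assms finite_permutations[of Y] by simp
qed

lemma conv_id:
  "conv Y x y id = (\<Sum>h | h permutes Y. x h * y (inv h))"
  by (simp add: conv_def)

lemma group_algebra_expand:
  assumes "finite Y" "x \<in> group_algebra Y"
  shows "x = (\<Sum>g | g permutes Y. cfun_scale (x g) (perm_elem g))"
proof
  fix h
  show "x h = (\<Sum>g | g permutes Y. cfun_scale (x g) (perm_elem g)) h"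
    using assms finite_permutations[of Y]
    by (cases "h permutes Y")
       (auto simp: sum_fun_apply cfun_scale_def perm_elem_def group_algebra_def if_distrib[of "\<lambda>x. _ * x"]
         intro!: sum.neutral cong: if_cong)
qed

lemma perm_elem_in_group_algebra: "g permutes Y \<Longrightarrow> perm_elem g \<in> group_algebra Y"
  by (auto simp: perm_elem_def group_algebra_def)

text \<open>The trace of \<open>f\<close> on \<open>V\<close> is the trace of \<open>f \<circ> P\<close> on the whole group algebra, where \<open>P\<close> projects onto \<open>V\<close>.\<close>

lemma trace_on_conv_projection:
  assumes Y: "finite Y" and V: "cfun.subspace V" "V \<subseteq> group_algebra Y"
    and c: "\<And>x. x \<in> group_algebra Y \<Longrightarrow> conv Y x c \<in> V" "\<And>v. v \<in> V \<Longrightarrow> conv Y v c = v"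
    and f: "\<And>v. v \<in> V \<Longrightarrow> conv Y y v \<in> V"
  shows "trace_on V (conv Y y) = (\<Sum>g | g permutes Y. conv Y y (conv Y (perm_elem g) c) g)"
proof -
  let ?G = "{g. g permutes Y}"
  have fin: "finite ?G" using Y by (rule finite_permutations)
  define B where "B = (SOME B. B \<subseteq> V \<and> cfun.independent B \<and> cfun.span B = V)"
  have "\<exists>B. B \<subseteq> V \<and> cfun.independent B \<and> cfun.span B = V"
  proof -
    obtain B where B: "B \<subseteq> V" "cfun.independent B" "V \<subseteq> cfun.span B"
      using cfun.maximal_independent_subset[of V] by blast
    moreover have "cfun.span B \<subseteq> V" using B(1) V(1) by (rule cfun.span_minimal)
    ultimately show ?thesis by blast
  qed
  hence "B \<subseteq> V \<and> cfun.independent B \<and> cfun.span B = V"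
    unfolding B_def by (rule someI_ex)
  hence B: "B \<subseteq> V" "cfun.independent B" "cfun.span B = V" by auto
  have "group_algebra Y \<subseteq> cfun.span (perm_elem ` ?G)"
  proof
    fix x assume x: "x \<in> group_algebra Y"
    have "(\<Sum>g | g permutes Y. cfun_scale (x g) (perm_elem g)) \<in> cfun.span (perm_elem ` ?G)"
      by (intro cfun.span_sum cfun.span_scale cfun.span_base) auto
    thus "x \<in> cfun.span (perm_elem ` ?G)" using group_algebra_expand[OF Y x] by simp
  qed
  hence "finite B"
    using cfun.independent_span_bound[of "perm_elem ` ?G" B] B V(2) fin by auto
  \<comment> \<open>Right multiplication by c fixes V pointwise, so b is a combination of the
    translates of c, with the values of b as coefficients.\<close>
  have eq: "conv Y y b = (\<Sum>g\<in>?G. cfun_scale (b g) (conv Y y (conv Y (perm_elem g) c)))" if "b \<in> B" for b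
  proof -
    have "b = conv Y b c" using c(2)[of b] that B(1) by auto
    also have "conv Y b c = conv Y (\<Sum>g\<in>?G. cfun_scale (b g) (perm_elem g)) c"
      using group_algebra_expand[OF Y, of b] that B(1) V(2)
      by (intro arg_cong[where f = "\<lambda>x. conv Y x c"]) blast
    also have "\<dots> = (\<Sum>g\<in>?G. cfun_scale (b g) (conv Y (perm_elem g) c))"
      by (simp only: conv_sum_left conv_scale_left)
    finally have *: "b = (\<Sum>g\<in>?G. cfun_scale (b g) (conv Y (perm_elem g) c))" .
    show ?thesis
      by (subst (1) *) (simp add: conv_sum_right conv_scale_right)
  qed
  have inV: "conv Y y (conv Y (perm_elem g) c) \<in> cfun.span B" if "g \<in> ?G" for g
    using that f c(1) perm_elem_in_group_algebra B(3) by auto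
  have rep: "cfun.representation B (conv Y y b) b =
      (\<Sum>g\<in>?G. b g * cfun.representation B (conv Y y (conv Y (perm_elem g) c)) b)" if "b \<in> B" for b
    unfolding eq[OF that]
    using inV B(2) by (subst cfun.representation_sum)
      (auto simp: cfun.representation_scale cfun.span_scale sum_fun_apply intro!: sum.cong)
  have "trace_on V (conv Y y) = (\<Sum>b\<in>B. cfun.representation B (conv Y y b) b)"
    by (simp add: trace_on_def B_def Let_def)
  also have "\<dots> = (\<Sum>b\<in>B. \<Sum>g\<in>?G. b g * cfun.representation B (conv Y y (conv Y (perm_elem g) c)) b)"
    by (intro sum.cong refl rep)
  also have "\<dots> = (\<Sum>g\<in>?G. \<Sum>b\<in>B. b g * cfun.representation B (conv Y y (conv Y (perm_elem g) c)) b)"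
    by (rule sum.swap)
  also have "\<dots> = (\<Sum>g\<in>?G. conv Y y (conv Y (perm_elem g) c) g)"
  proof (intro sum.cong refl)
    fix g assume g: "g \<in> ?G"
    let ?v = "conv Y y (conv Y (perm_elem g) c)"
    \<comment> \<open>Evaluating the expansion of \<open>?v\<close> in the basis B at g turns the
      coordinates back into the diagonal matrix entry at g.\<close>
    have "?v = (\<Sum>b\<in>B. cfun_scale (cfun.representation B ?v b) b)"
      using cfun.sum_representation_eq[OF B(2) inV[OF g] \<open>finite B\<close>] by simp
    hence "?v g = (\<Sum>b\<in>B. cfun_scale (cfun.representation B ?v b) b) g" by (rule fun_cong)
    thus "(\<Sum>b\<in>B. b g * cfun.representation B ?v b) = ?v g"
      by (simp add: sum_fun_apply cfun_scale_def mult.commute)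
  qed
  finally show ?thesis .
qed

section \<open>Young symmetrizers\<close>

text \<open>The factor a of the symmetrizer c = a b as an explicit function; \<open>col_elem\<close>
  is the factor b.\<close>

definition row_elem :: "nat list \<Rightarrow> (nat \<times> nat \<Rightarrow> nat \<times> nat) \<Rightarrow> complex" where
  "row_elem \<rho> g = (if g \<in> row_group \<rho> then 1 else 0)"

definition col_elem :: "nat list \<Rightarrow> (nat \<times> nat \<Rightarrow> nat \<times> nat) \<Rightarrow> complex" where
  "col_elem \<rho> g = (if g \<in> column_group \<rho> then of_int (sign g) else 0)"

lemma row_group_permutes: "g \<in> row_group \<rho> \<Longrightarrow> g permutes young_diagram \<rho>"
  by (simp add: row_group_def)

lemma column_group_permutes: "g \<in> column_group \<rho> \<Longrightarrow> g permutes young_diagram \<rho>"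
  by (simp add: column_group_def)

lemma finite_row_group [simp, intro]: "finite (row_group \<rho>)"
  by (rule finite_subset[OF _ finite_permutations[of "young_diagram \<rho>"]]) (auto simp: row_group_def)

lemma finite_column_group [simp, intro]: "finite (column_group \<rho>)"
  by (rule finite_subset[OF _ finite_permutations[of "young_diagram \<rho>"]]) (auto simp: column_group_def)

lemma id_in_row_group [simp, intro]: "id \<in> row_group \<rho>"
  by (simp add: row_group_def permutes_id)

lemma id_in_column_group [simp, intro]: "id \<in> column_group \<rho>"
  by (simp add: column_group_def permutes_id)

lemma row_group_comp: "g \<in> row_group \<rho> \<Longrightarrow> h \<in> row_group \<rho> \<Longrightarrow> g \<circ> h \<in> row_group \<rho>"
  by (simp add: row_group_def permutes_compose del: split_paired_All)

lemma column_group_comp: "g \<in> column_group \<rho> \<Longrightarrow> h \<in> column_group \<rho> \<Longrightarrow> g \<circ> h \<in> column_group \<rho>"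
  by (simp add: column_group_def permutes_compose del: split_paired_All)

lemma row_group_inv: "g \<in> row_group \<rho> \<Longrightarrow> inv g \<in> row_group \<rho>"
  unfolding row_group_def by (simp add: permutes_inv del: split_paired_All) (metis permutes_inverses(1))

lemma column_group_inv: "g \<in> column_group \<rho> \<Longrightarrow> inv g \<in> column_group \<rho>"
  unfolding column_group_def by (simp add: permutes_inv del: split_paired_All) (metis permutes_inverses(1))

lemma row_column_group_Int: "g \<in> row_group \<rho> \<Longrightarrow> g \<in> column_group \<rho> \<Longrightarrow> g = id"
  by (rule ext) (simp add: row_group_def column_group_def prod_eq_iff del: split_paired_All)

lemma column_group_cancel_left: "r \<in> column_group \<rho> \<Longrightarrow> r \<circ> g \<in> column_group \<rho> \<longleftrightarrow> g \<in> column_group \<rho>"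
  using column_group_comp[of r \<rho> g] column_group_comp[of "inv r" \<rho> "r \<circ> g"] column_group_inv[of r \<rho>]
    permutes_comp_inv_cancel(1)[OF column_group_permutes, of r \<rho> g] by auto

lemma column_group_cancel_right: "r \<in> column_group \<rho> \<Longrightarrow> g \<circ> r \<in> column_group \<rho> \<longleftrightarrow> g \<in> column_group \<rho>"
  using column_group_comp[of g \<rho> r] column_group_comp[of "g \<circ> r" \<rho> "inv r"] column_group_inv[of r \<rho>]
    permutes_comp_inv_cancel(3)[OF column_group_permutes, of r \<rho> g] by auto

lemma sum_row_group_shift:
  assumes "r \<in> row_group \<rho>"
  shows "(\<Sum>g\<in>row_group \<rho>. f (r \<circ> g)) = (\<Sum>g\<in>row_group \<rho>. f g)"
  by (rule sum.reindex_bij_witness[of _ "\<lambda>g. inv r \<circ> g" "\<lambda>g. r \<circ> g"])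
     (use assms permutes_comp_inv_cancel[OF row_group_permutes[OF assms]] in
       \<open>simp_all add: row_group_comp row_group_inv\<close>)

lemma sum_column_group_shift:
  assumes "r \<in> column_group \<rho>"
  shows "(\<Sum>g\<in>column_group \<rho>. f (r \<circ> g)) = (\<Sum>g\<in>column_group \<rho>. f g)"
  by (rule sum.reindex_bij_witness[of _ "\<lambda>g. inv r \<circ> g" "\<lambda>g. r \<circ> g"])
     (use assms permutes_comp_inv_cancel[OF column_group_permutes[OF assms]] in
       \<open>simp_all add: column_group_comp column_group_inv\<close>)

lemma sum_row_group_inv: "(\<Sum>g\<in>row_group \<rho>. f (inv g)) = (\<Sum>g\<in>row_group \<rho>. f g)"
  by (rule sum.reindex_bij_witness[of _ inv inv])
     (auto simp: row_group_inv permutes_inv_inv[OF row_group_permutes])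

lemma sum_column_group_inv: "(\<Sum>g\<in>column_group \<rho>. f (inv g)) = (\<Sum>g\<in>column_group \<rho>. f g)"
  by (rule sum.reindex_bij_witness[of _ inv inv])
     (auto simp: column_group_inv permutes_inv_inv[OF column_group_permutes])

lemma sign_inv_permutes: "finite Y \<Longrightarrow> g permutes Y \<Longrightarrow> sign (inv g) = sign g"
  by (meson sign_inverse permutes_imp_permutation)

lemma sign_sign: "of_int (sign g) * (of_int (sign g) * x) = (x :: complex)"
  by (simp add: sign_def)

lemma sum_permutes_row_elem:
  "(\<Sum>h | h permutes young_diagram \<rho>. row_elem \<rho> h * f h) = (\<Sum>h\<in>row_group \<rho>. f h)"
  by (rule sum.mono_neutral_cong_right) (auto simp: row_elem_def row_group_permutes finite_permutations)

lemma sum_permutes_col_elem: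
  "(\<Sum>h | h permutes young_diagram \<rho>. col_elem \<rho> h * f h) =
    (\<Sum>h\<in>column_group \<rho>. of_int (sign h) * f h)"
  by (rule sum.mono_neutral_cong_right) (auto simp: col_elem_def column_group_permutes finite_permutations)

lemma young_symmetrizer_conv:
  "young_symmetrizer \<rho> = conv (young_diagram \<rho>) (row_elem \<rho>) (col_elem \<rho>)"
proof -
  have "(\<Sum>g\<in>row_group \<rho>. perm_elem g) = row_elem \<rho>"
    by (rule ext) (simp add: sum_fun_apply perm_elem_def row_elem_def)
  moreover have "(\<Sum>g\<in>column_group \<rho>. cfun_scale (of_int (sign g)) (perm_elem g)) = col_elem \<rho>"
    by (rule ext) (simp add: sum_fun_apply perm_elem_def col_elem_def cfun_scale_def
        if_distrib[of "\<lambda>x. _ * x"] cong: if_cong)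
  ultimately show ?thesis by (simp add: young_symmetrizer_def)
qed

lemma young_symmetrizer_supported: "young_symmetrizer \<rho> \<in> group_algebra (young_diagram \<rho>)"
  unfolding young_symmetrizer_conv
  by (rule conv_supported) (auto simp: group_algebra_def col_elem_def column_group_permutes)

lemma young_symmetrizer_rows:
  "young_symmetrizer \<rho> g = (\<Sum>h\<in>row_group \<rho>. col_elem \<rho> (inv h \<circ> g))"
  unfolding young_symmetrizer_conv conv_def by (rule sum_permutes_row_elem)

lemma young_symmetrizer_columns:
  assumes g: "g permutes young_diagram \<rho>"
  shows "young_symmetrizer \<rho> g = (\<Sum>s\<in>column_group \<rho>. of_int (sign s) * row_elem \<rho> (g \<circ> inv s))"
proof -
  let ?Y = "young_diagram \<rho>"
  have "young_symmetrizer \<rho> g = (\<Sum>h | h permutes ?Y. row_elem \<rho> h * col_elem \<rho> (inv h \<circ> g))"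
    unfolding young_symmetrizer_conv conv_def ..
  also have "\<dots> = (\<Sum>h | h permutes ?Y. row_elem \<rho> (g \<circ> h) * col_elem \<rho> (inv (g \<circ> h) \<circ> g))"
    by (rule sum_permutes_shift(1)[OF g, symmetric])
  also have "\<dots> = (\<Sum>h | h permutes ?Y. row_elem \<rho> (g \<circ> h) * col_elem \<rho> (inv h))"
    by (rule sum.cong) (auto simp: permutes_inv_comp[OF g] permutes_comp_inv_cancel[OF g])
  also have "\<dots> = (\<Sum>h | h permutes ?Y. row_elem \<rho> (g \<circ> inv h) * col_elem \<rho> (inv (inv h)))"
    by (rule sum_permutes_inv[symmetric])
  also have "\<dots> = (\<Sum>h | h permutes ?Y. col_elem \<rho> h * row_elem \<rho> (g \<circ> inv h))"
    by (rule sum.cong) (auto simp: permutes_inv_inv mult.commute)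
  finally show ?thesis by (simp add: sum_permutes_col_elem)
qed

lemma young_symmetrizer_row:
  assumes r: "r \<in> row_group \<rho>"
  shows "young_symmetrizer \<rho> (r \<circ> g) = young_symmetrizer \<rho> g"
proof -
  have "young_symmetrizer \<rho> (r \<circ> g) = (\<Sum>h\<in>row_group \<rho>. col_elem \<rho> (inv (r \<circ> h) \<circ> (r \<circ> g)))"
    unfolding young_symmetrizer_rows by (rule sum_row_group_shift[OF r, symmetric])
  also have "\<dots> = young_symmetrizer \<rho> g"
    unfolding young_symmetrizer_rows
  proof (rule sum.cong[OF refl])
    fix h assume "h \<in> row_group \<rho>"
    hence "inv (r \<circ> h) \<circ> (r \<circ> g) = inv h \<circ> (inv r \<circ> (r \<circ> g))"
      by (simp add: permutes_inv_comp[OF row_group_permutes[OF r] row_group_permutes] o_assoc)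
    thus "col_elem \<rho> (inv (r \<circ> h) \<circ> (r \<circ> g)) = col_elem \<rho> (inv h \<circ> g)"
      by (simp add: permutes_comp_inv_cancel(1)[OF row_group_permutes[OF r]])
  qed
  finally show ?thesis .
qed

lemma col_elem_column:
  assumes s: "s \<in> column_group \<rho>"
  shows "col_elem \<rho> (g \<circ> s) = of_int (sign s) * col_elem \<rho> g"
  using column_group_cancel_right[OF s, of g] sign_comp[of "young_diagram \<rho>" g s]
    column_group_permutes[OF s] column_group_permutes[of g \<rho>]
  by (auto simp: col_elem_def)

lemma young_symmetrizer_column:
  assumes s: "s \<in> column_group \<rho>"
  shows "young_symmetrizer \<rho> (g \<circ> s) = of_int (sign s) * young_symmetrizer \<rho> g"
  unfolding young_symmetrizer_rows sum_distrib_left o_assoc col_elem_column[OF s] ..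

text \<open>The row and the column group meet only in the identity. This normalization lets the
  scalar in von Neumann's lemma be read off at \<open>id\<close>.\<close>

lemma young_symmetrizer_id: "young_symmetrizer \<rho> id = 1"
proof -
  have "young_symmetrizer \<rho> id = (\<Sum>h\<in>row_group \<rho>. col_elem \<rho> (inv h))"
    unfolding young_symmetrizer_rows by simp
  also have "\<dots> = (\<Sum>h\<in>row_group \<rho>. col_elem \<rho> h)" by (rule sum_row_group_inv)
  also have "\<dots> = (\<Sum>h\<in>{id}. col_elem \<rho> h)"
    by (rule sum.mono_neutral_right) (auto simp: col_elem_def dest: row_column_group_Int)
  also have "\<dots> = 1" by (simp add: col_elem_def)
  finally show ?thesis .
qed

lemma young_symmetrizer_real: "young_symmetrizer \<rho> g \<in> \<real>"
  unfolding young_symmetrizer_rows by (intro sum_in_Reals) (auto simp: col_elem_def)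

section \<open>Fillings with distinct entries in each column\<close>

lemma card_young_diagram_rows: "card {e \<in> young_diagram \<rho>. fst e \<le> v} = (\<Sum>i<v. prow \<rho> i)"
proof -
  let ?N = "max (length \<rho>) v"
  have "card {e \<in> young_diagram \<rho>. fst e \<le> v} = (\<Sum>e\<in>young_diagram \<rho>. if fst e \<le> v then 1 else 0)"
    by (simp add: sum.inter_filter[symmetric])
  also have "\<dots> = (\<Sum>i<?N. \<Sum>j=1..prow \<rho> i. if fst (Suc i, j) \<le> v then 1 else 0)"
    by (rule sum_young_diagram) simp
  also have "\<dots> = (\<Sum>i<?N. if i < v then prow \<rho> i else 0)"
    by (rule sum.cong) auto
  also have "\<dots> = (\<Sum>i<v. prow \<rho> i)"
    by (rule sum.mono_neutral_cong_right) auto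
  finally show ?thesis .
qed

definition column_injective :: "nat list \<Rightarrow> (nat \<times> nat \<Rightarrow> nat) \<Rightarrow> bool" where
  "column_injective \<rho> u \<longleftrightarrow>
     (\<forall>e\<in>young_diagram \<rho>. \<forall>e'\<in>young_diagram \<rho>. snd e = snd e' \<longrightarrow> u e = u e' \<longrightarrow> e = e')"

lemma card_split_columns:
  "card {e \<in> young_diagram \<rho>. P e} =
    (\<Sum>j\<in>snd ` young_diagram \<rho>. card {e \<in> young_diagram \<rho>. snd e = j \<and> P e})"
proof -
  have "{e \<in> young_diagram \<rho>. P e} =
      (\<Union>j\<in>snd ` young_diagram \<rho>. {e \<in> young_diagram \<rho>. snd e = j \<and> P e})" by auto
  thus ?thesis by (simp only:) (rule card_UN_disjoint, auto)
qed

lemma mem_young_diagram_conj: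
  "\<rho> \<in> partitions n \<Longrightarrow> (i, j) \<in> young_diagram \<rho> \<longleftrightarrow> 1 \<le> i \<and> 1 \<le> j \<and> i \<le> conj_part \<rho> j"
  using le_conj_part_iff[of \<rho> n i j] by (auto simp: mem_young_diagram_iff)

lemma card_column_le:
  assumes \<rho>: "\<rho> \<in> partitions n" and j: "j \<in> snd ` young_diagram \<rho>"
  shows "card {e \<in> young_diagram \<rho>. snd e = j \<and> fst e \<le> v} = min v (conj_part \<rho> j)"
proof -
  have "{e \<in> young_diagram \<rho>. snd e = j \<and> fst e \<le> v} = (\<lambda>i. (i, j)) ` {1..min v (conj_part \<rho> j)}"
    using j mem_young_diagram_conj[OF \<rho>] by auto
  thus ?thesis by (simp add: card_image inj_on_def)
qed

lemma card_column:
  assumes \<rho>: "\<rho> \<in> partitions n" and j: "j \<in> snd ` young_diagram \<rho>"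
  shows "card {e \<in> young_diagram \<rho>. snd e = j} = conj_part \<rho> j"
proof -
  have "{e \<in> young_diagram \<rho>. snd e = j} = {e \<in> young_diagram \<rho>. snd e = j \<and> fst e \<le> conj_part \<rho> j}"
    using mem_young_diagram_conj[OF \<rho>] by auto
  thus ?thesis using card_column_le[OF \<rho> j, of "conj_part \<rho> j"] by simp
qed

text \<open>A column contains each of the v values below v at most once and has only
  \<open>conj_part \<rho> j\<close> squares. The smaller of the two bounds is the number of its
  squares in the first v rows.\<close>

lemma card_column_injective_le:
  assumes \<rho>: "\<rho> \<in> partitions n" and u: "column_injective \<rho> u" and j: "j \<in> snd ` young_diagram \<rho>"
  shows "card {e \<in> young_diagram \<rho>. snd e = j \<and> u e < v} \<le>
    card {e \<in> young_diagram \<rho>. snd e = j \<and> fst e \<le> v}"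
proof -
  let ?S = "{e \<in> young_diagram \<rho>. snd e = j \<and> u e < v}"
  have "card ?S \<le> card {e \<in> young_diagram \<rho>. snd e = j}"
    by (rule card_mono) auto
  moreover have "inj_on u ?S" using u by (auto simp: column_injective_def inj_on_def)
  hence "card ?S \<le> card {..<v}" by (rule card_inj_on_le) auto
  ultimately show ?thesis
    by (simp add: card_column[OF \<rho> j] card_column_le[OF \<rho> j])
qed

lemma column_injective_dominance:
  assumes \<rho>: "\<rho> \<in> partitions n" and u: "column_injective \<rho> u"
  shows "card {e \<in> young_diagram \<rho>. u e < v} \<le> (\<Sum>i<v. prow \<rho> i)"
  unfolding card_young_diagram_rows[symmetric]
  by (subst (1 2) card_split_columns) (rule sum_mono, rule card_column_injective_le[OF assms])

text \<open>For content \<rho> the bounds are attained in every column. With v the height of the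
  column, this says that its entries are exactly 0, ..., v - 1, so moving every square to the row
  given by its entry is a column permutation.\<close>

lemma column_injective_standard:
  assumes \<rho>: "\<rho> \<in> partitions n" and u: "column_injective \<rho> u"
    and eq: "\<And>v. card {e \<in> young_diagram \<rho>. u e < v} = (\<Sum>i<v. prow \<rho> i)"
  obtains s where "s \<in> column_group \<rho>" "\<And>e. e \<in> young_diagram \<rho> \<Longrightarrow> fst (s e) = Suc (u e)"
proof -
  let ?Y = "young_diagram \<rho>"
  have bound: "u e < conj_part \<rho> (snd e)" if e: "e \<in> ?Y" for e
  proof -
    define j where "j = snd e"
    let ?v = "conj_part \<rho> j"
    have j: "j \<in> snd ` ?Y" using e by (auto simp: j_def)
    have "(\<Sum>j\<in>snd ` ?Y. card {e \<in> ?Y. snd e = j \<and> u e < ?v}) =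
        (\<Sum>j\<in>snd ` ?Y. card {e \<in> ?Y. snd e = j \<and> fst e \<le> ?v})"
      unfolding card_split_columns[symmetric] card_young_diagram_rows by (rule eq)
    hence "card {e \<in> ?Y. snd e = j \<and> u e < ?v} = card {e \<in> ?Y. snd e = j \<and> fst e \<le> ?v}"
      by (rule sum_mono_inv) (use card_column_injective_le[OF \<rho> u] j in auto)
    also have "\<dots> = card {e \<in> ?Y. snd e = j}"
      using card_column[OF \<rho> j] card_column_le[OF \<rho> j] by simp
    finally have "{e \<in> ?Y. snd e = j \<and> u e < ?v} = {e \<in> ?Y. snd e = j}"
      by (intro card_subset_eq) auto
    thus ?thesis using e by (auto simp: j_def)
  qed
  define s where "s = (\<lambda>e. if e \<in> ?Y then (Suc (u e), snd e) else e)"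
  have "s e \<in> ?Y" if "e \<in> ?Y" for e
    using bound[OF that] that mem_young_diagram_conj[OF \<rho>]
    by (cases e) (auto simp: s_def)
  hence "s ` ?Y \<subseteq> ?Y" by blast
  moreover have "inj_on s ?Y"
    using u by (auto simp: inj_on_def s_def column_injective_def)
  ultimately have "bij_betw s ?Y ?Y"
    by (simp add: bij_betw_def endo_inj_surj)
  hence "s permutes ?Y" by (rule bij_imp_permutes) (simp add: s_def)
  hence "s \<in> column_group \<rho>" by (auto simp: column_group_def s_def)
  moreover have "fst (s e) = Suc (u e)" if "e \<in> ?Y" for e using that by (simp add: s_def)
  ultimately show ?thesis using that by blast
qed

text \<open>The rows to which g sends the squares form a filling of content \<rho>. Sorting its
  columns gives s, and g after the inverse of s preserves rows. Rows are numbered from 1 and entries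
  from 0, hence the shift by 1.\<close>

lemma row_column_factorization:
  assumes \<rho>: "\<rho> \<in> partitions n" and g: "g permutes young_diagram \<rho>"
    and inj: "column_injective \<rho> (\<lambda>e. fst (g e))"
  obtains r s where "r \<in> row_group \<rho>" "s \<in> column_group \<rho>" "g = r \<circ> s"
proof -
  let ?Y = "young_diagram \<rho>"
  have pos: "1 \<le> fst e" if "e \<in> ?Y" for e using that by (cases e) (auto simp: mem_young_diagram_iff)
  have gY: "g e \<in> ?Y \<longleftrightarrow> e \<in> ?Y" for e using g by (rule permutes_in_image)
  have pos': "1 \<le> fst (g e)" if "e \<in> ?Y" for e using pos gY that by blast
  obtain s where s: "s \<in> column_group \<rho>" "\<And>e. e \<in> ?Y \<Longrightarrow> fst (s e) = Suc (fst (g e) - 1)"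
  proof (rule column_injective_standard[OF \<rho>])
    show "column_injective \<rho> (\<lambda>e. fst (g e) - 1)"
      unfolding column_injective_def
    proof (intro ballI impI)
      fix e e' assume *: "e \<in> ?Y" "e' \<in> ?Y" "snd e = snd e'" "fst (g e) - 1 = fst (g e') - 1"
      hence "fst (g e) = fst (g e')" using pos'[of e] pos'[of e'] by linarith
      thus "e = e'" using inj * by (auto simp: column_injective_def)
    qed
    fix v
    have "{e \<in> ?Y. fst e \<le> v} = g ` {e \<in> ?Y. fst (g e) - 1 < v}"
    proof (intro equalityI subsetI)
      fix e assume e: "e \<in> {e \<in> ?Y. fst e \<le> v}"
      moreover have "inv g e \<in> ?Y" using e permutes_in_image[OF permutes_inv[OF g]] by auto
      moreover have "g (inv g e) = e" by (rule permutes_inverses(1)[OF g])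
      ultimately show "e \<in> g ` {e \<in> ?Y. fst (g e) - 1 < v}"
        using pos[of e] by (intro image_eqI[of _ _ "inv g e"]) auto
    qed (use gY pos' in \<open>auto simp: Suc_le_eq\<close>)
    hence "card {e \<in> ?Y. fst e \<le> v} = card {e \<in> ?Y. fst (g e) - 1 < v}"
      by (simp only: card_image[OF permutes_inj_on[OF g]])
    thus "card {e \<in> ?Y. fst (g e) - 1 < v} = (\<Sum>i<v. prow \<rho> i)"
      by (simp add: card_young_diagram_rows)
  qed blast
  have sp: "s permutes ?Y" by (rule column_group_permutes[OF s(1)])
  define r where "r = g \<circ> inv s"
  have rp: "r permutes ?Y" unfolding r_def by (rule permutes_compose[OF permutes_inv[OF sp] g])
  have "fst (r e) = fst e" for e
  proof (cases "e \<in> ?Y")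
    case True
    hence e: "inv s e \<in> ?Y" using permutes_in_image[OF permutes_inv[OF sp]] by blast
    have "fst (r e) = fst (s (inv s e))"
      using s(2)[OF e] pos'[OF e] by (simp add: r_def)
    thus ?thesis by (simp only: permutes_inverses(1)[OF sp])
  next
    case False
    thus ?thesis using permutes_not_in[OF rp] by simp
  qed
  hence "r \<in> row_group \<rho>" using rp by (simp add: row_group_def)
  moreover have "g = r \<circ> s" by (simp only: r_def permutes_comp_inv_cancel(4)[OF sp])
  ultimately show ?thesis using s(1) that by blast
qed

text \<open>Von Neumann's lemma: a transposition of two squares of one column annihilates all other coefficients.\<close>

lemma young_symmetrizer_unique:
  assumes \<rho>: "\<rho> \<in> partitions n" and y: "y \<in> group_algebra (young_diagram \<rho>)"
    and row: "\<And>r g. r \<in> row_group \<rho> \<Longrightarrow> y (r \<circ> g) = y g"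
    and col: "\<And>s g. s \<in> column_group \<rho> \<Longrightarrow> y (g \<circ> s) = of_int (sign s) * y g"
  shows "y = cfun_scale (y id) (young_symmetrizer \<rho>)"
proof
  fix g
  let ?Y = "young_diagram \<rho>"
  let ?c = "young_symmetrizer \<rho>"
  show "y g = cfun_scale (y id) ?c g"
  proof (cases "g permutes ?Y")
    case False
    thus ?thesis using y young_symmetrizer_supported[of \<rho>]
      by (auto simp: group_algebra_def cfun_scale_def)
  next
    case g: True
    show ?thesis
    proof (cases "column_injective \<rho> (\<lambda>e. fst (g e))")
      case True
      then obtain r s where rs: "r \<in> row_group \<rho>" "s \<in> column_group \<rho>" "g = r \<circ> s"
        using row_column_factorization[OF \<rho> g] by blast
      have "y g = of_int (sign s) * y id" "?c g = of_int (sign s) * ?c id"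
        using row[OF rs(1), of s] col[OF rs(2), of id] young_symmetrizer_row[OF rs(1), of s]
          young_symmetrizer_column[OF rs(2), of id] by (simp_all add: rs(3))
      thus ?thesis by (simp add: cfun_scale_def young_symmetrizer_id)
    next
      case False
      then obtain e e' where e: "e \<in> ?Y" "e' \<in> ?Y" "snd e = snd e'" "fst (g e) = fst (g e')" "e \<noteq> e'"
        by (auto simp: column_injective_def)
      let ?t = "Transposition.transpose (g e) (g e')" and ?t' = "Transposition.transpose e e'"
      have ge: "g e \<in> ?Y" "g e' \<in> ?Y" using e permutes_in_image[OF g] by auto
      have t: "?t \<in> row_group \<rho>"
        using permutes_swap_id[OF ge] e(4)
        by (simp add: row_group_def Transposition.transpose_def del: split_paired_All)
      have t': "?t' \<in> column_group \<rho>"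
        using permutes_swap_id[OF e(1,2)] e(3)
        by (simp add: column_group_def Transposition.transpose_def del: split_paired_All)
      have eq: "?t \<circ> g = g \<circ> ?t'"
        using permutes_inj[OF g] by (intro ext) (simp add: Transposition.transpose_def inj_eq)
      have sgn: "sign ?t' = -1" using e(5) by (simp add: sign_swap_id)
      have "y g = - y g" using row[OF t, of g] col[OF t', of g] by (simp add: eq sgn)
      moreover have "?c g = - ?c g"
        using young_symmetrizer_row[OF t, of g] young_symmetrizer_column[OF t', of g] by (simp add: eq sgn)
      ultimately show ?thesis by (simp add: cfun_scale_def)
    qed
  qed
qed

lemma sum_young_symmetrizer:
  "(\<Sum>g | g permutes young_diagram \<rho>. young_symmetrizer \<rho> g * f g) =
    (\<Sum>h\<in>row_group \<rho>. \<Sum>s\<in>column_group \<rho>. of_int (sign s) * f (h \<circ> s))"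
proof -
  let ?G = "{g. g permutes young_diagram \<rho>}"
  have "(\<Sum>g\<in>?G. young_symmetrizer \<rho> g * f g) =
      (\<Sum>g\<in>?G. \<Sum>h\<in>row_group \<rho>. col_elem \<rho> (inv h \<circ> g) * f g)"
    unfolding young_symmetrizer_rows sum_distrib_right ..
  also have "\<dots> = (\<Sum>h\<in>row_group \<rho>. \<Sum>g\<in>?G. col_elem \<rho> (inv h \<circ> g) * f g)"
    by (rule sum.swap)
  also have "\<dots> = (\<Sum>h\<in>row_group \<rho>. \<Sum>s\<in>column_group \<rho>. of_int (sign s) * f (h \<circ> s))"
  proof (rule sum.cong[OF refl])
    fix h assume "h \<in> row_group \<rho>"
    hence h: "h permutes young_diagram \<rho>" by (rule row_group_permutes)
    have "(\<Sum>g\<in>?G. col_elem \<rho> (inv h \<circ> g) * f g) =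
        (\<Sum>g\<in>?G. col_elem \<rho> (inv h \<circ> (h \<circ> g)) * f (h \<circ> g))"
      by (rule sum_permutes_shift(1)[OF h, symmetric])
    also have "\<dots> = (\<Sum>g\<in>?G. col_elem \<rho> g * f (h \<circ> g))"
      by (simp only: permutes_comp_inv_cancel(1)[OF h])
    finally show "(\<Sum>g\<in>?G. col_elem \<rho> (inv h \<circ> g) * f g) =
        (\<Sum>s\<in>column_group \<rho>. of_int (sign s) * f (h \<circ> s))"
      by (simp only: sum_permutes_col_elem)
  qed
  finally show ?thesis .
qed

section \<open>The scalar k with c c = k c\<close>

lemma conv_left_invariant:
  assumes r: "r permutes Y" and x: "\<And>g. x (r \<circ> g) = x g"
  shows "conv Y x y (r \<circ> g) = conv Y x y g"
proof -
  have "conv Y x y (r \<circ> g) = (\<Sum>h | h permutes Y. x (r \<circ> h) * y (inv (r \<circ> h) \<circ> (r \<circ> g)))"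
    unfolding conv_def by (rule sum_permutes_shift(1)[OF r, symmetric])
  also have "\<dots> = conv Y x y g"
    unfolding conv_def
  proof (rule sum.cong[OF refl])
    fix h assume "h \<in> {h. h permutes Y}"
    hence "inv (r \<circ> h) \<circ> (r \<circ> g) = inv h \<circ> (inv r \<circ> (r \<circ> g))"
      using permutes_inv_comp[OF r] by (simp add: o_assoc)
    thus "x (r \<circ> h) * y (inv (r \<circ> h) \<circ> (r \<circ> g)) = x h * y (inv h \<circ> g)"
      by (simp add: x permutes_comp_inv_cancel(1)[OF r])
  qed
  finally show ?thesis .
qed

lemma conv_right_semi_invariant:
  assumes "\<And>g. y (g \<circ> s) = t * y g"
  shows "conv Y x y (g \<circ> s) = t * conv Y x y g"
  unfolding conv_def o_assoc assms sum_distrib_left by (simp add: mult.left_commute)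

text \<open>The product inherits row invariance from its left factor and the sign rule for columns
  from its right factor, so it falls under von Neumann's lemma.\<close>

lemma young_symmetrizer_sandwich:
  assumes "\<rho> \<in> partitions n"
  shows "conv (young_diagram \<rho>) (young_symmetrizer \<rho>) (conv (young_diagram \<rho>) x (young_symmetrizer \<rho>)) =
    cfun_scale (conv (young_diagram \<rho>) (young_symmetrizer \<rho>)
      (conv (young_diagram \<rho>) x (young_symmetrizer \<rho>)) id) (young_symmetrizer \<rho>)"
proof (rule young_symmetrizer_unique[OF assms])
  show "conv (young_diagram \<rho>) (young_symmetrizer \<rho>) (conv (young_diagram \<rho>) x (young_symmetrizer \<rho>))
      \<in> group_algebra (young_diagram \<rho>)"
    by (intro conv_supported young_symmetrizer_supported)
qed (use young_symmetrizer_row young_symmetrizer_column row_group_permutes in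
    \<open>auto intro!: conv_left_invariant conv_right_semi_invariant\<close>)

definition young_const :: "nat list \<Rightarrow> complex" where
  "young_const \<rho> = conv (young_diagram \<rho>) (young_symmetrizer \<rho>) (young_symmetrizer \<rho>) id"

lemma young_symmetrizer_square:
  assumes "\<rho> \<in> partitions n"
  shows "conv (young_diagram \<rho>) (young_symmetrizer \<rho>) (young_symmetrizer \<rho>) =
    cfun_scale (young_const \<rho>) (young_symmetrizer \<rho>)"
  unfolding young_const_def
proof (rule young_symmetrizer_unique[OF assms])
  show "conv (young_diagram \<rho>) (young_symmetrizer \<rho>) (young_symmetrizer \<rho>)
      \<in> group_algebra (young_diagram \<rho>)"
    by (intro conv_supported young_symmetrizer_supported)
qed (use young_symmetrizer_row young_symmetrizer_column row_group_permutes in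
    \<open>auto intro!: conv_left_invariant conv_right_semi_invariant\<close>)

text \<open>Inversion reverses products and fixes both a and b, so it turns a b into b a.\<close>

lemma young_symmetrizer_inv:
  assumes g: "g permutes young_diagram \<rho>"
  shows "young_symmetrizer \<rho> (inv g) = conv (young_diagram \<rho>) (col_elem \<rho>) (row_elem \<rho>) g"
proof -
  have "young_symmetrizer \<rho> (inv g) = (\<Sum>s\<in>column_group \<rho>. of_int (sign s) * row_elem \<rho> (inv g \<circ> inv s))"
    by (rule young_symmetrizer_columns[OF permutes_inv[OF g]])
  also have "\<dots> = (\<Sum>s\<in>column_group \<rho>. of_int (sign (inv s)) * row_elem \<rho> (inv g \<circ> inv (inv s)))"
    by (rule sum_column_group_inv[symmetric])
  also have "\<dots> = (\<Sum>s\<in>column_group \<rho>. of_int (sign s) * row_elem \<rho> (inv s \<circ> g))"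
  proof (rule sum.cong[OF refl])
    fix s assume "s \<in> column_group \<rho>"
    hence s: "s permutes young_diagram \<rho>" by (rule column_group_permutes)
    have "inv g \<circ> s = inv (inv s \<circ> g)"
      using permutes_inv_comp[OF permutes_inv[OF s] g] permutes_inv_inv[OF s] by simp
    moreover have "inv x \<in> row_group \<rho> \<longleftrightarrow> x \<in> row_group \<rho>" if "x permutes young_diagram \<rho>" for x
      using row_group_inv[of x \<rho>] row_group_inv[of "inv x" \<rho>] permutes_inv_inv[OF that] by auto
    ultimately have "row_elem \<rho> (inv g \<circ> s) = row_elem \<rho> (inv s \<circ> g)"
      using permutes_compose[OF g permutes_inv[OF s]] by (simp add: row_elem_def)
    thus "of_int (sign (inv s)) * row_elem \<rho> (inv g \<circ> inv (inv s)) = of_int (sign s) * row_elem \<rho> (inv s \<circ> g)"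
      using permutes_inv_inv[OF s] sign_inv_permutes[OF finite_young_diagram s] by simp
  qed
  also have "\<dots> = conv (young_diagram \<rho>) (col_elem \<rho>) (row_elem \<rho>) g"
    unfolding conv_def by (rule sum_permutes_col_elem[symmetric])
  finally show ?thesis .
qed

lemma sum_real_squares_eq_0:
  fixes f :: "'b \<Rightarrow> complex"
  assumes "finite A" "\<And>x. x \<in> A \<Longrightarrow> f x \<in> \<real>" "(\<Sum>x\<in>A. (f x)\<^sup>2) = 0" "x \<in> A"
  shows "f x = 0"
proof -
  have f: "f x = of_real (Re (f x))" if "x \<in> A" for x using assms(2)[OF that] by (simp add: of_real_Re)
  have "(\<Sum>x\<in>A. (f x)\<^sup>2) = (\<Sum>x\<in>A. of_real ((Re (f x))\<^sup>2))"
    by (rule sum.cong[OF refl]) (metis f of_real_power)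
  hence "of_real (\<Sum>x\<in>A. (Re (f x))\<^sup>2) = (0 :: complex)" using assms(3) by simp
  hence "(\<Sum>x\<in>A. (Re (f x))\<^sup>2) = 0" by (simp only: of_real_eq_0_iff)
  hence "(Re (f x))\<^sup>2 = 0" using assms(1,4) by (subst (asm) sum_nonneg_eq_0_iff) auto
  thus ?thesis using f[OF assms(4)] by simp
qed

text \<open>
  With \<open>c = a b\<close> and \<open>c* = b a\<close>, the element \<open>c c*\<close> is selfadjoint, and its square is a multiple of
  \<open>(c c) a\<close>. If \<open>c c = 0\<close>, then positivity gives first \<open>c c* = 0\<close> and then \<open>c = 0\<close>.
\<close>

lemma young_const_nonzero:
  assumes \<rho>: "\<rho> \<in> partitions n"
  shows "young_const \<rho> \<noteq> 0"
proof
  assume k0: "young_const \<rho> = 0"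
  let ?Y = "young_diagram \<rho>" and ?c = "young_symmetrizer \<rho>" and ?a = "row_elem \<rho>" and ?b = "col_elem \<rho>"
  let ?G = "{g. g permutes ?Y}"
  have fin: "finite ?G" by (rule finite_permutations) auto
  define ba where "ba = conv ?Y ?b ?a"
  define z where "z = conv ?Y ?c ba"
  have bb: "conv ?Y ?b ?b = cfun_scale (of_nat (card (column_group \<rho>))) ?b"
  proof
    fix g
    have "conv ?Y ?b ?b g = (\<Sum>h\<in>column_group \<rho>. of_int (sign h) * ?b (inv h \<circ> g))"
      unfolding conv_def by (rule sum_permutes_col_elem)
    also have "\<dots> = (\<Sum>h\<in>column_group \<rho>. ?b g)"
    proof (rule sum.cong[OF refl])
      fix h assume h: "h \<in> column_group \<rho>"
      note hp = column_group_permutes[OF h]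
      show "of_int (sign h) * ?b (inv h \<circ> g) = ?b g"
      proof (cases "g \<in> column_group \<rho>")
        case True
        have "sign (inv h \<circ> g) = sign h * sign g"
          using sign_comp[OF finite_young_diagram permutes_inv[OF hp] column_group_permutes[OF True]]
            sign_inv_permutes[OF finite_young_diagram hp] by simp
        thus ?thesis using True column_group_cancel_left[OF column_group_inv[OF h], of g]
          by (simp add: col_elem_def sign_sign)
      qed (use column_group_cancel_left[OF column_group_inv[OF h], of g] in \<open>simp add: col_elem_def\<close>)
    qed
    finally show "conv ?Y ?b ?b g = cfun_scale (of_nat (card (column_group \<rho>))) ?b g"
      by (simp add: cfun_scale_def)
  qed
  have ac: "conv ?Y ?a ?c = cfun_scale (of_nat (card (row_group \<rho>))) ?c"
  proof
    fix g
    have "conv ?Y ?a ?c g = (\<Sum>h\<in>row_group \<rho>. ?c (inv h \<circ> g))"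
      unfolding conv_def by (rule sum_permutes_row_elem)
    thus "conv ?Y ?a ?c g = cfun_scale (of_nat (card (row_group \<rho>))) ?c g"
      by (simp add: cfun_scale_def young_symmetrizer_row row_group_inv)
  qed
  have z: "z = cfun_scale (of_nat (card (column_group \<rho>))) (conv ?Y ?c ?a)"
  proof -
    have "z = conv ?Y ?a (conv ?Y (conv ?Y ?b ?b) ?a)"
      by (simp only: z_def ba_def young_symmetrizer_conv conv_assoc)
    thus ?thesis
      by (simp only: bb conv_scale_left conv_scale_right young_symmetrizer_conv conv_assoc)
  qed
  have "conv ?Y (conv ?Y ?c ?a) (conv ?Y ?c ?a) = conv ?Y ?c (conv ?Y (conv ?Y ?a ?c) ?a)"
    by (simp only: conv_assoc)
  also have "\<dots> = cfun_scale (of_nat (card (row_group \<rho>))) (conv ?Y (conv ?Y ?c ?c) ?a)"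
    by (simp only: ac conv_scale_left conv_scale_right conv_assoc)
  also have "\<dots> = (\<lambda>_. 0)"
    unfolding young_symmetrizer_square[OF \<rho>] k0 by (simp add: cfun_scale_def conv_def)
  finally have zz: "conv ?Y z z = (\<lambda>_. 0)"
    unfolding z conv_scale_left conv_scale_right by (simp add: cfun_scale_def)
  have z_apply: "z g = (\<Sum>h\<in>?G. ?c h * ?c (inv g \<circ> h))" if g: "g permutes ?Y" for g
    unfolding z_def conv_def
  proof (rule sum.cong[OF refl])
    fix h assume "h \<in> ?G"
    hence h: "h permutes ?Y" by simp
    have "ba (inv h \<circ> g) = ?c (inv (inv h \<circ> g))"
      unfolding ba_def using young_symmetrizer_inv[OF permutes_compose[OF g permutes_inv[OF h]]] by simp
    also have "inv (inv h \<circ> g) = inv g \<circ> h"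
      using permutes_inv_comp[OF permutes_inv[OF h] g] permutes_inv_inv[OF h] by simp
    finally show "?c h * ba (inv h \<circ> g) = ?c h * ?c (inv g \<circ> h)" by (simp only:)
  qed
  have z_real: "z g \<in> \<real>" if "g \<in> ?G" for g
    using z_apply[of g] that young_symmetrizer_real by (auto intro!: sum_in_Reals Reals_mult)
  have z_inv: "z (inv g) = z g" if g: "g permutes ?Y" for g
  proof -
    have "z (inv g) = (\<Sum>h\<in>?G. ?c h * ?c (g \<circ> h))"
      using z_apply[OF permutes_inv[OF g]] permutes_inv_inv[OF g] by simp
    also have "\<dots> = (\<Sum>h\<in>?G. ?c (inv g \<circ> h) * ?c (g \<circ> (inv g \<circ> h)))"
      by (rule sum_permutes_shift(1)[OF permutes_inv[OF g], symmetric])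
    also have "\<dots> = z g"
      unfolding z_apply[OF g] permutes_comp_inv_cancel(2)[OF g] by (simp add: mult.commute)
    finally show ?thesis .
  qed
  \<comment> \<open>As z is invariant under inversion, the value of z z at \<open>id\<close> is a
    sum of real squares; by \<open>z_apply\<close> so is the value of z itself.\<close>
  have "(\<Sum>g\<in>?G. (z g)\<^sup>2) = (\<Sum>g\<in>?G. z g * z (inv g))"
    by (rule sum.cong[OF refl]) (simp add: z_inv power2_eq_square)
  also have "\<dots> = 0" using fun_cong[OF zz, of id] by (simp only: conv_id)
  finally have "z id = 0"
    by (rule sum_real_squares_eq_0[OF fin z_real, rotated]) (auto simp: permutes_id)
  hence "(\<Sum>h\<in>?G. (?c h)\<^sup>2) = 0"
    using z_apply[OF permutes_id] by (simp add: power2_eq_square)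
  hence "?c id = 0"
    by (rule sum_real_squares_eq_0[OF fin young_symmetrizer_real]) (auto simp: permutes_id)
  thus False by (simp add: young_symmetrizer_id)
qed

section \<open>The irreducible characters\<close>

text \<open>The symmetrizer summed over its conjugates, a class function that is the character up to
  the factor \<open>young_const\<close>.\<close>

definition conj_sum :: "nat list \<Rightarrow> (nat \<times> nat \<Rightarrow> nat \<times> nat) \<Rightarrow> complex" where
  "conj_sum \<rho> g = (\<Sum>h | h permutes young_diagram \<rho>. young_symmetrizer \<rho> (inv h \<circ> (g \<circ> h)))"

text \<open>Inversion exchanges a b with b a. Moving the column factor from one end to the other is
  a conjugation, which the sum over h absorbs.\<close>

lemma conj_sum_inv:
  assumes g: "g permutes young_diagram \<rho>"
  shows "conj_sum \<rho> (inv g) = conj_sum \<rho> g"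
proof -
  let ?Y = "young_diagram \<rho>"
  let ?G = "{g. g permutes ?Y}"
  let ?C = "column_group \<rho>"
  have "conj_sum \<rho> (inv g) = (\<Sum>h\<in>?G. \<Sum>s\<in>?C. of_int (sign s) * row_elem \<rho> (inv s \<circ> (inv h \<circ> (g \<circ> h))))"
    unfolding conj_sum_def
  proof (rule sum.cong[OF refl])
    fix h assume "h \<in> ?G"
    hence h: "h permutes ?Y" by simp
    have x: "inv h \<circ> (g \<circ> h) permutes ?Y"
      by (intro permutes_compose[OF permutes_compose[OF h g] permutes_inv[OF h]])
    have "inv h \<circ> (inv g \<circ> h) = inv (inv h \<circ> (g \<circ> h))"
      using permutes_inv_comp[OF permutes_inv[OF h] permutes_compose[OF h g]]
        permutes_inv_comp[OF g h] permutes_inv_inv[OF h] by (simp add: o_assoc)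
    hence "young_symmetrizer \<rho> (inv h \<circ> (inv g \<circ> h)) =
        conv ?Y (col_elem \<rho>) (row_elem \<rho>) (inv h \<circ> (g \<circ> h))"
      using young_symmetrizer_inv[OF x] by (simp only:)
    thus "young_symmetrizer \<rho> (inv h \<circ> (inv g \<circ> h)) =
        (\<Sum>s\<in>?C. of_int (sign s) * row_elem \<rho> (inv s \<circ> (inv h \<circ> (g \<circ> h))))"
      by (simp only: conv_def sum_permutes_col_elem)
  qed
  also have "\<dots> = (\<Sum>s\<in>?C. \<Sum>h\<in>?G. of_int (sign s) * row_elem \<rho> (inv s \<circ> (inv h \<circ> (g \<circ> h))))"
    by (rule sum.swap)
  also have "\<dots> = (\<Sum>s\<in>?C. \<Sum>h\<in>?G. of_int (sign s) * row_elem \<rho> ((inv h \<circ> (g \<circ> h)) \<circ> inv s))"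
  proof (rule sum.cong[OF refl])
    fix s assume "s \<in> ?C"
    hence s: "s permutes ?Y" by (rule column_group_permutes)
    have "(\<Sum>h\<in>?G. of_int (sign s) * row_elem \<rho> (inv s \<circ> (inv h \<circ> (g \<circ> h)))) =
        (\<Sum>h\<in>?G. of_int (sign s) * row_elem \<rho> (inv s \<circ> (inv (h \<circ> inv s) \<circ> (g \<circ> (h \<circ> inv s)))))"
      by (rule sum_permutes_shift(2)[OF permutes_inv[OF s], symmetric])
    also have "\<dots> = (\<Sum>h\<in>?G. of_int (sign s) * row_elem \<rho> ((inv h \<circ> (g \<circ> h)) \<circ> inv s))"
    proof (rule sum.cong[OF refl])
      fix h assume "h \<in> ?G"
      hence "inv (h \<circ> inv s) = s \<circ> inv h"
        using permutes_inv_comp[of h ?Y "inv s"] permutes_inv[OF s] permutes_inv_inv[OF s] by simp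
      hence "inv s \<circ> (inv (h \<circ> inv s) \<circ> (g \<circ> (h \<circ> inv s))) = (inv h \<circ> (g \<circ> h)) \<circ> inv s"
        by (simp add: o_assoc permutes_comp_inv_cancel(6)[OF s])
      thus "of_int (sign s) * row_elem \<rho> (inv s \<circ> (inv (h \<circ> inv s) \<circ> (g \<circ> (h \<circ> inv s)))) =
          of_int (sign s) * row_elem \<rho> ((inv h \<circ> (g \<circ> h)) \<circ> inv s)"
        by (simp only:)
    qed
    finally show "(\<Sum>h\<in>?G. of_int (sign s) * row_elem \<rho> (inv s \<circ> (inv h \<circ> (g \<circ> h)))) =
        (\<Sum>h\<in>?G. of_int (sign s) * row_elem \<rho> ((inv h \<circ> (g \<circ> h)) \<circ> inv s))" .
  qed
  also have "\<dots> = (\<Sum>h\<in>?G. \<Sum>s\<in>?C. of_int (sign s) * row_elem \<rho> ((inv h \<circ> (g \<circ> h)) \<circ> inv s))"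
    by (rule sum.swap)
  also have "\<dots> = conj_sum \<rho> g"
    unfolding conj_sum_def
  proof (rule sum.cong[OF refl])
    fix h assume "h \<in> ?G"
    hence h: "h permutes ?Y" by simp
    show "(\<Sum>s\<in>?C. of_int (sign s) * row_elem \<rho> ((inv h \<circ> (g \<circ> h)) \<circ> inv s)) =
        young_symmetrizer \<rho> (inv h \<circ> (g \<circ> h))"
      by (rule young_symmetrizer_columns[symmetric])
         (intro permutes_compose[OF permutes_compose[OF h g] permutes_inv[OF h]])
  qed
  finally show ?thesis .
qed

text \<open>Right multiplication by c / k projects the group algebra onto the left ideal, so the
  trace is that of x \<mapsto> g x c / k on the whole algebra, read off in the basis of
  permutations. The result involves the inverse of g, which \<open>conj_sum_inv\<close>
  removes.\<close>

lemma irr_character_eq: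
  assumes \<rho>: "\<rho> \<in> partitions n" and g: "g permutes young_diagram \<rho>"
  shows "irr_character \<rho> g = conj_sum \<rho> g / young_const \<rho>"
proof -
  let ?Y = "young_diagram \<rho>" and ?c = "young_symmetrizer \<rho>" and ?k = "young_const \<rho>"
  let ?V = "specht_module \<rho>"
  let ?p = "cfun_scale (1 / ?k) ?c"
  have fin: "finite ?Y" by simp
  have k: "?k \<noteq> 0" by (rule young_const_nonzero[OF \<rho>])
  have scale: "cfun_scale s (cfun_scale t x) = cfun_scale (s * t) x" for s t :: complex and x :: "(nat \<times> nat \<Rightarrow> nat \<times> nat) \<Rightarrow> complex"
    by (simp add: cfun_scale_def mult.assoc)
  have mem: "conv ?Y x ?c \<in> ?V" if "x \<in> group_algebra ?Y" for x
    using that by (auto simp: specht_module_def)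
  have "irr_character \<rho> g = trace_on ?V (conv ?Y (perm_elem g))"
    unfolding irr_character_def by simp
  also have "\<dots> = (\<Sum>h | h permutes ?Y. conv ?Y (perm_elem g) (conv ?Y (perm_elem h) ?p) h)"
  proof (rule trace_on_conv_projection[OF fin])
    show "cfun.subspace ?V"
      unfolding cfun.subspace_def
    proof (intro conjI ballI allI)
      have "0 = conv ?Y 0 ?c" by (simp add: conv_def fun_eq_iff)
      thus "0 \<in> ?V" using mem[of 0] by (simp add: group_algebra_def)
    next
      fix x y assume "x \<in> ?V" "y \<in> ?V"
      then obtain x' y' where *: "x' \<in> group_algebra ?Y" "y' \<in> group_algebra ?Y"
        "x = conv ?Y x' ?c" "y = conv ?Y y' ?c" by (auto simp: specht_module_def)
      have "x + y = conv ?Y (x' + y') ?c"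
        by (simp add: * conv_def fun_eq_iff sum.distrib distrib_right)
      thus "x + y \<in> ?V" using mem[of "x' + y'"] * by (simp add: group_algebra_def)
    next
      fix t x assume "x \<in> ?V"
      then obtain x' where *: "x' \<in> group_algebra ?Y" "x = conv ?Y x' ?c" by (auto simp: specht_module_def)
      have "cfun_scale t x = conv ?Y (cfun_scale t x') ?c" by (simp add: * conv_scale_left)
      thus "cfun_scale t x \<in> ?V" using mem[of "cfun_scale t x'"] * by (simp add: group_algebra_def cfun_scale_def)
    qed
    show "?V \<subseteq> group_algebra ?Y"
      using conv_supported[OF young_symmetrizer_supported] by (auto simp: specht_module_def)
    show "conv ?Y x ?p \<in> ?V" if "x \<in> group_algebra ?Y" for x
    proof -
      have "cfun_scale (1 / ?k) x \<in> group_algebra ?Y"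
        using that by (simp add: group_algebra_def cfun_scale_def)
      from mem[OF this] show ?thesis by (simp only: conv_scale_right conv_scale_left)
    qed
    show "conv ?Y v ?p = v" if v: "v \<in> ?V" for v
    proof -
      obtain x where "v = conv ?Y x ?c" using v by (auto simp: specht_module_def)
      thus ?thesis
        using k by (simp add: conv_scale_right conv_assoc young_symmetrizer_square[OF \<rho>] scale)
    qed
    show "conv ?Y (perm_elem g) v \<in> ?V" if v: "v \<in> ?V" for v
    proof -
      obtain x where x: "x \<in> group_algebra ?Y" "v = conv ?Y x ?c" using v by (auto simp: specht_module_def)
      thus ?thesis using mem[OF conv_supported[OF x(1)]] by (simp add: conv_assoc)
    qed
  qed
  also have "\<dots> = (\<Sum>h | h permutes ?Y. ?c (inv h \<circ> (inv g \<circ> h)) / ?k)"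
  proof (rule sum.cong[OF refl])
    fix h assume "h \<in> {h. h permutes ?Y}"
    hence h: "h permutes ?Y" by simp
    show "conv ?Y (perm_elem g) (conv ?Y (perm_elem h) ?p) h = ?c (inv h \<circ> (inv g \<circ> h)) / ?k"
      unfolding conv_perm_elem_left[OF fin g] conv_perm_elem_left[OF fin h] by (simp add: cfun_scale_def)
  qed
  also have "\<dots> = conj_sum \<rho> (inv g) / ?k"
    by (simp add: conj_sum_def sum_divide_distrib)
  finally show ?thesis by (simp add: conj_sum_inv[OF g])
qed

text \<open>Against a class function, all conjugates of the symmetrizer pair alike; the factorial
  counts them.\<close>

lemma sum_conj_sum:
  assumes f: "\<And>h g. h permutes young_diagram \<rho> \<Longrightarrow> g permutes young_diagram \<rho> \<Longrightarrow> f (h \<circ> (g \<circ> inv h)) = f g"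
  shows "(\<Sum>g | g permutes young_diagram \<rho>. conj_sum \<rho> g * f g) =
    of_nat (fact (card (young_diagram \<rho>))) * (\<Sum>g | g permutes young_diagram \<rho>. young_symmetrizer \<rho> g * f g)"
proof -
  let ?G = "{g. g permutes young_diagram \<rho>}" and ?c = "young_symmetrizer \<rho>"
  have "(\<Sum>g\<in>?G. conj_sum \<rho> g * f g) = (\<Sum>h\<in>?G. \<Sum>g\<in>?G. ?c (inv h \<circ> (g \<circ> h)) * f g)"
    unfolding conj_sum_def sum_distrib_right by (rule sum.swap)
  also have "\<dots> = (\<Sum>h\<in>?G. \<Sum>g\<in>?G. ?c g * f g)"
  proof (rule sum.cong[OF refl])
    fix h assume "h \<in> ?G"
    hence h: "h permutes young_diagram \<rho>" by simp
    have "(\<Sum>g\<in>?G. ?c (inv h \<circ> (g \<circ> h)) * f g) =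
        (\<Sum>g\<in>?G. ?c (inv h \<circ> ((h \<circ> g) \<circ> h)) * f (h \<circ> g))"
      by (rule sum_permutes_shift(1)[OF h, symmetric])
    also have "\<dots> = (\<Sum>g\<in>?G. ?c (inv h \<circ> ((h \<circ> (g \<circ> inv h)) \<circ> h)) * f (h \<circ> (g \<circ> inv h)))"
      by (rule sum_permutes_shift(2)[OF permutes_inv[OF h], symmetric])
    also have "\<dots> = (\<Sum>g\<in>?G. ?c g * f g)"
    proof (rule sum.cong[OF refl])
      fix g assume "g \<in> ?G"
      hence "f (h \<circ> (g \<circ> inv h)) = f g" using f[OF h] by simp
      moreover have "inv h \<circ> ((h \<circ> (g \<circ> inv h)) \<circ> h) = g"
        by (simp only: comp_assoc permutes_comp_inv_cancel[OF h] comp_id)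
      ultimately show "?c (inv h \<circ> ((h \<circ> (g \<circ> inv h)) \<circ> h)) * f (h \<circ> (g \<circ> inv h)) = ?c g * f g"
        by (simp only:)
    qed
    finally show "(\<Sum>g\<in>?G. ?c (inv h \<circ> (g \<circ> h)) * f g) = (\<Sum>g\<in>?G. ?c g * f g)" .
  qed
  also have "\<dots> = of_nat (card ?G) * (\<Sum>g\<in>?G. ?c g * f g)" by simp
  also have "card ?G = fact (card (young_diagram \<rho>))"
    by (rule card_permutations[OF refl]) simp
  finally show ?thesis .
qed

lemma conj_sum_conj:
  assumes h: "h permutes young_diagram \<rho>" and g: "g permutes young_diagram \<rho>"
  shows "conj_sum \<rho> (h \<circ> (g \<circ> inv h)) = conj_sum \<rho> g"
proof -
  let ?G = "{g. g permutes young_diagram \<rho>}" and ?c = "young_symmetrizer \<rho>"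
  have "conj_sum \<rho> (h \<circ> (g \<circ> inv h)) =
      (\<Sum>k\<in>?G. ?c (inv (h \<circ> k) \<circ> ((h \<circ> (g \<circ> inv h)) \<circ> (h \<circ> k))))"
    unfolding conj_sum_def by (rule sum_permutes_shift(1)[OF h, symmetric])
  also have "\<dots> = conj_sum \<rho> g"
    unfolding conj_sum_def
  proof (rule sum.cong[OF refl])
    fix k assume "k \<in> ?G"
    hence "inv (h \<circ> k) = inv k \<circ> inv h" using permutes_inv_comp[OF h] by simp
    hence "inv (h \<circ> k) \<circ> ((h \<circ> (g \<circ> inv h)) \<circ> (h \<circ> k)) = inv k \<circ> (g \<circ> k)"
      by (simp only: comp_assoc permutes_comp_inv_cancel[OF h])
    thus "?c (inv (h \<circ> k) \<circ> ((h \<circ> (g \<circ> inv h)) \<circ> (h \<circ> k))) = ?c (inv k \<circ> (g \<circ> k))"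
      by (simp only:)
  qed
  finally show ?thesis .
qed

text \<open>One of the two conjugations is absorbed by the other. The inner sum that remains is the
  value of c h c at h, where c h c is a multiple of c. The multiple is k times the value of c at the
  inverse of h, and summing over h gives the value k of c c at the identity once more.\<close>

lemma conj_sum_norm:
  assumes \<rho>: "\<rho> \<in> partitions n"
  shows "(\<Sum>g | g permutes young_diagram \<rho>. (conj_sum \<rho> g)\<^sup>2) =
    of_nat (fact (card (young_diagram \<rho>))) * (young_const \<rho>)\<^sup>2"
proof -
  let ?Y = "young_diagram \<rho>" and ?c = "young_symmetrizer \<rho>" and ?k = "young_const \<rho>"
  let ?G = "{g. g permutes ?Y}"
  have fin: "finite ?Y" by simp
  have "(\<Sum>g\<in>?G. (conj_sum \<rho> g)\<^sup>2) = (\<Sum>g\<in>?G. conj_sum \<rho> g * conj_sum \<rho> g)"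
    by (simp only: power2_eq_square)
  also have "\<dots> = of_nat (fact (card ?Y)) * (\<Sum>g\<in>?G. ?c g * conj_sum \<rho> g)"
    by (rule sum_conj_sum) (rule conj_sum_conj)
  also have "(\<Sum>g\<in>?G. ?c g * conj_sum \<rho> g) = (\<Sum>g\<in>?G. ?c g * conj_sum \<rho> (inv g))"
    by (rule sum.cong[OF refl]) (simp add: conj_sum_inv)
  also have "\<dots> = (\<Sum>h\<in>?G. \<Sum>g\<in>?G. ?c g * ?c (inv h \<circ> (inv g \<circ> h)))"
    unfolding conj_sum_def sum_distrib_left by (rule sum.swap)
  also have "\<dots> = (\<Sum>h\<in>?G. ?k * (?c h * ?c (inv h)))"
  proof (rule sum.cong[OF refl])
    fix h assume "h \<in> ?G"
    hence h: "h permutes ?Y" by simp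
    let ?x = "conv ?Y (perm_elem h) ?c"
    have "(\<Sum>g\<in>?G. ?c g * ?c (inv h \<circ> (inv g \<circ> h))) = conv ?Y ?c ?x h"
      unfolding conv_perm_elem_left[OF fin h] by (simp add: conv_def)
    also have "\<dots> = conv ?Y ?c ?x id * ?c h"
      using fun_cong[OF young_symmetrizer_sandwich[OF \<rho>, of "perm_elem h"], of h]
      by (simp add: cfun_scale_def)
    also have "conv ?Y ?c ?x id = (\<Sum>g\<in>?G. ?c g * ?c (inv h \<circ> inv g))"
      unfolding conv_perm_elem_left[OF fin h] by (simp add: conv_def)
    also have "\<dots> = (\<Sum>g\<in>?G. ?c (inv g) * ?c (inv h \<circ> inv (inv g)))"
      by (rule sum_permutes_inv[symmetric])
    also have "\<dots> = (\<Sum>g\<in>?G. ?c (inv (h \<circ> g)) * ?c (inv h \<circ> inv (inv (h \<circ> g))))"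
      by (rule sum_permutes_shift(1)[OF h, symmetric])
    also have "\<dots> = (\<Sum>g\<in>?G. ?c g * ?c (inv g \<circ> inv h))"
    proof (rule sum.cong[OF refl])
      fix g assume "g \<in> ?G"
      hence g: "g permutes ?Y" by simp
      have "inv (h \<circ> g) = inv g \<circ> inv h" "inv (inv (h \<circ> g)) = h \<circ> g"
        using permutes_inv_comp[OF h g] permutes_inv_inv[OF permutes_compose[OF g h]] by auto
      thus "?c (inv (h \<circ> g)) * ?c (inv h \<circ> inv (inv (h \<circ> g))) = ?c g * ?c (inv g \<circ> inv h)"
        by (simp only: permutes_comp_inv_cancel(1)[OF h] mult.commute)
    qed
    also have "\<dots> = conv ?Y ?c ?c (inv h)" by (simp add: conv_def)
    also have "\<dots> = ?k * ?c (inv h)"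
      by (simp add: young_symmetrizer_square[OF \<rho>] cfun_scale_def)
    finally show "(\<Sum>g\<in>?G. ?c g * ?c (inv h \<circ> (inv g \<circ> h))) = ?k * (?c h * ?c (inv h))"
      by (simp only: mult_ac)
  qed
  also have "\<dots> = ?k * conv ?Y ?c ?c id" by (simp add: conv_def sum_distrib_left)
  also have "conv ?Y ?c ?c id = ?k" by (simp add: young_const_def)
  finally show ?thesis by (simp only: power2_eq_square)
qed

section \<open>Pairing Young symmetrizers with permutation characters\<close>

lemma fixed_count_conj:
  assumes h: "h permutes Y"
  shows "fixed_count Y N (h \<circ> (g \<circ> inv h)) \<mu> = fixed_count Y N g \<mu>"
  unfolding fixed_count_def
proof (rule bij_betw_same_card[of "\<lambda>F. F \<circ> h"], rule bij_betwI[of _ _ _ "\<lambda>F. F \<circ> inv h"])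
  note c = permutes_comp_inv_cancel[OF h] and inv = permutes_inv[OF h]
  show "(\<lambda>F. F \<circ> h) \<in> {F \<in> inv_maps Y {..<N} (h \<circ> (g \<circ> inv h)). occ Y F = \<mu>} \<rightarrow>
      {F \<in> inv_maps Y {..<N} g. occ Y F = \<mu>}"
  proof (rule funcsetI)
    fix F assume "F \<in> {F \<in> inv_maps Y {..<N} (h \<circ> (g \<circ> inv h)). occ Y F = \<mu>}"
    hence F: "F \<in> Y \<rightarrow>\<^sub>E {..<N}" "F \<circ> (h \<circ> (g \<circ> inv h)) = F" "occ Y F = \<mu>"
      by (auto simp: inv_maps_def)
    have "F \<circ> h = F \<circ> (h \<circ> (g \<circ> inv h)) \<circ> h" by (simp only: F(2))
    also have "\<dots> = F \<circ> h \<circ> g" by (simp only: comp_assoc c comp_id)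
    finally show "F \<circ> h \<in> {F \<in> inv_maps Y {..<N} g. occ Y F = \<mu>}"
      using comp_in_PiE[OF F(1) h] F(3) by (simp add: inv_maps_def occ_comp[OF h])
  qed
  show "(\<lambda>F. F \<circ> inv h) \<in> {F \<in> inv_maps Y {..<N} g. occ Y F = \<mu>} \<rightarrow>
      {F \<in> inv_maps Y {..<N} (h \<circ> (g \<circ> inv h)). occ Y F = \<mu>}"
  proof (rule funcsetI)
    fix F assume "F \<in> {F \<in> inv_maps Y {..<N} g. occ Y F = \<mu>}"
    hence F: "F \<in> Y \<rightarrow>\<^sub>E {..<N}" "F \<circ> g = F" "occ Y F = \<mu>"
      by (auto simp: inv_maps_def)
    have "F \<circ> inv h \<circ> (h \<circ> (g \<circ> inv h)) = F \<circ> g \<circ> inv h" by (simp only: comp_assoc c comp_id)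
    also have "\<dots> = F \<circ> inv h" by (simp only: F(2))
    finally show "F \<circ> inv h \<in> {F \<in> inv_maps Y {..<N} (h \<circ> (g \<circ> inv h)). occ Y F = \<mu>}"
      using comp_in_PiE[OF F(1) inv] F(3) by (simp add: inv_maps_def occ_comp[OF inv])
  qed
qed (simp_all only: comp_assoc permutes_comp_inv_cancel[OF h] comp_id)

lemma sum_occ_lessThan:
  fixes F :: "'a \<Rightarrow> nat"
  assumes "finite Y"
  shows "(\<Sum>i<v. occ Y F i) = card {y \<in> Y. F y < v}"
proof -
  have "{y \<in> Y. F y < v} = (\<Union>i<v. {y \<in> Y. F y = i})" by auto
  thus ?thesis unfolding occ_def using assms by (simp only:) (rule card_UN_disjoint[symmetric], auto)
qed

text \<open>A map F fixed by h s is encoded by the filling u = F h, for which u s equals u after the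
  inverse of h. If u repeats an entry within a column, the transposition of the two squares leaves u
  unchanged and flips the sign of s, so the contributions of u cancel.\<close>

lemma young_symmetrizer_pairing:
  fixes \<mu> :: "nat \<Rightarrow> nat"
  defines "E \<equiv> \<lambda>Y N. {F \<in> Y \<rightarrow>\<^sub>E {..<N}. occ Y F = \<mu>}"
  shows "(\<Sum>g | g permutes young_diagram \<rho>. young_symmetrizer \<rho> g * of_nat (fixed_count (young_diagram \<rho>) N g \<mu>)) =
    (\<Sum>u | u \<in> E (young_diagram \<rho>) N \<and> column_injective \<rho> u. \<Sum>h\<in>row_group \<rho>. \<Sum>s\<in>column_group \<rho>.
       if u \<circ> s = u \<circ> h then of_int (sign s) else 0)" (is "?L = ?R")
proof -
  let ?Y = "young_diagram \<rho>"
  let ?E = "E ?Y N"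
  have fin: "finite ?E"
    unfolding E_def by (rule finite_subset[of _ "?Y \<rightarrow>\<^sub>E {..<N}"]) (auto intro!: finite_PiE)
  have "?L = (\<Sum>h\<in>row_group \<rho>. \<Sum>s\<in>column_group \<rho>. of_int (sign s) * of_nat (fixed_count ?Y N (h \<circ> s) \<mu>))"
    by (rule sum_young_symmetrizer)
  also have "\<dots> = (\<Sum>h\<in>row_group \<rho>. \<Sum>s\<in>column_group \<rho>. \<Sum>u\<in>?E. if u \<circ> s = u \<circ> inv h then of_int (sign s) else 0)"
  proof (rule sum.cong[OF refl], rule sum.cong[OF refl])
    fix h s assume h: "h \<in> row_group \<rho>" and s: "s \<in> column_group \<rho>"
    note hp = row_group_permutes[OF h]
    note c = permutes_comp_inv_cancel[OF hp]
    have "{F \<in> inv_maps ?Y {..<N} (h \<circ> s). occ ?Y F = \<mu>} = {F \<in> ?E. F \<circ> (h \<circ> s) = F}"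
      by (auto simp: inv_maps_def E_def)
    also have "card \<dots> = card {u \<in> ?E. u \<circ> s = u \<circ> inv h}"
    proof (rule bij_betw_same_card[of "\<lambda>F. F \<circ> h"], rule bij_betwI[of _ _ _ "\<lambda>F. F \<circ> inv h"])
      show "(\<lambda>F. F \<circ> h) \<in> {F \<in> ?E. F \<circ> (h \<circ> s) = F} \<rightarrow> {u \<in> ?E. u \<circ> s = u \<circ> inv h}"
      proof (rule funcsetI)
        fix F assume F: "F \<in> {F \<in> ?E. F \<circ> (h \<circ> s) = F}"
        have "F \<circ> h \<circ> inv h = F" by (rule c(3))
        moreover have "F \<circ> h \<circ> s = F" using F by (simp add: comp_assoc)
        ultimately show "F \<circ> h \<in> {u \<in> ?E. u \<circ> s = u \<circ> inv h}"
          using F comp_in_PiE[OF _ hp, of F "{..<N}"] by (simp add: E_def occ_comp[OF hp])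
      qed
      show "(\<lambda>F. F \<circ> inv h) \<in> {u \<in> ?E. u \<circ> s = u \<circ> inv h} \<rightarrow> {F \<in> ?E. F \<circ> (h \<circ> s) = F}"
      proof (rule funcsetI)
        fix F assume F: "F \<in> {u \<in> ?E. u \<circ> s = u \<circ> inv h}"
        have "F \<circ> inv h \<circ> (h \<circ> s) = F \<circ> s" by (simp only: comp_assoc c)
        thus "F \<circ> inv h \<in> {F \<in> ?E. F \<circ> (h \<circ> s) = F}"
          using F comp_in_PiE[OF _ permutes_inv[OF hp], of F "{..<N}"]
          by (simp add: E_def occ_comp[OF permutes_inv[OF hp]])
      qed
    qed (simp_all only: c)
    finally have "fixed_count ?Y N (h \<circ> s) \<mu> = card {u \<in> ?E. u \<circ> s = u \<circ> inv h}"
      by (simp only: fixed_count_def)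
    thus "of_int (sign s) * of_nat (fixed_count ?Y N (h \<circ> s) \<mu>) =
        (\<Sum>u\<in>?E. if u \<circ> s = u \<circ> inv h then of_int (sign s) else (0 :: complex))"
      using fin by (simp add: sum.inter_filter[symmetric])
  qed
  also have "\<dots> = (\<Sum>h\<in>row_group \<rho>. \<Sum>s\<in>column_group \<rho>. \<Sum>u\<in>?E. if u \<circ> s = u \<circ> h then of_int (sign s) else 0)"
    by (rule sum_row_group_inv[where f = "\<lambda>h. \<Sum>s\<in>column_group \<rho>. \<Sum>u\<in>?E. if u \<circ> s = u \<circ> h then of_int (sign s) else 0"])
  also have "\<dots> = (\<Sum>h\<in>row_group \<rho>. \<Sum>u\<in>?E. \<Sum>s\<in>column_group \<rho>. if u \<circ> s = u \<circ> h then of_int (sign s) else 0)"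
    by (rule sum.cong[OF refl]) (rule sum.swap)
  also have "\<dots> = (\<Sum>u\<in>?E. \<Sum>h\<in>row_group \<rho>. \<Sum>s\<in>column_group \<rho>. if u \<circ> s = u \<circ> h then of_int (sign s) else 0)"
    by (rule sum.swap)
  also have "\<dots> = ?R"
  proof (rule sum.mono_neutral_right[OF fin])
    show "\<forall>u\<in>?E - {u. u \<in> ?E \<and> column_injective \<rho> u}.
        (\<Sum>h\<in>row_group \<rho>. \<Sum>s\<in>column_group \<rho>. if u \<circ> s = u \<circ> h then of_int (sign s) else 0) = (0 :: complex)"
    proof
      fix u assume "u \<in> ?E - {u. u \<in> ?E \<and> column_injective \<rho> u}"
      then obtain e e' where e: "e \<in> ?Y" "e' \<in> ?Y" "snd e = snd e'" "u e = u e'" "e \<noteq> e'"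
        by (auto simp: column_injective_def)
      let ?t = "Transposition.transpose e e'"
      have t: "?t \<in> column_group \<rho>"
        using permutes_swap_id[OF e(1,2)] e(3)
        by (simp add: column_group_def Transposition.transpose_def del: split_paired_All)
      have ut: "u \<circ> ?t = u" using e(4) by (intro ext) (simp add: Transposition.transpose_def)
      have "(\<Sum>s\<in>column_group \<rho>. if u \<circ> s = u \<circ> h then of_int (sign s) else 0) = (0 :: complex)" for h
      proof -
        let ?f = "\<lambda>s. if u \<circ> s = u \<circ> h then of_int (sign s) else (0 :: complex)"
        have "(\<Sum>s\<in>column_group \<rho>. ?f s) = (\<Sum>s\<in>column_group \<rho>. ?f (?t \<circ> s))"
          by (rule sum_column_group_shift[OF t, symmetric])
        also have "\<dots> = (\<Sum>s\<in>column_group \<rho>. - ?f s)"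
        proof (rule sum.cong[OF refl])
          fix s assume "s \<in> column_group \<rho>"
          hence "sign (?t \<circ> s) = - sign s"
            using sign_comp[OF finite_young_diagram column_group_permutes[OF t] column_group_permutes] e(5)
            by (simp add: sign_swap_id)
          moreover have "u \<circ> (?t \<circ> s) = u \<circ> s" by (simp only: o_assoc ut)
          ultimately show "?f (?t \<circ> s) = - ?f s" by (simp only: of_int_minus) simp
        qed
        finally show ?thesis by (simp add: sum_negf)
      qed
      thus "(\<Sum>h\<in>row_group \<rho>. \<Sum>s\<in>column_group \<rho>. if u \<circ> s = u \<circ> h then of_int (sign s) else 0) = (0 :: complex)"
        by simp
    qed
  qed auto
  finally show ?thesis .
qed

text \<open>A nonzero pairing requires at least one filling of content \<mu> with distinct entries
  in each column.\<close>

lemma young_symmetrizer_pairing_dominance: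
  assumes \<rho>: "\<rho> \<in> partitions n"
    and nz: "(\<Sum>g | g permutes young_diagram \<rho>. young_symmetrizer \<rho> g * of_nat (fixed_count (young_diagram \<rho>) N g \<mu>)) \<noteq> 0"
  shows "(\<Sum>i<v. \<mu> i) \<le> (\<Sum>i<v. prow \<rho> i)"
proof -
  obtain u where "column_injective \<rho> u" "occ (young_diagram \<rho>) u = \<mu>"
    using nz unfolding young_symmetrizer_pairing by (auto elim: sum.not_neutral_contains_not_neutral)
  thus ?thesis
    using column_injective_dominance[OF \<rho>, of u v] sum_occ_lessThan[OF finite_young_diagram[of \<rho>], of u v]
    by simp
qed

text \<open>The fillings that contribute are the column rearrangements of the filling
  \<open>u0\<close> by row numbers. As \<open>u0\<close> sees only rows, the condition on s and h
  becomes membership in the row group, and the triple sum collapses to the value of c c at the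
  identity.\<close>

lemma young_symmetrizer_pairing_self:
  assumes \<rho>: "\<rho> \<in> partitions n" and N: "length \<rho> \<le> N"
  shows "(\<Sum>g | g permutes young_diagram \<rho>. young_symmetrizer \<rho> g *
      of_nat (fixed_count (young_diagram \<rho>) N g (prow \<rho>))) = young_const \<rho>"
proof -
  let ?Y = "young_diagram \<rho>" and ?C = "column_group \<rho>" and ?R = "row_group \<rho>" and ?c = "young_symmetrizer \<rho>"
  let ?E = "{u. u \<in> {F \<in> ?Y \<rightarrow>\<^sub>E {..<N}. occ ?Y F = prow \<rho>} \<and> column_injective \<rho> u}"
  define u0 where "u0 = (\<lambda>e\<in>?Y. fst e - 1)"
  have pos: "1 \<le> fst e" "fst e \<le> length \<rho>" if "e \<in> ?Y" for e
    using that by (auto simp: young_diagram_def)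
  have u0E: "u0 \<in> ?Y \<rightarrow>\<^sub>E {..<N}"
    using pos N by (force simp: u0_def)
  have occ0: "occ ?Y u0 = prow \<rho>"
  proof
    fix i
    have c: "card {e \<in> ?Y. u0 e < v} = (\<Sum>i<v. prow \<rho> i)" for v
    proof -
      have "{e \<in> ?Y. u0 e < v} = {e \<in> ?Y. fst e \<le> v}"
        using pos by (force simp: u0_def)
      thus ?thesis by (simp only: card_young_diagram_rows)
    qed
    show "occ ?Y u0 i = prow \<rho> i"
      using c[of i] c[of "Suc i"] sum_occ_lessThan[OF finite_young_diagram[of \<rho>], of u0 i]
        sum_occ_lessThan[OF finite_young_diagram[of \<rho>], of u0 "Suc i"] by simp
  qed
  have u0_iff: "u0 \<circ> x = u0 \<circ> y \<longleftrightarrow> y \<circ> inv x \<in> ?R" if x: "x permutes ?Y" and y: "y permutes ?Y" for x y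
  proof -
    have "u0 \<circ> x = u0 \<circ> y \<longleftrightarrow> u0 \<circ> (y \<circ> inv x) = u0"
      using permutes_comp_inv_cancel[OF x] by (metis comp_assoc comp_id)
    also have "\<dots> \<longleftrightarrow> y \<circ> inv x \<in> ?R"
    proof -
      have z: "y \<circ> inv x permutes ?Y" (is "?z permutes _") by (rule permutes_compose[OF permutes_inv[OF x] y])
      have "u0 (?z e) = u0 e \<longleftrightarrow> fst (?z e) = fst e" for e
      proof (cases "e \<in> ?Y")
        case True
        hence "?z e \<in> ?Y" using permutes_in_image[OF z] by blast
        thus ?thesis using True pos(1)[of e] pos(1)[of "?z e"] by (simp add: u0_def) linarith
      next
        case False
        thus ?thesis using permutes_not_in[OF z False] by (simp only: refl)
      qed
      thus ?thesis using z by (simp add: row_group_def fun_eq_iff del: split_paired_All)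
    qed
    finally show ?thesis .
  qed
  have bij: "bij_betw (\<lambda>s. u0 \<circ> s) ?C ?E"
    unfolding bij_betw_def
  proof (intro conjI inj_onI equalityI subsetI)
    fix s s' assume s: "s \<in> ?C" "s' \<in> ?C" "u0 \<circ> s = u0 \<circ> s'"
    have "s' \<circ> inv s \<in> ?R"
      using u0_iff[OF column_group_permutes[OF s(1)] column_group_permutes[OF s(2)]] s(3) by blast
    moreover have "s' \<circ> inv s \<in> ?C" using s by (intro column_group_comp column_group_inv)
    ultimately have "s' \<circ> inv s = id" by (rule row_column_group_Int)
    hence "s' \<circ> inv s \<circ> s = s" by simp
    thus "s = s'" by (simp only: permutes_comp_inv_cancel(4)[OF column_group_permutes[OF s(1)]])
  next
    fix u assume "u \<in> (\<lambda>s. u0 \<circ> s) ` ?C"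
    then obtain s where s: "s \<in> ?C" "u = u0 \<circ> s" by blast
    note sp = column_group_permutes[OF s(1)]
    have "column_injective \<rho> (u0 \<circ> s)"
      unfolding column_injective_def
    proof (intro ballI impI)
      fix e e' assume e: "e \<in> ?Y" "e' \<in> ?Y" "snd e = snd e'" "(u0 \<circ> s) e = (u0 \<circ> s) e'"
      have "s e \<in> ?Y" "s e' \<in> ?Y" using e permutes_in_image[OF sp] by auto
      hence "fst (s e) = fst (s e')" using e(4) pos(1)[of "s e"] pos(1)[of "s e'"] by (simp add: u0_def)
      moreover have "snd (s e) = snd (s e')" using s(1) e(3) by (simp add: column_group_def del: split_paired_All)
      ultimately have "s e = s e'" by (rule prod_eqI)
      thus "e = e'" using permutes_inj[OF sp] by (simp add: inj_eq)
    qed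
    thus "u \<in> ?E"
      using comp_in_PiE[OF u0E sp] occ_comp[OF sp, of u0] by (simp add: s(2) occ0)
  next
    fix u assume u: "u \<in> ?E"
    obtain s where s: "s \<in> ?C" "\<And>e. e \<in> ?Y \<Longrightarrow> fst (s e) = Suc (u e)"
    proof (rule column_injective_standard[OF \<rho>])
      show "column_injective \<rho> u" using u by blast
      show "card {e \<in> ?Y. u e < v} = (\<Sum>i<v. prow \<rho> i)" for v
        using u sum_occ_lessThan[OF finite_young_diagram[of \<rho>], of u v] by simp
    qed blast
    note sp = column_group_permutes[OF s(1)]
    have "u = u0 \<circ> s"
    proof
      fix e show "u e = (u0 \<circ> s) e"
      proof (cases "e \<in> ?Y")
        case True
        hence "s e \<in> ?Y" using permutes_in_image[OF sp] by blast
        thus ?thesis using s(2)[OF True] by (simp add: u0_def)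
      next
        case False
        thus ?thesis
          using PiE_arb[of u ?Y "\<lambda>_. {..<N}" e] u permutes_not_in[OF sp, of e] by (simp add: u0_def)
      qed
    qed
    thus "u \<in> (\<lambda>s. u0 \<circ> s) ` ?C" using s(1) by blast
  qed
  have "(\<Sum>g | g permutes ?Y. ?c g * of_nat (fixed_count ?Y N g (prow \<rho>))) =
      (\<Sum>s0\<in>?C. \<Sum>h\<in>?R. \<Sum>s\<in>?C. if u0 \<circ> s0 \<circ> s = u0 \<circ> s0 \<circ> h then of_int (sign s) else 0)"
    unfolding young_symmetrizer_pairing by (rule sum.reindex_bij_betw[OF bij, symmetric])
  also have "\<dots> = (\<Sum>s0\<in>?C. \<Sum>h\<in>?R. of_int (sign s0) * ?c (s0 \<circ> h))"
  proof (rule sum.cong[OF refl], rule sum.cong[OF refl])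
    fix s0 h assume s0: "s0 \<in> ?C" and h: "h \<in> ?R"
    note sp = column_group_permutes[OF s0] and hp = row_group_permutes[OF h]
    have gp: "s0 \<circ> h permutes ?Y" by (rule permutes_compose[OF hp sp])
    \<comment> \<open>The sign of s is the product of those of s0 and s0 s. After a shift by s0, the
      sum over s is the expansion of the symmetrizer at s0 h along the column group.\<close>
    let ?f = "\<lambda>s. of_int (sign s0) * (of_int (sign s) * row_elem \<rho> ((s0 \<circ> h) \<circ> inv s))"
    have "(\<Sum>s\<in>?C. if u0 \<circ> s0 \<circ> s = u0 \<circ> s0 \<circ> h then of_int (sign s) else 0) = (\<Sum>s\<in>?C. ?f (s0 \<circ> s))"
    proof (rule sum.cong[OF refl])
      fix s assume "s \<in> ?C"
      hence s: "s permutes ?Y" by (rule column_group_permutes)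
      have "sign (s0 \<circ> s) = sign s0 * sign s" by (rule sign_comp[OF finite_young_diagram sp s])
      moreover have "u0 \<circ> s0 \<circ> s = u0 \<circ> s0 \<circ> h \<longleftrightarrow> (s0 \<circ> h) \<circ> inv (s0 \<circ> s) \<in> ?R"
        unfolding comp_assoc[of u0] by (rule u0_iff[OF permutes_compose[OF s sp] gp])
      ultimately show "(if u0 \<circ> s0 \<circ> s = u0 \<circ> s0 \<circ> h then of_int (sign s) else 0) = ?f (s0 \<circ> s)"
        by (simp add: row_elem_def sign_sign mult.assoc)
    qed
    also have "\<dots> = (\<Sum>s\<in>?C. ?f s)" by (rule sum_column_group_shift[OF s0])
    also have "\<dots> = of_int (sign s0) * ?c (s0 \<circ> h)"
      unfolding young_symmetrizer_columns[OF gp] sum_distrib_left ..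
    finally show "(\<Sum>s\<in>?C. if u0 \<circ> s0 \<circ> s = u0 \<circ> s0 \<circ> h then of_int (sign s) else 0) =
        of_int (sign s0) * ?c (s0 \<circ> h)" .
  qed
  also have "\<dots> = (\<Sum>h\<in>?R. \<Sum>s0\<in>?C. of_int (sign s0) * ?c (s0 \<circ> h))"
    by (rule sum.swap)
  also have "\<dots> = (\<Sum>h\<in>?R. \<Sum>s0\<in>?C. of_int (sign s0) * ?c (s0 \<circ> inv h))"
    by (rule sum_row_group_inv[symmetric])
  also have "\<dots> = (\<Sum>h\<in>?R. \<Sum>s\<in>?C. of_int (sign s) * ?c (inv (h \<circ> s)))"
  proof (rule sum.cong[OF refl])
    fix h assume "h \<in> ?R"
    hence hp: "h permutes ?Y" by (rule row_group_permutes)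
    have "(\<Sum>s0\<in>?C. of_int (sign s0) * ?c (s0 \<circ> inv h)) = (\<Sum>s\<in>?C. of_int (sign (inv s)) * ?c (inv s \<circ> inv h))"
      by (rule sum_column_group_inv[symmetric])
    also have "\<dots> = (\<Sum>s\<in>?C. of_int (sign s) * ?c (inv (h \<circ> s)))"
      by (rule sum.cong[OF refl])
         (simp add: sign_inv_permutes[OF finite_young_diagram column_group_permutes]
           permutes_inv_comp[OF hp column_group_permutes])
    finally show "(\<Sum>s0\<in>?C. of_int (sign s0) * ?c (s0 \<circ> inv h)) = (\<Sum>s\<in>?C. of_int (sign s) * ?c (inv (h \<circ> s)))" .
  qed
  also have "\<dots> = (\<Sum>g | g permutes ?Y. ?c g * ?c (inv g))"
    by (rule sum_young_symmetrizer[symmetric])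
  also have "\<dots> = young_const \<rho>" by (simp add: young_const_def conv_def)
  finally show ?thesis .
qed

lemma irr_character_eq_alt_char:
  assumes \<rho>: "\<rho> \<in> partitions n" and N: "length \<rho> \<le> N" and g: "g permutes young_diagram \<rho>"
  shows "irr_character \<rho> g = of_int (alt_char (young_diagram \<rho>) N (beta N \<rho>) g)"
proof -
  let ?Y = "young_diagram \<rho>" and ?k = "young_const \<rho>"
  let ?G = "{g. g permutes ?Y}"
  let ?F = "of_nat (fact n) :: complex"
  define ch where "ch = (\<lambda>g. conj_sum \<rho> g / ?k)"
  define phi where "phi = (\<lambda>g. of_int (alt_char ?Y N (beta N \<rho>) g) :: complex)"
  have k: "?k \<noteq> 0" by (rule young_const_nonzero[OF \<rho>])
  have card: "card ?Y = n" by (rule card_young_diagram[OF \<rho>])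
  have \<beta>: "beta N \<rho> = (\<lambda>i. prow \<rho> i + delta N i)" by (simp add: fun_eq_iff beta_eq)
  have w: "prow \<rho> \<in> weights N n"
    using sum_prow[OF \<rho> N] N by (auto simp: weights_def prow_def)
  have dec: "strict_dec N (\<lambda>i. prow \<rho> i + delta N i)"
    using beta_strict[OF \<rho>] by (simp add: strict_dec_def flip: \<beta>)
  have pair: "(\<Sum>g\<in>?G. ch g * of_nat (fixed_count ?Y N g \<mu>)) =
      ?F / ?k * (\<Sum>g\<in>?G. young_symmetrizer \<rho> g * of_nat (fixed_count ?Y N g \<mu>))" for \<mu>
  proof -
    have "(\<Sum>g\<in>?G. conj_sum \<rho> g * of_nat (fixed_count ?Y N g \<mu>)) =
        of_nat (fact (card ?Y)) * (\<Sum>g\<in>?G. young_symmetrizer \<rho> g * of_nat (fixed_count ?Y N g \<mu>))"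
      by (rule sum_conj_sum) (simp add: fixed_count_conj)
    thus ?thesis by (simp add: ch_def card sum_divide_distrib[symmetric])
  qed
  have ch_phi: "(\<Sum>g\<in>?G. ch g * phi g) = ?F"
  proof -
    have "(\<Sum>g\<in>?G. ch g * phi g) = (\<Sum>g\<in>?G. ch g * of_nat (fixed_count ?Y N g (prow \<rho>)))"
      unfolding phi_def \<beta>
    proof (rule alt_char_pairing[OF finite_young_diagram w])
      fix \<mu> v assume "(\<Sum>g\<in>?G. ch g * of_nat (fixed_count ?Y N g \<mu>)) \<noteq> 0"
      thus "(\<Sum>u<v. \<mu> u) \<le> (\<Sum>u<v. prow \<rho> u)"
        unfolding pair by (intro young_symmetrizer_pairing_dominance[OF \<rho>]) auto
    qed
    \<comment> \<open>The denominator k of the character cancels against the pairing of the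
      symmetrizer, which is k.\<close>
    thus ?thesis using k by (simp add: pair young_symmetrizer_pairing_self[OF \<rho> N])
  qed
  have phi_phi: "(\<Sum>g\<in>?G. (phi g)\<^sup>2) = ?F"
    using alt_char_norm[OF finite_young_diagram, of "prow \<rho>" N \<rho>] w dec by (simp add: phi_def \<beta> card)
  have ch_ch: "(\<Sum>g\<in>?G. (ch g)\<^sup>2) = ?F"
    using conj_sum_norm[OF \<rho>] k by (simp add: ch_def power_divide card sum_divide_distrib[symmetric])
  have "(\<Sum>g\<in>?G. (ch g - phi g)\<^sup>2) = (\<Sum>g\<in>?G. (ch g)\<^sup>2) + (\<Sum>g\<in>?G. (phi g)\<^sup>2) - 2 * (\<Sum>g\<in>?G. ch g * phi g)"
    by (simp add: power2_diff sum.distrib sum_subtractf sum_distrib_left mult.assoc)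
  hence "(\<Sum>g\<in>?G. (ch g - phi g)\<^sup>2) = 0" by (simp add: ch_phi phi_phi ch_ch)
  moreover have "ch g - phi g \<in> \<real>" for g
    unfolding ch_def phi_def conj_sum_def young_const_def conv_def
    using young_symmetrizer_real by (intro Reals_diff Reals_divide sum_in_Reals Reals_mult) auto
  ultimately have "ch g - phi g = 0"
    using g by (intro sum_real_squares_eq_0[of ?G "\<lambda>g. ch g - phi g"]) (auto intro: finite_permutations)
  thus ?thesis
    by (simp add: irr_character_eq[OF \<rho> g] ch_def phi_def)
qed

section \<open>Cycle types\<close>

text \<open>The powers of the cycle along a list rotate the list, so that the orbit of its first
  entry runs through all entries.\<close>

lemma ex_cyclic_on:
  assumes "finite A" "A \<noteq> {}"
  obtains c where "c permutes A" "cyclic_on c A"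
proof -
  obtain xs where xs: "set xs = A" "distinct xs"
    using finite_distinct_list[OF assms(1)] by blast
  define c where "c = cycle_of_list xs"
  have ne: "0 < length xs" using xs(1) assms(2) by auto
  have pow: "(c ^^ n) (xs ! 0) = xs ! (n mod length xs)" for n
  proof -
    have "(c ^^ n) (xs ! 0) = map (c ^^ n) xs ! 0" using ne by simp
    also have "\<dots> = rotate n xs ! 0" unfolding c_def by (simp only: cyclic_rotation[OF xs(2)])
    also have "\<dots> = xs ! (n mod length xs)" using ne by (simp add: nth_rotate)
    finally show ?thesis .
  qed
  have "orbit c (xs ! 0) = A"
  proof (intro equalityI subsetI)
    fix x assume "x \<in> orbit c (xs ! 0)"
    then obtain n where "x = xs ! (n mod length xs)" by (auto simp: orbit_altdef pow)
    thus "x \<in> A" using ne xs(1) by (auto intro!: nth_mem)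
  next
    fix x assume "x \<in> A"
    then obtain i where i: "i < length xs" "x = xs ! i" using xs(1) by (auto simp: in_set_conv_nth)
    \<comment> \<open>Orbits consist of positive iterates; adding one full turn covers the starting
      point as well.\<close>
    have "x = (c ^^ (i + length xs)) (xs ! 0)" using i unfolding pow by simp
    thus "x \<in> orbit c (xs ! 0)" using ne unfolding orbit_altdef by blast
  qed
  moreover have "xs ! 0 \<in> A" using ne xs(1) nth_mem by blast
  ultimately have "cyclic_on c A" by (intro cyclic_on_singleI[of "xs ! 0"]) simp_all
  moreover have "c permutes A" using cycle_permutes[of xs] xs(1) by (simp add: c_def)
  ultimately show ?thesis using that by blast
qed

text \<open>A cycle is placed on some d elements and the remaining parts are realized on the
  complement. As the supports are disjoint, the orbits of the product are those of its
  factors.\<close>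

lemma ex_cycle_type:
  assumes "finite Y" "sum_list \<eta> = card Y" "0 \<notin> set \<eta>"
  shows "\<exists>g. g permutes Y \<and> cycle_type Y g = mset \<eta>"
  using assms
proof (induction \<eta> arbitrary: Y)
  case Nil
  hence "Y = {}" by simp
  thus ?case by (intro exI[of _ id]) (auto simp: cycle_type_def permutes_id)
next
  case (Cons d \<eta>)
  have "d \<le> card Y" using Cons.prems by simp
  then obtain A where A: "A \<subseteq> Y" "card A = d" by (rule obtain_subset_with_card_n)
  let ?B = "Y - A"
  have finA: "finite A" using A(1) Cons.prems(1) by (rule finite_subset)
  have neA: "A \<noteq> {}" using A(2) Cons.prems(3) by auto
  have "sum_list \<eta> = card ?B"
    using Cons.prems A finA by (simp add: card_Diff_subset)
  then obtain h where h: "h permutes ?B" "cycle_type ?B h = mset \<eta>"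
    using Cons.IH[of ?B] Cons.prems by auto
  obtain c where c: "c permutes A" "cyclic_on c A" using ex_cyclic_on[OF finA neA] .
  define g where "g = c \<circ> h"
  have "cyclic_on g A"
    unfolding g_def by (rule permutes_comp_preserves_cyclic1[OF h(1) c(2), of A]) auto
  hence orbA: "orbit g x = A" if "x \<in> A" for x using that by (rule orbit_cyclic_eq3)
  have finB: "finite ?B" using Cons.prems(1) by simp
  have subB: "orbit h x \<subseteq> ?B" if "x \<in> ?B" for x using permutes_orbit_subset[OF h(1) that] .
  have orbB: "orbit g x = orbit h x" if x: "x \<in> ?B" for x
  proof (rule orbit_cyclic_eq3)
    show "cyclic_on g (orbit h x)"
      unfolding g_def
      by (rule permutes_comp_preserves_cyclic2[OF c(1) cyclic_on_orbit[OF h(1) finB], of ?B])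
         (use subB[OF x] in auto)
    show "x \<in> orbit h x"
      by (rule permutation_self_in_orbit) (use h(1) finB in \<open>auto simp: permutation_permutes\<close>)
  qed
  have "orbit g ` Y = orbit g ` A \<union> orbit g ` ?B" using A(1) by blast
  also have "orbit g ` A = {A}" using orbA neA by auto
  also have "orbit g ` ?B = orbit h ` ?B" using orbB by simp
  finally have orb: "orbit g ` Y = insert A (orbit h ` ?B)" by simp
  have "A \<notin> orbit h ` ?B"
  proof
    assume "A \<in> orbit h ` ?B"
    then obtain x where x: "x \<in> ?B" "A = orbit h x" by blast
    thus False using subB[OF x(1)] neA by auto
  qed
  hence "cycle_type Y g = add_mset d (mset \<eta>)"
    using h(2) finB A(2) by (simp add: cycle_type_def orb)
  moreover have "g permutes Y"
    unfolding g_def using c(1) h(1) A(1)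
    by (intro permutes_compose) (auto intro: permutes_subset)
  ultimately show ?case by auto
qed

lemma alt_coeff_reindex:
  assumes "bij_betw b A B" "\<And>F. F \<in> A \<Longrightarrow> c' (b F) = c F"
  shows "alt_coeff N B c' \<alpha> = alt_coeff N A c \<alpha>"
  unfolding alt_coeff_def
  by (intro sum.cong[OF refl], subst sum.reindex_bij_betw[OF assms(1), symmetric]) (simp add: assms(2))

text \<open>An invariant map is constant on the orbits of g, hence a coloring of the cycles, and its
  content counts each cycle with its length.\<close>

lemma alt_char_cycle_type:
  assumes Y: "finite Y" and g: "g permutes Y" and type: "cycle_type Y g = mset \<eta>"
  shows "alt_char Y N \<alpha> g = alt_coeff N (colorings N \<eta>) (color_weight \<eta>) \<alpha>"
proof -
  have perm: "permutation g" using Y g by (auto simp: permutation_permutes)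
  let ?n = "length \<eta>"
  obtain os0 where os0: "set os0 = orbit g ` Y" "distinct os0"
    using finite_distinct_list[of "orbit g ` Y"] Y by auto
  have "mset (map card os0) = mset \<eta>"
    using type os0 mset_set_set[OF os0(2)] by (simp add: cycle_type_def)
  hence "mset \<eta> = mset (map card os0)" ..
  \<comment> \<open>The orbits come in an arbitrary order; p rearranges them so that their sizes are
    listed as in \<eta>.\<close>
  then obtain p where p: "p permutes {..<length (map card os0)}" "permute_list p (map card os0) = \<eta>"
    by (rule mset_eq_permutation)
  define os where "os = permute_list p os0"
  have p': "p permutes {..<length os0}" using p(1) by simp
  have os: "set os = orbit g ` Y" "distinct os" "map card os = \<eta>"
    using os0 p' p(2) by (simp_all add: os_def set_permute_list distinct_permute_list permute_list_map)
  have len: "length os = ?n" using os(3) by auto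
  have card_os: "card (os ! k) = \<eta> ! k" if "k < ?n" for k
    using that len os(3) by (metis nth_map)
  define idx where "idx = (\<lambda>y. SOME k. k < ?n \<and> os ! k = orbit g y)"
  have idx: "idx y < ?n" "os ! idx y = orbit g y" if "y \<in> Y" for y
  proof -
    have "orbit g y \<in> set os" using that os(1) by blast
    hence "\<exists>k. k < ?n \<and> os ! k = orbit g y" by (auto simp: in_set_conv_nth len)
    hence "idx y < ?n \<and> os ! idx y = orbit g y" unfolding idx_def by (rule someI_ex)
    thus "idx y < ?n" "os ! idx y = orbit g y" by auto
  qed
  have self: "y \<in> orbit g y" for y by (rule permutation_self_in_orbit[OF perm])
  have eqI: "orbit g x = orbit g y" if "x \<in> orbit g y" for x y
    using orbit_cyclic_eq3[OF cyclic_on_orbit'[OF perm] that] .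
  have os_eq: "os ! k = {y \<in> Y. idx y = k}" if k: "k < ?n" for k
  proof -
    obtain x where x: "x \<in> Y" "os ! k = orbit g x"
      using nth_mem[of k os] k len os(1) by auto
    show ?thesis
    proof (intro equalityI subsetI)
      fix y assume "y \<in> os ! k"
      hence y: "y \<in> orbit g x" using x(2) by simp
      hence yY: "y \<in> Y" using permutes_orbit_subset[OF g x(1)] by blast
      have "os ! idx y = os ! k" using idx(2)[OF yY] eqI[OF y] x(2) by simp
      hence "idx y = k" using nth_eq_iff_index_eq[OF os(2)] idx(1)[OF yY] k len by simp
      thus "y \<in> {y \<in> Y. idx y = k}" using yY by simp
    next
      fix y assume "y \<in> {y \<in> Y. idx y = k}"
      thus "y \<in> os ! k" using idx(2)[of y] self[of y] by auto
    qed
  qed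
  have idx_step: "idx (g y) = idx y" for y
    unfolding idx_def permutation_orbit_step[OF perm] ..
  \<comment> \<open>One point of each orbit, at which an invariant map reveals the color of the
    orbit.\<close>
  define rep where "rep = (\<lambda>k. SOME y. y \<in> os ! k)"
  have rep: "rep k \<in> Y" "idx (rep k) = k" if k: "k < ?n" for k
  proof -
    have "os ! k \<noteq> {}" using nth_mem[of k os] k len os(1) orbit_nonempty by fastforce
    hence "rep k \<in> os ! k" unfolding rep_def by (rule some_in_eq[THEN iffD2])
    thus "rep k \<in> Y" "idx (rep k) = k" using os_eq[OF k] by auto
  qed
  let ?b = "\<lambda>F. \<lambda>y\<in>Y. F (idx y)"
  have gY: "g y \<in> Y \<longleftrightarrow> y \<in> Y" for y using g by (rule permutes_in_image)
  have bij: "bij_betw ?b (colorings N \<eta>) (inv_maps Y {..<N} g)"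
  proof (rule bij_betwI[of _ _ _ "\<lambda>f. \<lambda>k\<in>{..<?n}. f (rep k)"])
    show "?b \<in> colorings N \<eta> \<rightarrow> inv_maps Y {..<N} g"
    proof (rule funcsetI)
      fix F assume F: "F \<in> colorings N \<eta>"
      have "F (idx y) < N" if "y \<in> Y" for y
        using PiE_mem[of F "{..<?n}" "\<lambda>_. {..<N}" "idx y"] F idx(1)[OF that] by (simp add: colorings_def)
      hence "?b F \<in> Y \<rightarrow>\<^sub>E {..<N}" by auto
      moreover have "?b F \<circ> g = ?b F" by (rule ext) (simp add: gY idx_step)
      ultimately show "?b F \<in> inv_maps Y {..<N} g" by (simp add: inv_maps_def)
    qed
    show "(\<lambda>f. \<lambda>k\<in>{..<?n}. f (rep k)) \<in> inv_maps Y {..<N} g \<rightarrow> colorings N \<eta>"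
    proof (rule funcsetI)
      fix f assume f: "f \<in> inv_maps Y {..<N} g"
      have "f (rep k) < N" if "k < ?n" for k
        using PiE_mem[of f Y "\<lambda>_. {..<N}" "rep k"] f rep(1)[OF that] by (simp add: inv_maps_def)
      thus "(\<lambda>k\<in>{..<?n}. f (rep k)) \<in> colorings N \<eta>" by (auto simp: colorings_def)
    qed
    show "(\<lambda>k\<in>{..<?n}. ?b F (rep k)) = F" if "F \<in> colorings N \<eta>" for F
    proof
      fix k show "(\<lambda>k\<in>{..<?n}. ?b F (rep k)) k = F k"
        using rep[of k] PiE_arb[of F "{..<?n}" "\<lambda>_. {..<N}" k] that
        by (cases "k < ?n") (simp_all add: colorings_def)
    qed
    show "?b (\<lambda>k\<in>{..<?n}. f (rep k)) = f" if f: "f \<in> inv_maps Y {..<N} g" for f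
    proof
      fix y
      have step: "f (g x) = f x" for x
        using f by (simp add: inv_maps_def) (metis comp_apply)
      have orb: "f x = f y" if "x \<in> orbit g y" for x
        using that by induction (simp_all add: step)
      show "?b (\<lambda>k\<in>{..<?n}. f (rep k)) y = f y"
      proof (cases "y \<in> Y")
        case True
        have "rep (idx y) \<in> os ! idx y" using os_eq[OF idx(1)[OF True]] rep[OF idx(1)[OF True]] by simp
        hence "f (rep (idx y)) = f y" using idx(2)[OF True] orb by simp
        thus ?thesis using True idx(1)[OF True] by simp
      next
        case False
        thus ?thesis using PiE_arb[of f Y "\<lambda>_. {..<N}" y] f by (simp add: inv_maps_def)
      qed
    qed
  qed
  have weight: "occ Y (?b F) = color_weight \<eta> F" for F
  proof
    fix i
    have "{y \<in> Y. ?b F y = i} = (\<Union>k\<in>{k. k < ?n \<and> F k = i}. os ! k)"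
      using idx(1) os_eq by auto
    hence "occ Y (?b F) i = card (\<Union>k\<in>{k. k < ?n \<and> F k = i}. os ! k)" by (simp only: occ_def)
    also have "\<dots> = (\<Sum>k | k < ?n \<and> F k = i. card (os ! k))"
    proof (rule card_UN_disjoint)
      show "\<forall>k\<in>{k. k < ?n \<and> F k = i}. finite (os ! k)" using os_eq Y by simp
      show "\<forall>k\<in>{k. k < ?n \<and> F k = i}. \<forall>j\<in>{k. k < ?n \<and> F k = i}. k \<noteq> j \<longrightarrow> os ! k \<inter> os ! j = {}"
        using os_eq by auto
    qed simp
    also have "\<dots> = color_weight \<eta> F i"
      unfolding color_weight_def by (rule sum.cong[OF refl]) (simp add: card_os)
    finally show "occ Y (?b F) i = color_weight \<eta> F i" .
  qed
  show ?thesis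
    unfolding alt_char_def by (rule alt_coeff_reindex[OF bij]) (rule weight)
qed

text \<open>Frobenius' formula. As N occurs only on the right, it also shows that the coefficient is
  stable for N \<ge> n.\<close>

lemma chi_eq_alt_coeff:
  assumes \<rho>: "\<rho> \<in> partitions n" and \<eta>: "\<eta> \<in> partitions n" and N: "n \<le> N"
  shows "chi \<rho> \<eta> = of_int (alt_coeff N (colorings N \<eta>) (color_weight \<eta>) (beta N \<rho>))"
proof -
  let ?Y = "young_diagram \<rho>"
  define g where "g = (SOME g. g permutes ?Y \<and> cycle_type ?Y g = mset \<eta>)"
  have "\<exists>g. g permutes ?Y \<and> cycle_type ?Y g = mset \<eta>"
    by (rule ex_cycle_type) (use \<eta> card_young_diagram[OF \<rho>] in \<open>auto simp: partitions_def\<close>)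
  hence g: "g permutes ?Y \<and> cycle_type ?Y g = mset \<eta>" unfolding g_def by (rule someI_ex)
  have "length \<rho> \<le> N" using partition_length_le[OF \<rho>] N by simp
  hence "chi \<rho> \<eta> = of_int (alt_char ?Y N (beta N \<rho>) g)"
    using irr_character_eq_alt_char[OF \<rho> _ conjunct1[OF g]] by (simp add: chi_def g_def)
  also have "alt_char ?Y N (beta N \<rho>) g = alt_coeff N (colorings N \<eta>) (color_weight \<eta>) (beta N \<rho>)"
    using g by (intro alt_char_cycle_type) auto
  finally show ?thesis .
qed

section \<open>The generating function\<close>

lemma prod_nth_eq_prod_count:
  fixes f :: "nat \<Rightarrow> 'b::comm_monoid_mult"
  shows "(\<Prod>k<length xs. f (xs ! k)) = (\<Prod>d\<in>set xs. f d ^ count_list xs d)"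
proof -
  have "(\<Prod>k<length xs. f (xs ! k)) = prod_list (map f xs)"
    by (simp add: prod.list_conv_set_nth atLeast0LessThan)
  also have "\<dots> = (\<Prod>d\<in>set xs. f d ^ count_list xs d)"
    by (simp add: prod_mset_prod_list[symmetric] image_prod_mset_multiplicity count_mset)
  finally show ?thesis .
qed

text \<open>For Im z < 0 the modulus exp (Im z) of q is less than 1. The factor w^n distributes over
  the parts of \<eta>, which add up to n, and turns each factor 1 / (1 - q^d) into a sine term;
  \<open>zee\<close> contributes the factorials of the multiplicities and the denominators
  d.\<close>

lemma character_sum:
  assumes \<eta>: "\<eta> \<in> partitions n" and z: "Im z < 0"
  shows "(\<Sum>\<rho>\<in>partitions n. exp (1 / 4 * of_int (kappa \<rho>) * \<i> * z) /
      (\<Prod>e\<in>young_diagram \<rho>. 2 * sin (of_int (hook_length \<rho> e) * z / 2)) * (chi \<rho> \<eta> / of_nat (zee \<eta>))) =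
    (\<Prod>d\<in>set \<eta>. (- (\<i> ^ (d + 1) / (2 * of_nat d * sin (of_nat d * z / 2)))) ^ count_list \<eta> d /
      fact (count_list \<eta> d))"
proof -
  define q where "q = exp (- \<i> * z)"
  define w where "w = \<i> * exp (- \<i> * z / 2)"
  let ?s = "\<lambda>d. - (\<i> ^ (d + 1) / (2 * sin (of_nat d * z / 2)))"
  have q: "norm q < 1" "q \<noteq> 0" using z by (auto simp: q_def)
  have pos: "0 < d" if "d \<in> set \<eta>" for d using that \<eta> by (auto simp: partitions_def intro: gr0I)
  have "(\<Sum>\<rho>\<in>partitions n. exp (1 / 4 * of_int (kappa \<rho>) * \<i> * z) /
      (\<Prod>e\<in>young_diagram \<rho>. 2 * sin (of_int (hook_length \<rho> e) * z / 2)) * (chi \<rho> \<eta> / of_nat (zee \<eta>))) =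
      (\<Sum>\<rho>\<in>partitions n. w ^ n / of_nat (zee \<eta>) * (chi \<rho> \<eta> * (q ^ nrow \<rho> / hook_prod q \<rho>)))"
  proof (rule sum.cong[OF refl])
    fix \<rho> assume "\<rho> \<in> partitions n"
    note h = hook_term[OF this, of z, folded q_def w_def]
    show "exp (1 / 4 * of_int (kappa \<rho>) * \<i> * z) /
        (\<Prod>e\<in>young_diagram \<rho>. 2 * sin (of_int (hook_length \<rho> e) * z / 2)) * (chi \<rho> \<eta> / of_nat (zee \<eta>)) =
        w ^ n / of_nat (zee \<eta>) * (chi \<rho> \<eta> * (q ^ nrow \<rho> / hook_prod q \<rho>))"
      unfolding h by (simp add: mult_ac)
  qed
  also have "\<dots> = w ^ n / of_nat (zee \<eta>) * (\<Sum>\<rho>\<in>partitions n. chi \<rho> \<eta> * (q ^ nrow \<rho> / hook_prod q \<rho>))"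
    by (rule sum_distrib_left[symmetric])
  also have "(\<Sum>\<rho>\<in>partitions n. chi \<rho> \<eta> * (q ^ nrow \<rho> / hook_prod q \<rho>)) =
      (\<Prod>k<length \<eta>. 1 / (1 - q ^ (\<eta> ! k)))"
    by (rule principal_specialization[OF \<eta> q]) (simp add: chi_eq_alt_coeff[OF _ \<eta>])
  also have "w ^ n = (\<Prod>k<length \<eta>. w ^ (\<eta> ! k))"
    using \<eta> by (simp add: power_sum[symmetric] partitions_def sum_list_sum_nth atLeast0LessThan)
  also have "(\<Prod>k<length \<eta>. w ^ (\<eta> ! k)) / of_nat (zee \<eta>) * (\<Prod>k<length \<eta>. 1 / (1 - q ^ (\<eta> ! k))) =
      (\<Prod>k<length \<eta>. w ^ (\<eta> ! k) / (1 - q ^ (\<eta> ! k))) / of_nat (zee \<eta>)"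
    by (simp add: prod_dividef)
  also have "(\<Prod>k<length \<eta>. w ^ (\<eta> ! k) / (1 - q ^ (\<eta> ! k))) = (\<Prod>k<length \<eta>. ?s (\<eta> ! k))"
  proof (rule prod.cong[OF refl])
    fix k assume "k \<in> {..<length \<eta>}"
    hence "1 \<le> \<eta> ! k" using pos[of "\<eta> ! k"] by (simp add: Suc_le_eq)
    thus "w ^ (\<eta> ! k) / (1 - q ^ (\<eta> ! k)) = ?s (\<eta> ! k)"
      unfolding w_def q_def by (rule power_sum_term[symmetric])
  qed
  also have "\<dots> = (\<Prod>d\<in>set \<eta>. ?s d ^ count_list \<eta> d)"
    by (rule prod_nth_eq_prod_count)
  also have "\<dots> / of_nat (zee \<eta>) = (\<Prod>d\<in>set \<eta>. ?s d ^ count_list \<eta> d /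
      (fact (count_list \<eta> d) * of_nat d ^ count_list \<eta> d))"
    by (simp add: zee_def prod_dividef)
  also have "\<dots> = (\<Prod>d\<in>set \<eta>. (- (\<i> ^ (d + 1) / (2 * of_nat d * sin (of_nat d * z / 2)))) ^ count_list \<eta> d /
      fact (count_list \<eta> d))"
  proof (rule prod.cong[OF refl])
    fix d assume "d \<in> set \<eta>"
    have "- (\<i> ^ (d + 1) / (2 * of_nat d * sin (of_nat d * z / 2))) = ?s d / of_nat d"
      by simp
    thus "?s d ^ count_list \<eta> d / (fact (count_list \<eta> d) * of_nat d ^ count_list \<eta> d) =
        (- (\<i> ^ (d + 1) / (2 * of_nat d * sin (of_nat d * z / 2)))) ^ count_list \<eta> d / fact (count_list \<eta> d)"
      by (simp only: power_divide divide_divide_eq_left mult.commute)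
  qed
  finally show ?thesis .
qed

lemma partition_eqI:
  assumes "\<eta> \<in> partitions n" "\<eta>' \<in> partitions n" "mset \<eta> = mset \<eta>'"
  shows "\<eta> = \<eta>'"
proof -
  have s: "sort (rev \<eta>) = rev \<eta>" "sort (rev \<eta>') = rev \<eta>'"
    using assms(1,2) by (auto simp: partitions_def sorted_wrt_rev intro!: sorted_sort_id)
  have "sort (rev \<eta>) = sort (rev \<eta>')"
    using assms(3) by (simp flip: sorted_list_of_multiset_mset)
  hence "rev \<eta> = rev \<eta>'" by (simp only: s)
  thus ?thesis by (simp only: rev_is_rev_conv)
qed

lemma ex_partition_mset:
  assumes "0 \<notin># m"
  obtains \<eta> where "\<eta> \<in> partitions (sum_mset m)" "mset \<eta> = m"
proof -
  let ?\<eta> = "rev (sorted_list_of_multiset m)"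
  have m: "mset ?\<eta> = m" by simp
  have "sum_list ?\<eta> = sum_mset m" using m by (metis sum_mset_sum_list)
  moreover have "0 \<notin> set ?\<eta>" using assms m by (metis set_mset_mset)
  moreover have "sorted_wrt (\<ge>) ?\<eta>"
    by (simp add: sorted_wrt_rev)
  ultimately have "?\<eta> \<in> partitions (sum_mset m)" by (simp add: partitions_def)
  thus ?thesis using m that by blast
qed

theorem theorem3p3:
  "mfps_log
     (mfps_sum
       (\<lambda>n. \<Sum>\<rho>\<in>partitions n. \<Sum>\<eta>\<in>partitions n.
          mfps_const (mero (\<lambda>z.
              exp (1 / 4 * of_int (kappa \<rho>) * \<i> * z) /
              (\<Prod>e\<in>young_diagram \<rho>. 2 * sin (of_int (hook_length \<rho> e) * z / 2)) *
              (chi \<rho> \<eta> / of_nat (zee \<eta>)))) *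
          prod_list (map mfps_var \<eta>))
       {0..})
   = - mfps_sum
        (\<lambda>d. mfps_const (mero (\<lambda>z. \<i> ^ (d + 1) / (2 * of_nat d * sin (of_nat d * z / 2)))) * mfps_var d)
        {1..}"
proof -
  define T where "T = (\<lambda>\<rho> \<eta> z. exp (1 / 4 * of_int (kappa \<rho>) * \<i> * z) /
    (\<Prod>e\<in>young_diagram \<rho>. 2 * sin (of_int (hook_length \<rho> e) * z / 2)) * (chi \<rho> \<eta> / of_nat (zee \<eta>)))"
  define C where "C = (\<lambda>d z. \<i> ^ (d + 1) / (2 * of_nat d * sin (of_nat d * z / 2)))"
  define S where "S = (\<lambda>n. \<Sum>\<rho>\<in>partitions n. \<Sum>\<eta>\<in>partitions n.
    mfps_const (mero (T \<rho> \<eta>)) * prod_list (map mfps_var \<eta>))"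
  have T_mero: "T \<rho> \<eta> meromorphic_on UNIV" for \<rho> \<eta>
    unfolding T_def by (intro meromorphic_intros meromorphic_sin_mult)
  have C_mero: "C d meromorphic_on UNIV" for d
    unfolding C_def by (intro meromorphic_intros meromorphic_sin_mult)
  have factor: "(- mero (C d)) ^ k / of_nat j = mero (\<lambda>z. (- C d z) ^ k / of_nat j)"
    "(\<lambda>z. (- C d z) ^ k / of_nat j) meromorphic_on UNIV" for d k j
  proof -
    have 1: "(\<lambda>z. - C d z) meromorphic_on UNIV" by (intro meromorphic_intros C_mero)
    have 2: "(\<lambda>z. (- C d z) ^ k) meromorphic_on UNIV" by (intro meromorphic_intros 1)
    show "(- mero (C d)) ^ k / of_nat j = mero (\<lambda>z. (- C d z) ^ k / of_nat j)"
      unfolding mero_uminus[OF C_mero] mero_power[OF 1] by (rule mero_divide_of_nat[OF 2])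
    show "(\<lambda>z. (- C d z) ^ k / of_nat j) meromorphic_on UNIV" by (intro meromorphic_intros 2)
  qed
  have S_coeff: "mfps_coeff (S n) m =
      (\<Sum>\<rho>\<in>partitions n. \<Sum>\<eta>\<in>partitions n. if m = mset \<eta> then mero (T \<rho> \<eta>) else 0)" for n m
    unfolding S_def mfps_coeff_sum mfps_coeff_const_mult mfps_coeff_prod_list_var
    by (intro sum.cong refl) auto
  have coeff: "mfps_coeff (mfps_sum S {0..}) m = (if 0 \<in># m then 0 else
      (\<Prod>d\<in>set_mset m. (- mero (C d)) ^ count m d / fact (count m d)))" for m
  proof -
    \<comment> \<open>A monomial determines the only n and the only \<eta> that can contribute to
      it: the sum of its indices and their decreasing arrangement.\<close>
    let ?n = "sum_mset m"
    have "mfps_coeff (mfps_sum S {0..}) m = (\<Sum>n\<in>{?n}. mfps_coeff (S n) m)"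
      by (rule mfps_coeff_mfps_sum_superset)
         (auto simp: S_coeff partitions_def sum_mset_sum_list intro!: sum.neutral)
    also have "\<dots> = (if 0 \<in># m then 0 else
      (\<Prod>d\<in>set_mset m. (- mero (C d)) ^ count m d / fact (count m d)))"
    proof (cases "0 \<in># m")
      \<comment> \<open>Parts are positive, so the variable of index 0 never occurs.\<close>
      case True
      thus ?thesis by (auto simp: S_coeff partitions_def intro!: sum.neutral)
    next
      case False
      obtain \<eta> where \<eta>: "\<eta> \<in> partitions ?n" "mset \<eta> = m" using ex_partition_mset[OF False] .
      have "(\<Sum>n\<in>{?n}. mfps_coeff (S n) m) = (\<Sum>\<rho>\<in>partitions ?n. mero (T \<rho> \<eta>))"
        unfolding S_coeff sum.empty sum.insert_remove[OF finite.emptyI]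
      proof (simp, rule sum.cong[OF refl])
        fix \<rho>
        have "(\<Sum>\<eta>'\<in>partitions ?n. if m = mset \<eta>' then mero (T \<rho> \<eta>') else 0) =
            (\<Sum>\<eta>'\<in>{\<eta>}. mero (T \<rho> \<eta>'))"
          by (rule sum.mono_neutral_cong_right) (use \<eta> partition_eqI[OF \<eta>(1)] in auto)
        thus "(\<Sum>\<eta>'\<in>partitions ?n. if m = mset \<eta>' then mero (T \<rho> \<eta>') else 0) = mero (T \<rho> \<eta>)" by simp
      qed
      also have "\<dots> = mero (\<lambda>z. \<Sum>\<rho>\<in>partitions ?n. T \<rho> \<eta> z)"
        by (rule mero_sum) (rule T_mero)
      \<comment> \<open>The two sides agree on the lower half-plane, where q lies in the unit disc,
        and hence as meromorphic functions.\<close>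
      also have "\<dots> = mero (\<lambda>z. \<Prod>d\<in>set_mset m. (- C d z) ^ count m d / of_nat (fact (count m d)))"
      proof (rule mero_eqI[of _ _ "{z. Im z < 0}"])
        show "open {z. Im z < 0}" by (rule open_halfspace_Im_lt)
        show "{z. Im z < 0} \<noteq> {}" by (auto intro!: exI[of _ "- \<i>"])
        fix z assume "z \<in> {z. Im z < 0}"
        hence "Im z < 0" by simp
        from character_sum[OF \<eta>(1) this]
        show "(\<Sum>\<rho>\<in>partitions ?n. T \<rho> \<eta> z) =
            (\<Prod>d\<in>set_mset m. (- C d z) ^ count m d / of_nat (fact (count m d)))"
          by (simp add: T_def C_def \<eta>(2)[symmetric] count_mset)
      qed (intro meromorphic_intros T_mero C_mero; simp)+
      also have "\<dots> = (\<Prod>d\<in>set_mset m. (- mero (C d)) ^ count m d / of_nat (fact (count m d)))"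
        unfolding factor(1) by (rule mero_prod[symmetric]) (rule factor(2))
      finally show ?thesis using False by simp
    qed
    finally show ?thesis .
  qed
  have "mfps_log (mfps_sum S {0..}) = mfps_sum (\<lambda>d. mfps_const (- mero (C d)) * mfps_var d) {1..}"
    by (rule mfps_log_exp_linear) (rule coeff)
  also have "\<dots> = - mfps_sum (\<lambda>d. mfps_const (mero (C d)) * mfps_var d) {1..}"
    by (rule mfps_eqI) (simp add: mfps_coeff_minus mfps_coeff_mfps_sum mfps_coeff_const_mult sum_negf)
  finally show ?thesis unfolding S_def T_def C_def .
qed

end
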